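(* Let $n\ge3$ and let $S_n$ act on $V=W^*\oplus W$ with basis $\mathcal{B}=\{x_1,\dots,x_n,y_1,\dots,y_n\}$ by the doubled permutation representation. Suppose $a,a^\perp,b,b^\perp,c,\alpha,\beta\in\mathbb{C}$ satisfy $$\alpha a+\beta\big(a+(n-2)a^\perp\big)=0,\qquad \alpha a^\perp+\beta\big(2a+(n-3)a^\perp\big)=0,$$ $$\alpha b+\beta\big(b+(n-2)b^\perp\big)=0,\qquad \alpha b^\perp+\beta\big(2b+(n-3)b^\perp\big)=0.$$ Let $\kappa^L$ (linear) and $\kappa^C$ (constant) be the cochains such that for $1\le i\ne j\le n$ $$\kappa^L(x_i,x_j)=\kappa^L(y_i,y_j)=0,$$ $$\kappa^L(x_i,y_i)=\sum_{k\ne i}\big((a-a^\perp)(x_i+x_k)+a^\perp x_{[n]}+(b-b^\perp)(y_i+y_k)+b^\perp y_{[n]}\big)\otimes(ik),$$ $$\kappa^L(x_i,y_j)=-\big((a-a^\perp)(x_i+x_j)+a^\perp x_{[n]}+(b-b^\perp)(y_i+y_j)+b^\perp y_{[n]}\big)\otimes(ij),$$ and $$\kappa^C(x_i,y_j)=\beta-c\,(ij)-(a-a^\perp)(b-b^\perp)\sum_{k\ne i,j}\big((ijk)-(kji)\big),$$ $$\kappa^C(x_i,x_j)=(b-b^\perp)^2\sum_{k\ne i,j}\big((ijk)-(kji)\big),\qquad \kappa^C(y_i,y_j)=(a-a^\perp)^2\sum_{k\ne i,j}\big((ijk)-(kji)\big),$$ $$\kappa^C(x_i,y_i)=\alpha+c\sum_{k\ne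 i}(ik).$$ Then the quotient $\mathcal{H}_{\kappa,t}$ of $T(V)\#S_n[t]$ by the ideal generated by $\{uv-vu-\kappa^L(u,v)t-\kappa^C(u,v)t^2\mid u,v\in\mathcal{B}\}$ is a Drinfeld orbifold algebra over $\mathbb{C}[t]$. Further, the algebras $\mathcal{H}_{\kappa,1}$ (the specializations at $t=1$) are precisely the Drinfeld orbifold algebras such that $\mathrm{im}\,\kappa^L_g\subseteq V^g$ for each $g\in S_n$ and $\kappa^L$ is supported only off the identity.
   Context: For a finite group $G$ acting linearly on a finite-dimensional complex vector space $V$ (action ${}^{g}v$, fixed space $V^g$), and a $\mathbb{C}$-algebra $R$ with $G$-action by automorphisms, $R\#G$ is $R\otimes\mathbb{C}G$ with product $(r\otimes g)(s\otimes h)=r({}^{g}s)\otimes gh$. A 2-cochain is $\kappa=\sum_{g\in G}\kappa_g g$ with components $\kappa_g:\bigwedge^2V\to S(V)$ linear (skew-symmetric bilinear maps; $\kappa(u,v)=\sum_g\kappa_g(u,v)\otimes g$); it is linear if every $\kappa_g$ maps into $V$, constant if every $\kappa_g$ maps into $\mathbb{C}$. It is supported only off the identity if $\kappa_1=0$. For $\kappa=\kappa^L+\kappa^C$ with $\kappa^L$ linear and $\kappa^C$ constant, $\mathcal{H}_\kappa=T(V)\#G/\langle vw-wv-\kappa^L(v,w)-\kappa^C(v,w)\mid v,w\in V\rangle$ is a Drinfeld orbifold algebra if its associated graded algebra (elements of $V$ in degree one, of $G$ in degree zero) is isomorphic to $S(V)\#G$. In that case $\mathcal{H}_{\kappa,t}=T(V)\#G[t]/\langle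 vw-wv-\kappa^L(v,w)t-\kappa^C(v,w)t^2\mid v,w\in V\rangle$ is called a Drinfeld orbifold algebra over $\mathbb{C}[t]$. $W\cong\mathbb{C}^n$ has basis $y_1,\dots,y_n$, $W^*$ has dual basis $x_1,\dots,x_n$, and ${}^{\sigma}y_i=y_{\sigma(i)}$, ${}^{\sigma}x_i=x_{\sigma(i)}$; $x_{[n]}=\sum x_i$, $y_{[n]}=\sum y_i$. Sums over $k$ run over $k\in\{1,\dots,n\}$ with the stated exclusions. *)

theory Defs
  imports
    "HOL-Analysis.Analysis"
    "HOL-Algebra.QuotRing"
    "HOL-Algebra.UnivPoly"
    "HOL-Combinatorics.Perm"
    "HOL-Library.Poly_Mapping"
begin

text \<open>
  A finite-dimensional complex vector space \<open>V\<close> is given with a basis indexed by a finite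
  type, \<open>V = complex ^ 'b\<close>; a finite group is a finite type with group operations.
\<close>

class finite_group = finite + monoid_mult + inverse +
  assumes finite_group_left_inverse: "inverse g * g = 1"

instance perm :: (finite) finite
proof
  have "inj (Perm.apply :: 'a perm \<Rightarrow> 'a \<Rightarrow> 'a)"
    by (simp add: inj_def perm_eq_iff fun_eq_iff)
  then show "finite (UNIV :: 'a perm set)"
    using finite_imageD finite by blast
qed

instance perm :: (finite) finite_group
  by standard simp


subsection \<open>Tensor and symmetric algebra\<close>

text \<open>
  \<open>T(V)\<close> is the free algebra on the basis of \<open>V\<close>, i.e. the monoid algebra of the free monoid;
  \<open>S(V)\<close> is the polynomial ring on the basis.  Both products are the convolution product of
  \<^type>\<open>poly_mapping\<close>, so that the monoid of words has to be written additively.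
\<close>

datatype 'b fword = FWord (letters: "'b list")

instantiation fword :: (type) monoid_add
begin
definition "0 = FWord []"
definition "v + w = FWord (letters v @ letters w)"
instance by standard (simp_all add: zero_fword_def plus_fword_def)
end

type_synonym 'b tensor_alg = "'b fword \<Rightarrow>\<^sub>0 complex"
type_synonym 'b sym_alg = "('b \<Rightarrow>\<^sub>0 nat) \<Rightarrow>\<^sub>0 complex"

definition scalar :: "complex \<Rightarrow> ('m::zero \<Rightarrow>\<^sub>0 complex)"
  where "scalar c = Poly_Mapping.single 0 c"

definition tensor_vec :: "complex ^ 'b \<Rightarrow> 'b tensor_alg"
  where "tensor_vec v = (\<Sum>b\<in>UNIV. Poly_Mapping.single (FWord [b]) (v $ b))"

definition sym_vec :: "complex ^ 'b \<Rightarrow> 'b sym_alg"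
  where "sym_vec v = (\<Sum>b\<in>UNIV. Poly_Mapping.single (Poly_Mapping.single b 1) (v $ b))"

definition linear_action :: "('g::finite_group \<Rightarrow> complex ^ 'b \<Rightarrow> complex ^ 'b) \<Rightarrow> bool"
  where "linear_action \<rho> \<longleftrightarrow> (\<forall>g. Vector_Spaces.linear (*s) (*s) (\<rho> g)) \<and>
           \<rho> 1 = id \<and> (\<forall>g h. \<rho> (g * h) = \<rho> g \<circ> \<rho> h)"

definition fixed_space :: "('g \<Rightarrow> complex ^ 'b \<Rightarrow> complex ^ 'b) \<Rightarrow> 'g \<Rightarrow> (complex ^ 'b) set"
  where "fixed_space \<rho> g = {v. \<rho> g v = v}"

text \<open>The extensions of \<open>\<rho> g\<close> to algebra endomorphisms of \<open>T(V)\<close> and \<open>S(V)\<close>.\<close>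

definition tensor_act ::
    "('g \<Rightarrow> complex ^ 'b \<Rightarrow> complex ^ 'b) \<Rightarrow> 'g \<Rightarrow> 'b tensor_alg \<Rightarrow> 'b tensor_alg"
  where "tensor_act \<rho> g p = (\<Sum>w\<in>Poly_Mapping.keys p. scalar (Poly_Mapping.lookup p w) *
           prod_list (map (\<lambda>b. tensor_vec (\<rho> g (axis b 1))) (letters w)))"

definition sym_act ::
    "('g \<Rightarrow> complex ^ 'b \<Rightarrow> complex ^ 'b) \<Rightarrow> 'g \<Rightarrow> 'b sym_alg \<Rightarrow> 'b sym_alg"
  where "sym_act \<rho> g p = (\<Sum>m\<in>Poly_Mapping.keys p. scalar (Poly_Mapping.lookup p m) *
           (\<Prod>b\<in>UNIV. sym_vec (\<rho> g (axis b 1)) ^ Poly_Mapping.lookup m b))"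


subsection \<open>Skew group algebras\<close>

text \<open>
  An element \<open>\<Sum>\<^sub>g r\<^sub>g \<otimes> g\<close> of \<open>R#G = R \<otimes> \<complex>G\<close> is the function \<open>g \<mapsto> r\<^sub>g\<close>.
\<close>

definition skew_group_ring ::
    "('g::finite_group \<Rightarrow> 'r::ring_1 \<Rightarrow> 'r) \<Rightarrow> ('g \<Rightarrow> 'r) ring"
  where "skew_group_ring act =
    \<lparr>carrier = UNIV,
     mult = (\<lambda>r s k. \<Sum>(g, h)\<in>{(g, h). g * h = k}. r g * act g (s h)),
     one = (\<lambda>g. if g = 1 then 1 else 0),
     zero = (\<lambda>g. 0),
     add = (\<lambda>r s g. r g + s g)\<rparr>"

definition tensor_skew ::
    "('g::finite_group \<Rightarrow> complex ^ 'b \<Rightarrow> complex ^ 'b) \<Rightarrow> ('g \<Rightarrow> 'b tensor_alg) ring"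
  where "tensor_skew \<rho> = skew_group_ring (tensor_act \<rho>)"

definition sym_skew ::
    "('g::finite_group \<Rightarrow> complex ^ 'b \<Rightarrow> complex ^ 'b) \<Rightarrow> ('g \<Rightarrow> 'b sym_alg) ring"
  where "sym_skew \<rho> = skew_group_ring (sym_act \<rho>)"

definition skew_scalar :: "complex \<Rightarrow> ('g::finite_group \<Rightarrow> ('m::zero \<Rightarrow>\<^sub>0 complex))"
  where "skew_scalar c = (\<lambda>g. if g = 1 then scalar c else 0)"

definition skew_vec :: "complex ^ 'b \<Rightarrow> ('g::finite_group \<Rightarrow> 'b tensor_alg)"
  where "skew_vec v = (\<lambda>g. if g = 1 then tensor_vec v else 0)"

text \<open>Elements of \<open>V\<close> have degree one, elements of \<open>G\<close> degree zero.\<close>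

definition tensor_skew_filt :: "nat \<Rightarrow> ('g \<Rightarrow> 'b tensor_alg) set"
  where "tensor_skew_filt m =
           {f. \<forall>g. \<forall>w\<in>Poly_Mapping.keys (f g). length (letters w) \<le> m}"

definition sym_skew_homog :: "nat \<Rightarrow> ('g \<Rightarrow> ('b::finite) sym_alg) set"
  where "sym_skew_homog m =
           {f. \<forall>g. \<forall>k\<in>Poly_Mapping.keys (f g). (\<Sum>b\<in>UNIV. Poly_Mapping.lookup k b) = m}"


subsection \<open>Associated graded algebras\<close>

definition filt_below :: "('a, 'z) ring_scheme \<Rightarrow> (nat \<Rightarrow> 'a set) \<Rightarrow> nat \<Rightarrow> 'a set"
  where "filt_below R F m = (if m = 0 then {\<zero>\<^bsub>R\<^esub>} else F (m - 1))"

text \<open>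
  For a ring with an increasing filtration \<open>F\<close>, this is \<open>\<Oplus>\<^sub>m F\<^sub>m / F\<^sub>m\<^sub>-\<^sub>1\<close>: an element is a
  finitely supported family of cosets, and products are computed on arbitrary representatives
  (as in \<^const>\<open>rcoset_mult\<close>).
\<close>

definition assoc_graded :: "('a, 'z) ring_scheme \<Rightarrow> (nat \<Rightarrow> 'a set) \<Rightarrow> (nat \<Rightarrow> 'a set) ring"
  where "assoc_graded R F =
    \<lparr>carrier = {u. (\<forall>m. \<exists>r\<in>F m. u m = filt_below R F m +>\<^bsub>R\<^esub> r) \<and>
                   finite {m. u m \<noteq> filt_below R F m}},
     mult = (\<lambda>u v m. \<Union>a\<in>{a. \<forall>i. a i \<in> u i}. \<Union>b\<in>{b. \<forall>i. b i \<in> v i}.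
               filt_below R F m +>\<^bsub>R\<^esub> (\<Oplus>\<^bsub>R\<^esub>i\<in>{..m}. a i \<otimes>\<^bsub>R\<^esub> b (m - i))),
     one = (\<lambda>m. filt_below R F m +>\<^bsub>R\<^esub> (if m = 0 then \<one>\<^bsub>R\<^esub> else \<zero>\<^bsub>R\<^esub>)),
     zero = (\<lambda>m. filt_below R F m),
     add = (\<lambda>u v m. u m <+>\<^bsub>R\<^esub> v m)\<rparr>"

definition assoc_graded_homog ::
    "('a, 'z) ring_scheme \<Rightarrow> (nat \<Rightarrow> 'a set) \<Rightarrow> nat \<Rightarrow> (nat \<Rightarrow> 'a set) set"
  where "assoc_graded_homog R F m =
           {u \<in> carrier (assoc_graded R F). \<forall>k. k \<noteq> m \<longrightarrow> u k = filt_below R F k}"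

definition assoc_graded_scalar ::
    "('a, 'z) ring_scheme \<Rightarrow> (nat \<Rightarrow> 'a set) \<Rightarrow> (complex \<Rightarrow> 'a) \<Rightarrow> complex \<Rightarrow> nat \<Rightarrow> 'a set"
  where "assoc_graded_scalar R F \<eta> c =
           (\<lambda>m. filt_below R F m +>\<^bsub>R\<^esub> (if m = 0 then \<eta> c else \<zero>\<^bsub>R\<^esub>))"

text \<open>
  A \<open>\<complex>\<close>-algebra is a ring \<open>R\<close> with its structure map \<open>\<complex> \<rightarrow> R\<close>; a grading is given by the
  family of its homogeneous components.
\<close>

definition graded_algebra_iso ::
    "('a, 'z) ring_scheme \<Rightarrow> (complex \<Rightarrow> 'a) \<Rightarrow> (nat \<Rightarrow> 'a set) \<Rightarrow>
     ('c, 'y) ring_scheme \<Rightarrow> (complex \<Rightarrow> 'c) \<Rightarrow> (nat \<Rightarrow> 'c set) \<Rightarrow> ('a \<Rightarrow> 'c) \<Rightarrow> bool"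
  where "graded_algebra_iso R \<eta> A S \<theta> B \<phi> \<longleftrightarrow>
           \<phi> \<in> ring_iso R S \<and> (\<forall>c. \<phi> (\<eta> c) = \<theta> c) \<and> (\<forall>m. \<phi> ` A m = B m)"


subsection \<open>Drinfeld orbifold algebras\<close>

text \<open>
  The argument \<open>\<kappa>L\<close> (resp. \<open>\<kappa>C\<close>) consists of the components \<open>\<kappa>\<^sub>g\<close> of a cochain that all map
  into \<open>V\<close> (resp. into \<open>\<complex>\<close>).
\<close>

definition skew_bilinear ::
    "(complex \<Rightarrow> 'c \<Rightarrow> 'c) \<Rightarrow> (complex ^ 'b \<Rightarrow> complex ^ 'b \<Rightarrow> 'c::ab_group_add) \<Rightarrow> bool"
  where "skew_bilinear s \<beta> \<longleftrightarrow> (\<forall>u. Vector_Spaces.linear (*s) s (\<beta> u)) \<and>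
           (\<forall>v. Vector_Spaces.linear (*s) s (\<lambda>u. \<beta> u v)) \<and> (\<forall>u v. \<beta> u v = - \<beta> v u)"

definition linear_cochain :: "('g \<Rightarrow> complex ^ 'b \<Rightarrow> complex ^ 'b \<Rightarrow> complex ^ 'b) \<Rightarrow> bool"
  where "linear_cochain \<kappa>L \<longleftrightarrow> (\<forall>g. skew_bilinear (*s) (\<kappa>L g))"

definition constant_cochain :: "('g \<Rightarrow> complex ^ 'b \<Rightarrow> complex ^ 'b \<Rightarrow> complex) \<Rightarrow> bool"
  where "constant_cochain \<kappa>C \<longleftrightarrow> (\<forall>g. skew_bilinear (*) (\<kappa>C g))"

definition cochainL_elem ::
    "('g \<Rightarrow> complex ^ 'b \<Rightarrow> complex ^ 'b \<Rightarrow> complex ^ 'b) \<Rightarrow>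
     complex ^ 'b \<Rightarrow> complex ^ 'b \<Rightarrow> 'g \<Rightarrow> 'b tensor_alg"
  where "cochainL_elem \<kappa>L u v = (\<lambda>g. tensor_vec (\<kappa>L g u v))"

definition cochainC_elem ::
    "('g \<Rightarrow> complex ^ 'b \<Rightarrow> complex ^ 'b \<Rightarrow> complex) \<Rightarrow>
     complex ^ 'b \<Rightarrow> complex ^ 'b \<Rightarrow> 'g \<Rightarrow> 'b tensor_alg"
  where "cochainC_elem \<kappa>C u v = (\<lambda>g. scalar (\<kappa>C g u v))"

definition skew_commutator ::
    "('g::finite_group \<Rightarrow> complex ^ 'b \<Rightarrow> complex ^ 'b) \<Rightarrow>
     complex ^ 'b \<Rightarrow> complex ^ 'b \<Rightarrow> 'g \<Rightarrow> 'b tensor_alg"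
  where "skew_commutator \<rho> u v =
           (skew_vec u \<otimes>\<^bsub>tensor_skew \<rho>\<^esub> skew_vec v) \<ominus>\<^bsub>tensor_skew \<rho>\<^esub>
           (skew_vec v \<otimes>\<^bsub>tensor_skew \<rho>\<^esub> skew_vec u)"

definition H_ideal ::
    "('g::finite_group \<Rightarrow> complex ^ 'b \<Rightarrow> complex ^ 'b) \<Rightarrow>
     ('g \<Rightarrow> complex ^ 'b \<Rightarrow> complex ^ 'b \<Rightarrow> complex ^ 'b) \<Rightarrow>
     ('g \<Rightarrow> complex ^ 'b \<Rightarrow> complex ^ 'b \<Rightarrow> complex) \<Rightarrow> ('g \<Rightarrow> 'b tensor_alg) set"
  where "H_ideal \<rho> \<kappa>L \<kappa>C = Idl\<^bsub>tensor_skew \<rho>\<^esub>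
           {skew_commutator \<rho> u v \<ominus>\<^bsub>tensor_skew \<rho>\<^esub> cochainL_elem \<kappa>L u v
              \<ominus>\<^bsub>tensor_skew \<rho>\<^esub> cochainC_elem \<kappa>C u v | u v. True}"

definition H_alg ::
    "('g::finite_group \<Rightarrow> complex ^ 'b \<Rightarrow> complex ^ 'b) \<Rightarrow>
     ('g \<Rightarrow> complex ^ 'b \<Rightarrow> complex ^ 'b \<Rightarrow> complex ^ 'b) \<Rightarrow>
     ('g \<Rightarrow> complex ^ 'b \<Rightarrow> complex ^ 'b \<Rightarrow> complex) \<Rightarrow> ('g \<Rightarrow> 'b tensor_alg) set ring"
  where "H_alg \<rho> \<kappa>L \<kappa>C = tensor_skew \<rho> Quot H_ideal \<rho> \<kappa>L \<kappa>C"

definition H_class ::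
    "('g::finite_group \<Rightarrow> complex ^ 'b \<Rightarrow> complex ^ 'b) \<Rightarrow>
     ('g \<Rightarrow> complex ^ 'b \<Rightarrow> complex ^ 'b \<Rightarrow> complex ^ 'b) \<Rightarrow>
     ('g \<Rightarrow> complex ^ 'b \<Rightarrow> complex ^ 'b \<Rightarrow> complex) \<Rightarrow>
     ('g \<Rightarrow> 'b tensor_alg) \<Rightarrow> ('g \<Rightarrow> 'b tensor_alg) set"
  where "H_class \<rho> \<kappa>L \<kappa>C f = H_ideal \<rho> \<kappa>L \<kappa>C +>\<^bsub>tensor_skew \<rho>\<^esub> f"

definition H_filt ::
    "('g::finite_group \<Rightarrow> complex ^ 'b \<Rightarrow> complex ^ 'b) \<Rightarrow>
     ('g \<Rightarrow> complex ^ 'b \<Rightarrow> complex ^ 'b \<Rightarrow> complex ^ 'b) \<Rightarrow>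
     ('g \<Rightarrow> complex ^ 'b \<Rightarrow> complex ^ 'b \<Rightarrow> complex) \<Rightarrow> nat \<Rightarrow> ('g \<Rightarrow> 'b tensor_alg) set set"
  where "H_filt \<rho> \<kappa>L \<kappa>C m = H_class \<rho> \<kappa>L \<kappa>C ` tensor_skew_filt m"

definition drinfeld_orbifold_algebra ::
    "('g::finite_group \<Rightarrow> complex ^ ('b::finite) \<Rightarrow> complex ^ 'b) \<Rightarrow>
     ('g \<Rightarrow> complex ^ 'b \<Rightarrow> complex ^ 'b \<Rightarrow> complex ^ 'b) \<Rightarrow>
     ('g \<Rightarrow> complex ^ 'b \<Rightarrow> complex ^ 'b \<Rightarrow> complex) \<Rightarrow> bool"
  where "drinfeld_orbifold_algebra \<rho> \<kappa>L \<kappa>C \<longleftrightarrow>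
    linear_action \<rho> \<and> linear_cochain \<kappa>L \<and> constant_cochain \<kappa>C \<and>
    (\<exists>\<phi>. graded_algebra_iso
           (assoc_graded (H_alg \<rho> \<kappa>L \<kappa>C) (H_filt \<rho> \<kappa>L \<kappa>C))
           (assoc_graded_scalar (H_alg \<rho> \<kappa>L \<kappa>C) (H_filt \<rho> \<kappa>L \<kappa>C)
              (\<lambda>c. H_class \<rho> \<kappa>L \<kappa>C (skew_scalar c)))
           (assoc_graded_homog (H_alg \<rho> \<kappa>L \<kappa>C) (H_filt \<rho> \<kappa>L \<kappa>C))
           (sym_skew \<rho>) skew_scalar sym_skew_homog \<phi>)"


subsection \<open>Drinfeld orbifold algebras over \<open>\<complex>[t]\<close>\<close>

text \<open>
  \<open>T(V)#G[t]\<close> is \<^term>\<open>UP (tensor_skew \<rho>)\<close>.  The set \<open>U\<close> is the range of \<open>u\<close> and \<open>v\<close> in the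
  defining relations: all of \<open>V\<close> in the general definition, or just a basis.
\<close>

definition Ht_ideal ::
    "('g::finite_group \<Rightarrow> complex ^ 'b \<Rightarrow> complex ^ 'b) \<Rightarrow>
     ('g \<Rightarrow> complex ^ 'b \<Rightarrow> complex ^ 'b \<Rightarrow> complex ^ 'b) \<Rightarrow>
     ('g \<Rightarrow> complex ^ 'b \<Rightarrow> complex ^ 'b \<Rightarrow> complex) \<Rightarrow> (complex ^ 'b) set \<Rightarrow>
     (nat \<Rightarrow> 'g \<Rightarrow> 'b tensor_alg) set"
  where "Ht_ideal \<rho> \<kappa>L \<kappa>C U = (let P = UP (tensor_skew \<rho>) in Idl\<^bsub>P\<^esub>
           {monom P (skew_commutator \<rho> u v) 0 \<ominus>\<^bsub>P\<^esub> monom P (cochainL_elem \<kappa>L u v) 1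
              \<ominus>\<^bsub>P\<^esub> monom P (cochainC_elem \<kappa>C u v) 2 | u v. u \<in> U \<and> v \<in> U})"

definition Ht_alg ::
    "('g::finite_group \<Rightarrow> complex ^ 'b \<Rightarrow> complex ^ 'b) \<Rightarrow>
     ('g \<Rightarrow> complex ^ 'b \<Rightarrow> complex ^ 'b \<Rightarrow> complex ^ 'b) \<Rightarrow>
     ('g \<Rightarrow> complex ^ 'b \<Rightarrow> complex ^ 'b \<Rightarrow> complex) \<Rightarrow> (complex ^ 'b) set \<Rightarrow>
     (nat \<Rightarrow> 'g \<Rightarrow> 'b tensor_alg) set ring"
  where "Ht_alg \<rho> \<kappa>L \<kappa>C U = UP (tensor_skew \<rho>) Quot Ht_ideal \<rho> \<kappa>L \<kappa>C U"

definition drinfeld_orbifold_algebra_t ::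
    "('g::finite_group \<Rightarrow> complex ^ ('b::finite) \<Rightarrow> complex ^ 'b) \<Rightarrow>
     ('g \<Rightarrow> complex ^ 'b \<Rightarrow> complex ^ 'b \<Rightarrow> complex ^ 'b) \<Rightarrow>
     ('g \<Rightarrow> complex ^ 'b \<Rightarrow> complex ^ 'b \<Rightarrow> complex) \<Rightarrow>
     (nat \<Rightarrow> 'g \<Rightarrow> 'b tensor_alg) set ring \<Rightarrow> bool"
  where "drinfeld_orbifold_algebra_t \<rho> \<kappa>L \<kappa>C H \<longleftrightarrow>
           drinfeld_orbifold_algebra \<rho> \<kappa>L \<kappa>C \<and> H = Ht_alg \<rho> \<kappa>L \<kappa>C UNIV"

text \<open>
  The specialization of \<open>A[t]/I\<close> at \<open>t = \<tau>\<close>, i.e. \<open>A[t]/(I + (t - \<tau>))\<close>, presented as the quotient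
  of \<open>A\<close> by the image of \<open>I\<close> under the evaluation \<open>t \<mapsto> \<tau>\<close>.
\<close>

definition Ht_specialization ::
    "('g::finite_group \<Rightarrow> complex ^ 'b \<Rightarrow> complex ^ 'b) \<Rightarrow>
     ('g \<Rightarrow> complex ^ 'b \<Rightarrow> complex ^ 'b \<Rightarrow> complex ^ 'b) \<Rightarrow>
     ('g \<Rightarrow> complex ^ 'b \<Rightarrow> complex ^ 'b \<Rightarrow> complex) \<Rightarrow> (complex ^ 'b) set \<Rightarrow> complex \<Rightarrow>
     ('g \<Rightarrow> 'b tensor_alg) set ring"
  where "Ht_specialization \<rho> \<kappa>L \<kappa>C U \<tau> = tensor_skew \<rho> Quot
           (UnivPoly.eval (tensor_skew \<rho>) (tensor_skew \<rho>) (\<lambda>a. a) (skew_scalar \<tau>)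
              ` Ht_ideal \<rho> \<kappa>L \<kappa>C U)"


subsection \<open>The doubled permutation representation\<close>

text \<open>
  The basis of \<open>V = W* \<oplus> W\<close> is indexed by \<open>'n + 'n\<close>: \<^term>\<open>Inl i\<close> for \<open>x\<^sub>i\<close> and \<^term>\<open>Inr i\<close>
  for \<open>y\<^sub>i\<close>, where \<open>'n\<close> plays the role of \<open>{1, \<dots>, n}\<close>.
\<close>

definition x_vec :: "'n::finite \<Rightarrow> complex ^ ('n + 'n)"
  where "x_vec i = axis (Inl i) 1"

definition y_vec :: "'n::finite \<Rightarrow> complex ^ ('n + 'n)"
  where "y_vec i = axis (Inr i) 1"

definition xy_basis :: "(complex ^ ('n::finite + 'n)) set"
  where "xy_basis = range x_vec \<union> range y_vec"

definition doubled_perm_rep :: "'n::finite perm \<Rightarrow> complex ^ ('n + 'n) \<Rightarrow> complex ^ ('n + 'n)"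
  where "doubled_perm_rep \<sigma> v =
    (\<chi> p. v $ map_sum (Perm.apply (inverse \<sigma>)) (Perm.apply (inverse \<sigma>)) p)"

lemma doubled_perm_rep_basis:
  "doubled_perm_rep \<sigma> (x_vec i) = x_vec (Perm.apply \<sigma> i)"
  "doubled_perm_rep \<sigma> (y_vec i) = y_vec (Perm.apply \<sigma> i)"
proof -
  have *: "Perm.apply (inverse \<sigma>) j = i \<longleftrightarrow> j = Perm.apply \<sigma> i" for j
    by (metis apply_sequence perm.left_inverse perm.right_inverse apply_one id_apply)
  show "doubled_perm_rep \<sigma> (x_vec i) = x_vec (Perm.apply \<sigma> i)"
    by (auto simp: doubled_perm_rep_def x_vec_def vec_eq_iff axis_def map_sum_def * split: sum.split)
  show "doubled_perm_rep \<sigma> (y_vec i) = y_vec (Perm.apply \<sigma> i)"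
    by (auto simp: doubled_perm_rep_def y_vec_def vec_eq_iff axis_def map_sum_def * split: sum.split)
qed


subsection \<open>The cochains\<close>

definition kappa_vec ::
    "complex \<Rightarrow> complex \<Rightarrow> complex \<Rightarrow> complex \<Rightarrow> 'n::finite \<Rightarrow> 'n \<Rightarrow> complex ^ ('n + 'n)"
  where "kappa_vec a a' b b' i k =
    (a - a') *s (x_vec i + x_vec k) + a' *s (\<Sum>m\<in>UNIV. x_vec m) +
    (b - b') *s (y_vec i + y_vec k) + b' *s (\<Sum>m\<in>UNIV. y_vec m)"

text \<open>
  Values on pairs of basis vectors, extended bilinearly below; the last argument \<open>g\<close> selects the component \<open>\<kappa>\<^sub>g\<close>.  The cycle
  \<open>(ijk)\<close>, which maps \<open>i\<close> to \<open>j\<close> and \<open>j\<close> to \<open>k\<close>, is \<^term>\<open>Perm.cycle [i, j, k]\<close>.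
\<close>

definition kappaL_xy ::
    "complex \<Rightarrow> complex \<Rightarrow> complex \<Rightarrow> complex \<Rightarrow>
     'n::finite \<Rightarrow> 'n \<Rightarrow> 'n perm \<Rightarrow> complex ^ ('n + 'n)"
  where "kappaL_xy a a' b b' i j g =
     (if i = j
      then \<Sum>k\<in>- {i}. of_bool (g = Perm.swap i k) *s kappa_vec a a' b b' i k
      else - (of_bool (g = Perm.swap i j) *s kappa_vec a a' b b' i j))"

fun kappaL_basis ::
    "complex \<Rightarrow> complex \<Rightarrow> complex \<Rightarrow> complex \<Rightarrow>
     ('n::finite + 'n) \<Rightarrow> ('n + 'n) \<Rightarrow> 'n perm \<Rightarrow> complex ^ ('n + 'n)"
  where
  "kappaL_basis a a' b b' (Inl i) (Inl j) g = 0"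
| "kappaL_basis a a' b b' (Inr i) (Inr j) g = 0"
| "kappaL_basis a a' b b' (Inl i) (Inr j) g = kappaL_xy a a' b b' i j g"
| "kappaL_basis a a' b b' (Inr j) (Inl i) g = - kappaL_xy a a' b b' i j g"

definition three_cycles :: "'n::finite \<Rightarrow> 'n \<Rightarrow> 'n perm \<Rightarrow> complex"
  where "three_cycles i j g =
    (\<Sum>k\<in>- {i, j}. of_bool (g = Perm.cycle [i, j, k]) - of_bool (g = Perm.cycle [k, j, i]))"

definition kappaC_xy ::
    "complex \<Rightarrow> complex \<Rightarrow> complex \<Rightarrow> complex \<Rightarrow> complex \<Rightarrow> complex \<Rightarrow> complex \<Rightarrow>
     'n::finite \<Rightarrow> 'n \<Rightarrow> 'n perm \<Rightarrow> complex"
  where "kappaC_xy a a' b b' c \<alpha> \<beta> i j g =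
     (if i = j
      then \<alpha> * of_bool (g = 1) + c * (\<Sum>k\<in>- {i}. of_bool (g = Perm.swap i k))
      else \<beta> * of_bool (g = 1) - c * of_bool (g = Perm.swap i j)
           - (a - a') * (b - b') * three_cycles i j g)"

fun kappaC_basis ::
    "complex \<Rightarrow> complex \<Rightarrow> complex \<Rightarrow> complex \<Rightarrow> complex \<Rightarrow> complex \<Rightarrow> complex \<Rightarrow>
     ('n::finite + 'n) \<Rightarrow> ('n + 'n) \<Rightarrow> 'n perm \<Rightarrow> complex"
  where
  "kappaC_basis a a' b b' c \<alpha> \<beta> (Inl i) (Inl j) g =
     (if i = j then 0 else (b - b')\<^sup>2 * three_cycles i j g)"
| "kappaC_basis a a' b b' c \<alpha> \<beta> (Inr i) (Inr j) g =
     (if i = j then 0 else (a - a')\<^sup>2 * three_cycles i j g)"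
| "kappaC_basis a a' b b' c \<alpha> \<beta> (Inl i) (Inr j) g = kappaC_xy a a' b b' c \<alpha> \<beta> i j g"
| "kappaC_basis a a' b b' c \<alpha> \<beta> (Inr j) (Inl i) g = - kappaC_xy a a' b b' c \<alpha> \<beta> i j g"

definition kappaL ::
    "complex \<Rightarrow> complex \<Rightarrow> complex \<Rightarrow> complex \<Rightarrow>
     'n::finite perm \<Rightarrow> complex ^ ('n + 'n) \<Rightarrow> complex ^ ('n + 'n) \<Rightarrow> complex ^ ('n + 'n)"
  where "kappaL a a' b b' g u v =
    (\<Sum>p\<in>UNIV. \<Sum>q\<in>UNIV. (u $ p * v $ q) *s kappaL_basis a a' b b' p q g)"

definition kappaC ::
    "complex \<Rightarrow> complex \<Rightarrow> complex \<Rightarrow> complex \<Rightarrow> complex \<Rightarrow> complex \<Rightarrow> complex \<Rightarrow>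
     'n::finite perm \<Rightarrow> complex ^ ('n + 'n) \<Rightarrow> complex ^ ('n + 'n) \<Rightarrow> complex"
  where "kappaC a a' b b' c \<alpha> \<beta> g u v =
    (\<Sum>p\<in>UNIV. \<Sum>q\<in>UNIV. (u $ p * v $ q) * kappaC_basis a a' b b' c \<alpha> \<beta> p q g)"

lemma kappaL_axis:
  "kappaL a a' b b' g (axis p 1) (axis q 1) = kappaL_basis a a' b b' p q g"
proof -
  have "kappaL a a' b b' g (axis p 1) (axis q 1) =
      (\<Sum>r\<in>UNIV. \<Sum>s\<in>UNIV. if r = p then if s = q then kappaL_basis a a' b b' r s g else 0 else 0)"
    unfolding kappaL_def by (intro sum.cong refl) (auto simp: axis_def)
  also have "\<dots> = (\<Sum>r\<in>UNIV. if r = p then kappaL_basis a a' b b' r q g else 0)"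
    by (intro sum.cong refl) (auto simp: sum.delta)
  finally show ?thesis by simp
qed

lemma kappaC_axis:
  "kappaC a a' b b' c \<alpha> \<beta> g (axis p 1) (axis q 1) = kappaC_basis a a' b b' c \<alpha> \<beta> p q g"
proof -
  have "kappaC a a' b b' c \<alpha> \<beta> g (axis p 1) (axis q 1) =
      (\<Sum>r\<in>UNIV. \<Sum>s\<in>UNIV.
         if r = p then if s = q then kappaC_basis a a' b b' c \<alpha> \<beta> r s g else 0 else 0)"
    unfolding kappaC_def by (intro sum.cong refl) (auto simp: axis_def)
  also have "\<dots> = (\<Sum>r\<in>UNIV. if r = p then kappaC_basis a a' b b' c \<alpha> \<beta> r q g else 0)"
    by (intro sum.cong refl) (auto simp: sum.delta)
  finally show ?thesis by simp
qed

definition parameter_eqs ::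
    "nat \<Rightarrow> complex \<Rightarrow> complex \<Rightarrow> complex \<Rightarrow> complex \<Rightarrow> complex \<Rightarrow> complex \<Rightarrow> bool"
  where "parameter_eqs n a a' b b' \<alpha> \<beta> \<longleftrightarrow>
    \<alpha> * a + \<beta> * (a + (of_nat n - 2) * a') = 0 \<and>
    \<alpha> * a' + \<beta> * (2 * a + (of_nat n - 3) * a') = 0 \<and>
    \<alpha> * b + \<beta> * (b + (of_nat n - 2) * b') = 0 \<and>
    \<alpha> * b' + \<beta> * (2 * b + (of_nat n - 3) * b') = 0"

end

theory Submission
  imports Defs
begin

text \<open>
  Write \<open>I\<close> for the ideal of \<open>T(V)#S\<^sub>n\<close> that is generated by
  the relations \<open>uv - vu - \<kappa>(u, v)\<close>.  The quotient is a Drinfeld orbifold algebra if and only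
  if no element of \<open>I\<close> has a nonzero leading symbol in \<open>S(V)#S\<^sub>n\<close>.  There are two sources of
  obstructions: moving a group element past a relation, which requires \<open>\<kappa>\<close> to be invariant, and
  the Jacobi sum \<open>\<Sum> [\<kappa>(u, v), w]\<close> over cyclic permutations of \<open>u, v, w\<close>, which lies in \<open>I\<close>.  Modulo
  relations, twice this sum has components of degree two, one and zero (\<open>twice_jacobi\<close>), and each
  of them has to vanish.  These conditions are also sufficient: by the diamond lemma, in the
  form \<open>straightening_exists\<close>, one can construct on words of any bounded length a linear map that
  kills the relations and keeps leading normal forms, because the two ways of resolving
  overlapping exchanges differ by a Jacobi sum.  The result is \<open>drinfeld_iff_conditions\<close>.  An
  isomorphism of the associated graded algebra with \<open>S(V)#S\<^sub>n\<close> is not assumed to be the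
  canonical one; the finite dimension of the homogeneous components takes care of this.

  The component of \<open>\<kappa>\<^sup>L\<close> at \<open>(ij)\<close> is a vector \<open>\<lambda>\<^sub>i\<^sub>j\<close> times the skew
  form \<open>om i j\<close>, the determinant of the coordinate differences.  The composition of two such
  components is concentrated on 3-cycles (\<open>swap_product\<close>) and is balanced by the 3-cycle
  components of \<open>\<kappa>\<^sup>C\<close> through a polynomial identity (\<open>cycle_balance\<close>).  This holds for all values of the
  parameters.  The condition in degree zero reduces to pairing the invariant form
  with values \<open>\<alpha>\<close> and \<open>\<beta>\<close> with the vectors \<open>\<lambda>\<^sub>i\<^sub>j\<close> (\<open>kappa_constant_defect\<close>), and the four parameter
  equations say that these lie in its radical (\<open>invform_kappa_vec\<close>).

  Conversely, if the values of \<open>\<kappa>\<^sup>L\<^sub>g\<close> are fixed by \<open>g\<close>, the condition in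
  degree two splits into one condition for each coordinate (\<open>fixed_cocycle_codiff\<close>).  A skew
  form satisfying the latter at \<open>g \<noteq> 1\<close> is zero unless \<open>g\<close> is a transposition, and then it is a
  multiple of \<open>om i j\<close>.  Invariance under \<open>S\<^sub>n\<close> leaves the parameters \<open>a, a', b, b'\<close> for
  \<open>\<kappa>\<^sup>L\<close>.  The condition in degree one determines \<open>\<kappa>\<^sup>C\<close> up to a solution of the same homogeneous
  condition, hence up to \<open>c, \<alpha>, \<beta>\<close>, and the condition in degree zero gives back the parameter
  equations.

  The relations are bilinear, so those for basis vectors generate the same
  ideal of \<open>T(V)#S\<^sub>n[t]\<close> as all of them (\<open>Ht_alg_basis\<close>), and evaluation at \<open>t = 1\<close> maps this
  ideal onto \<open>I\<close> (\<open>specialization_at_one\<close>).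
\<close>

section \<open>Straightening words by adjacent exchanges\<close>

text \<open>
  The combinatorial core of Bergman's diamond lemma, freed from any algebra.  One wants a
  function \<open>S\<close> on words whose change under the adjacent exchange \<open>u p q v \<rightarrow> u q p v\<close> is a
  prescribed \<open>D u p q v\<close>.  Any two sequences of exchanges with the same effect on words
  differ by far commutations and braid moves, so the assumptions \<open>far\<close> and \<open>braid\<close>, which say
  that \<open>D\<close> is consistent on these, are the only obstructions besides skew-symmetry.  The values on sorted words are
  free and given by \<open>B\<close>.
\<close>

locale exchange_system =
  fixes key :: "'b \<Rightarrow> nat"
    and D :: "'b list \<Rightarrow> 'b \<Rightarrow> 'b \<Rightarrow> 'b list \<Rightarrow> 'z::ab_group_add"
    and B :: "'b list \<Rightarrow> 'z"
  assumes key_inj: "inj key"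
    and diag: "D u p p v = 0"
    and skew: "D u p q v = - D u q p v"
    and far: "D u p q (v @ r # s # w) - D u p q (v @ s # r # w) =
              D (u @ p # q # v) r s w - D (u @ q # p # v) r s w"
    and braid: "D u p q (r # v) + D (u @ [q]) p r v + D u q r (p # v) =
                D (u @ [p]) q r v + D u p r (q # v) + D (u @ [r]) p q v"
begin

text \<open>
  The values reachable by removing descents one at a time.  The function \<open>S\<close> is obtained by
  showing that this relation is functional.
\<close>

inductive val :: "'b list \<Rightarrow> 'z \<Rightarrow> bool" where
  base: "sorted (map key w) \<Longrightarrow> val w (B w)"
| step: "key p < key q \<Longrightarrow> val (u @ p # q # v) z \<Longrightarrow> val (u @ q # p # v) (z + D u q p v)"

text \<open>
  Keys are weighted by the number of letters to the right, because removing a descent moves the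
  larger key to the right.
\<close>

fun disorder :: "'b list \<Rightarrow> nat" where
  "disorder [] = 0"
| "disorder (a # w) = key a * length w + disorder w"

lemma disorder_swap:
  "key p < key q \<Longrightarrow> disorder (u @ p # q # v) < disorder (u @ q # p # v)"
  by (induction u) (auto simp: algebra_simps)

lemma unsorted_descent:
  "\<not> sorted (map key w) \<Longrightarrow> \<exists>u p q v. w = u @ q # p # v \<and> key p < key q"
proof (induction w)
  case (Cons a w)
  show ?case
  proof (cases "sorted (map key w)")
    case True
    with Cons.prems obtain b w' where "w = b # w'" "key b < key a"
      by (cases w) (auto simp: not_le intro: order.strict_trans2 order_trans)
    then show ?thesis by (metis append_Nil)
  next
    case False
    then obtain u p q v where "w = u @ q # p # v \<and> key p < key q"
      using Cons.IH by blast
    then show ?thesis by (metis append_Cons)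
  qed
qed simp

lemma sorted_no_descent: "key p < key q \<Longrightarrow> \<not> sorted (map key (u @ q # p # v))"
  by (auto simp: sorted_append)

lemma exchange_induct:
  assumes "\<And>w. sorted (map key w) \<Longrightarrow> P w"
    and "\<And>u p q v. P (u @ p # q # v) \<Longrightarrow> P (u @ q # p # v)"
  shows "P w"
proof (induction "disorder w" arbitrary: w rule: less_induct)
  case less
  show ?case
  proof (cases "sorted (map key w)")
    case False
    then obtain u p q v where "w = u @ q # p # v" "key p < key q"
      using unsorted_descent by blast
    then show ?thesis using less disorder_swap assms(2) by blast
  qed (use assms(1) in blast)
qed

lemma val_exists: "\<exists>z. val w z"
proof (induction "disorder w" arbitrary: w rule: less_induct)
  case less
  show ?case
  proof (cases "sorted (map key w)")
    case False
    then obtain u p q v where "w = u @ q # p # v" "key p < key q"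
      using unsorted_descent by blast
    then show ?thesis
      using less[of "u @ p # q # v"] disorder_swap step by blast
  qed (use base in blast)
qed

text \<open>
  Two descents of the same word are either equal, overlapping in one letter, or disjoint.
  Overlapping ones are resolved by sorting the three letters in the two possible ways, which
  is the braid relation; disjoint ones by removing both descents, which is far commutation.
\<close>

lemma descents_confluent:
  assumes unique: "\<And>y z z'. disorder y < disorder (u @ q # p # v) \<Longrightarrow>
      val y z \<Longrightarrow> val y z' \<Longrightarrow> z = z'"
    and eq: "u @ q # p # v = u' @ q' # p' # v'"
    and desc: "key p < key q" "key p' < key q'"
    and z: "val (u @ p # q # v) z" and z': "val (u' @ p' # q' # v') z'"
    and le: "length u \<le> length u'"
  shows "z + D u q p v = z' + D u' q' p' v'"
proof -
  have less: "disorder (u @ p # q # v) < disorder (u @ q # p # v)"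
    "disorder (u' @ p' # q' # v') < disorder (u @ q # p # v)"
    using disorder_swap[OF desc(1), of u v] disorder_swap[OF desc(2), of u' v'] eq by auto
  obtain m where m: "u' = u @ m"
    using eq le by (metis append_eq_append_conv_if append_take_drop_id)
  then have tail: "q # p # v = m @ q' # p' # v'" using eq by simp
  consider "m = []" | "m = [q]" | k where "m = q # p # k"
    using tail by (metis append_Cons append_Nil list.inject neq_Nil_conv)
  then show ?thesis
  proof cases
    case 1
    then show ?thesis
      using tail m z z' unique[OF less(1)] by auto
  next
    case 2
    then have e: "q' = p" "v = p' # v'" "u' = u @ [q]" using tail m by auto
    have lt: "key p' < key p" "key p' < key q" "key p < key q" using desc e by auto
    obtain t where t: "val (u @ p' # p # q # v') t" using val_exists by blast
    have "val (u @ p # p' # q # v') (t + D u p p' (q # v'))"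
      using step[OF lt(1), of u "q # v'"] t by simp
    then have "val ((u @ [p]) @ q # p' # v') (t + D u p p' (q # v') + D (u @ [p]) q p' v')"
      using step[OF lt(2), of "u @ [p]" v'] by simp
    then have z1: "z = t + D u p p' (q # v') + D (u @ [p]) q p' v'"
      using unique[OF less(1)] z e by simp
    have "val ((u @ [p']) @ q # p # v') (t + D (u @ [p']) q p v')"
      using step[OF lt(3), of "u @ [p']" v'] t by simp
    then have "val (u @ q # p' # p # v') (t + D (u @ [p']) q p v' + D u q p' (p # v'))"
      using step[OF lt(2), of u "p # v'"] by simp
    then have z2: "z' = t + D (u @ [p']) q p v' + D u q p' (p # v')"
      using unique[OF less(2)] z' e by simp
    show ?thesis
      using braid[of u q p p' v'] z1 z2 e by (simp add: algebra_simps)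
  next
    case 3
    then have e: "v = k @ q' # p' # v'" "u' = u @ q # p # k" using tail m by auto
    obtain t where t: "val (u @ p # q # k @ p' # q' # v') t" using val_exists by blast
    have "val ((u @ p # q # k) @ q' # p' # v') (t + D (u @ p # q # k) q' p' v')"
      using step[OF desc(2), of "u @ p # q # k" v'] t by simp
    then have z1: "z = t + D (u @ p # q # k) q' p' v'"
      using unique[OF less(1)] z e by simp
    have "val (u @ q # p # k @ p' # q' # v') (t + D u q p (k @ p' # q' # v'))"
      using step[OF desc(1), of u "k @ p' # q' # v'"] t by simp
    then have z2: "z' = t + D u q p (k @ p' # q' # v')"
      using unique[OF less(2)] z' e by simp
    show ?thesis
      using far[of u q p k q' p' v'] z1 z2 e by (simp add: algebra_simps)
  qed
qed

lemma val_unique: "val w z \<Longrightarrow> val w z' \<Longrightarrow> z = z'"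
proof (induction "disorder w" arbitrary: w z z' rule: less_induct)
  case less
  note IH = less.hyps and prems = less.prems
  show ?case
  proof (cases "sorted (map key w)")
    case True
    have "y = B w" if "val w y" for y
      using that True by cases (use sorted_no_descent in blast)+
    then show ?thesis using prems by blast
  next
    case False
    from prems(1) False obtain u p q v y where 1: "w = u @ q # p # v" "key p < key q"
        "val (u @ p # q # v) y" "z = y + D u q p v"
      by cases auto
    from prems(2) False obtain u' p' q' v' y' where 2: "w = u' @ q' # p' # v'" "key p' < key q'"
        "val (u' @ p' # q' # v') y'" "z' = y' + D u' q' p' v'"
      by cases auto
    show ?thesis
    proof (cases "length u \<le> length u'")
      case True
      then show ?thesis
        using descents_confluent[of u q p v u' q' p' v' y y'] 1 2 IH by metis
    next
      case False
      then show ?thesis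
        using descents_confluent[of u' q' p' v' u q p v y' y] 1 2 IH
        by (metis linorder_le_cases)
    qed
  qed
qed

text \<open>
  The exchange rule is imposed only on descents by \<open>val\<close>; for ascents it follows from the
  skew-symmetry of \<open>D\<close>, and for a repeated letter from \<open>D u p p v = 0\<close>.
\<close>

theorem straightening_exists:
  "\<exists>S. (\<forall>u p q v. S (u @ p # q # v) - S (u @ q # p # v) = D u p q v) \<and>
       (\<forall>w. sorted (map key w) \<longrightarrow> S w = B w)"
proof -
  define S where "S w = (THE z. val w z)" for w
  have S: "S w = z" if "val w z" for w z
    unfolding S_def using that val_unique by blast
  have val_S: "val w (S w)" for w
    using val_exists S by blast
  have lt: "S (u @ q # p # v) - S (u @ p # q # v) = D u q p v" if "key p < key q" for u p q v
    using S[OF step[OF that val_S]] by simp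
  have "S (u @ p # q # v) - S (u @ q # p # v) = D u p q v" for u p q v
  proof (cases "key p" "key q" rule: linorder_cases)
    case less
    have "S (u @ p # q # v) - S (u @ q # p # v) = - D u q p v"
      using lt[OF less, of u v] by (simp add: algebra_simps)
    then show ?thesis using skew[of u p q v] by simp
  next
    case equal
    then have "p = q" using key_inj by (simp add: inj_eq)
    then show ?thesis by (simp add: diag)
  next
    case greater
    then show ?thesis using lt by blast
  qed
  moreover have "S w = B w" if "sorted (map key w)" for w
    using S base that by blast
  ultimately show ?thesis by blast
qed

end

section \<open>The skew group algebra as a monoid algebra\<close>

definition lact :: "'n perm \<Rightarrow> 'n + 'n \<Rightarrow> 'n + 'n"
  where "lact g = map_sum (Perm.apply g) (Perm.apply g)"

lemma lact_1 [simp]: "lact 1 = id"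
  by (auto simp: lact_def fun_eq_iff map_sum_def split: sum.split)

lemma lact_mult: "lact (g * h) = lact g \<circ> lact h"
  by (auto simp: lact_def fun_eq_iff map_sum_def apply_times split: sum.split)

lemma lact_inverse [simp]: "lact g (lact (inverse g) p) = p" "lact (inverse g) (lact g p) = p"
  by (metis comp_apply id_apply lact_1 lact_mult perm.right_inverse)
     (metis comp_apply id_apply lact_1 lact_mult perm.left_inverse)

lemma lact_inj: "inj (lact g)"
  by (rule injI) (metis lact_inverse(2))

lemma doubled_perm_rep_nth [simp]: "doubled_perm_rep g v $ p = v $ lact (inverse g) p"
  by (simp add: doubled_perm_rep_def lact_def)

lemma doubled_perm_rep_axis: "doubled_perm_rep g (axis p c) = axis (lact g p) c"
  by (auto simp: vec_eq_iff axis_def)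

lemma doubled_perm_rep_linear: "Vector_Spaces.linear (*s) (*s) (doubled_perm_rep g)"
  unfolding Vector_Spaces.linear_def module_hom_def module_hom_axioms_def
  by (auto simp: vec_eq_iff vec.vector_space_axioms vec.module_axioms)

lemma doubled_perm_rep_add [simp]:
  "doubled_perm_rep g (u + v) = doubled_perm_rep g u + doubled_perm_rep g v"
  and doubled_perm_rep_scale [simp]: "doubled_perm_rep g (c *s u) = c *s doubled_perm_rep g u"
  by (simp_all add: vec_eq_iff)

lemma doubled_perm_rep_1 [simp]: "doubled_perm_rep 1 v = v"
  by (simp add: vec_eq_iff)

lemma doubled_perm_rep_mult:
  "doubled_perm_rep (g * h) v = doubled_perm_rep g (doubled_perm_rep h v)"
  by (simp add: vec_eq_iff lact_mult)

lemma linear_action_doubled_perm_rep: "linear_action doubled_perm_rep"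
  by (simp add: linear_action_def doubled_perm_rep_linear fun_eq_iff doubled_perm_rep_mult)

text \<open>
  The semidirect product of the free monoid on the basis of \<open>V\<close> with \<open>S\<^sub>n\<close>.  Since \<open>S\<^sub>n\<close> permutes
  the basis, \<open>T(V)#S\<^sub>n\<close> is the monoid algebra of this monoid: an element is a single finitely
  supported function, and the ring axioms come from \<^type>\<open>poly_mapping\<close>.
\<close>

datatype 'n twisted_word = TW (letters_of: "('n + 'n) list") (twist: "'n perm")

instantiation twisted_word :: (type) monoid_add
begin
definition "0 = TW [] 1"
definition "v + w = TW (letters_of v @ map (lact (twist v)) (letters_of w)) (twist v * twist w)"
instance
  by standard (simp_all add: zero_twisted_word_def plus_twisted_word_def lact_mult mult.assoc)
end

lemma TW_add: "TW v g + TW w h = TW (v @ map (lact g) w) (g * h)"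
  by (simp add: plus_twisted_word_def)

type_synonym 'n skew_alg = "'n twisted_word \<Rightarrow>\<^sub>0 complex"

definition wrd :: "('n + 'n) list \<Rightarrow> 'n skew_alg"
  where "wrd w = Poly_Mapping.single (TW w 1) 1"

definition grp :: "'n perm \<Rightarrow> 'n skew_alg"
  where "grp g = Poly_Mapping.single (TW [] g) 1"

definition vec_elem :: "complex ^ ('n::finite + 'n) \<Rightarrow> 'n skew_alg"
  where "vec_elem v = (\<Sum>p\<in>UNIV. scalar (v $ p) * wrd [p])"

text \<open>
  Identities between additive maps on a monoid algebra need only be checked on monomials.
\<close>

lemma additive_ext:
  fixes F G :: "('k \<Rightarrow>\<^sub>0 'c::ab_group_add) \<Rightarrow> 'z::ab_group_add"
  assumes "Modules.additive F" "Modules.additive G"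
    and "\<And>k c. F (Poly_Mapping.single k c) = G (Poly_Mapping.single k c)"
  shows "F x = G x"
proof (induction x rule: update_induct)
  case const
  then show ?case using assms(1,2) by (simp add: Modules.additive.zero)
next
  case (update f a b)
  have "Poly_Mapping.update k c f = f + Poly_Mapping.single k c" if "k \<notin> Poly_Mapping.keys f" for k c
    using that by (intro poly_mapping_eqI) (auto simp: lookup_update lookup_add lookup_single in_keys_iff when_def)
  then show ?case using update assms by (simp add: Modules.additive.add)
qed

lemma additive_sum_keys:
  fixes F :: "'k \<Rightarrow> 'c::ab_group_add \<Rightarrow> 'z::ab_group_add"
  assumes "\<And>k c d. F k (c + d) = F k c + F k d"
  shows "Modules.additive (\<lambda>f. \<Sum>k\<in>Poly_Mapping.keys f. F k (Poly_Mapping.lookup f k))"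
proof
  have "F k 0 = 0" for k using assms[of k 0 0] by simp
  then show "(\<Sum>k\<in>Poly_Mapping.keys (x + y). F k (Poly_Mapping.lookup (x + y) k)) =
    (\<Sum>k\<in>Poly_Mapping.keys x. F k (Poly_Mapping.lookup x k)) +
    (\<Sum>k\<in>Poly_Mapping.keys y. F k (Poly_Mapping.lookup y k))" for x y
    using assms by (intro setsum_keys_plus_distrib) auto
qed

lemma sum_keys_single:
  "F k 0 = 0 \<Longrightarrow> (\<Sum>l\<in>Poly_Mapping.keys (Poly_Mapping.single k c). F l (Poly_Mapping.lookup (Poly_Mapping.single k c) l)) = F k c"
  by (cases "c = 0") auto

lemma scalar_add: "scalar (c + d) = scalar c + scalar d"
  by (simp add: scalar_def single_add)

lemma scalar_minus: "scalar (- c) = - scalar c"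
  by (simp add: scalar_def single_uminus)

lemma scalar_diff: "scalar (c - d) = scalar c - scalar d"
  by (simp add: scalar_def single_diff)

lemma scalar_0 [simp]: "scalar 0 = 0"
  by (simp add: scalar_def)

lemma scalar_1 [simp]: "scalar 1 = 1"
  by (simp add: scalar_def)

lemma scalar_mult: "scalar (c * d) = scalar c * scalar d"
  by (simp add: scalar_def mult_single)

lemma scalar_sum: "scalar (sum f A) = (\<Sum>a\<in>A. scalar (f a))"
  by (induction A rule: infinite_finite_induct) (simp_all add: scalar_add)

lemma additive_mult_left: "Modules.additive (\<lambda>x::'a::ring. a * x)"
  and additive_mult_right: "Modules.additive (\<lambda>x::'a::ring. x * a)"
  by (simp_all add: Modules.additive_def algebra_simps)

lemma scalar_commute: "x * scalar c = scalar c * x"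
  by (rule additive_ext[OF additive_mult_right additive_mult_left])
     (simp add: scalar_def mult_single mult.commute)

lemma scalar_left_commute: "x * (scalar c * y) = scalar c * (x * y)"
  by (metis mult.assoc scalar_commute)

lemma lookup_scalar_mult: "Poly_Mapping.lookup (scalar c * x) k = c * Poly_Mapping.lookup x k"
  by (simp add: scalar_def mult_map_scale_conv_mult[symmetric] map.rep_eq when_def)

lemma wrd_Nil: "wrd [] = 1" and grp_1 [simp]: "grp 1 = 1"
  by (simp_all add: wrd_def grp_def zero_twisted_word_def[symmetric])

lemma wrd_append: "wrd (v @ w) = wrd v * wrd w"
  by (simp add: wrd_def mult_single TW_add)

lemma wrd_Cons: "wrd (p # w) = wrd [p] * wrd w"
  using wrd_append[of "[p]" w] by simp

lemma grp_mult: "grp (g * h) = grp g * grp h"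
  by (simp add: grp_def mult_single TW_add)

lemma grp_inverse [simp]: "grp g * grp (inverse g) = 1" "grp (inverse g) * grp g = 1"
  by (simp_all add: grp_mult[symmetric])

lemma grp_wrd: "grp g * wrd w = wrd (map (lact g) w) * grp g"
  by (simp add: grp_def wrd_def mult_single TW_add)

lemma single_TW: "Poly_Mapping.single (TW w g) c = scalar c * wrd w * grp g"
  by (simp add: scalar_def wrd_def grp_def mult_single TW_add zero_twisted_word_def)

lemma skew_alg_ext:
  fixes F G :: "'n skew_alg \<Rightarrow> 'z::ab_group_add"
  assumes "Modules.additive F" "Modules.additive G"
    and "\<And>c w g. F (scalar c * wrd w * grp g) = G (scalar c * wrd w * grp g)"
  shows "F x = G x"
proof (rule additive_ext[OF assms(1,2)])
  show "F (Poly_Mapping.single k c) = G (Poly_Mapping.single k c)" for k c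
    by (cases k) (simp add: single_TW assms(3))
qed

lemma vec_elem_add: "vec_elem (u + v) = vec_elem u + vec_elem v"
  by (simp add: vec_elem_def scalar_add algebra_simps sum.distrib)

lemma vec_elem_scale: "vec_elem (c *s u) = scalar c * vec_elem u"
  by (simp add: vec_elem_def scalar_mult sum_distrib_left mult.assoc)

lemma vec_elem_0 [simp]: "vec_elem 0 = 0"
  by (simp add: vec_elem_def)

lemma vec_elem_minus: "vec_elem (- u) = - vec_elem u"
  by (simp add: vec_elem_def scalar_minus sum_negf)

lemma vec_elem_diff: "vec_elem (u - v) = vec_elem u - vec_elem v"
  by (simp add: vec_elem_def scalar_diff algebra_simps sum_subtractf)

lemma vec_elem_sum: "vec_elem (sum f A) = (\<Sum>a\<in>A. vec_elem (f a))"
  by (induction A rule: infinite_finite_induct) (simp_all add: vec_elem_add)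

lemma vec_elem_axis: "vec_elem (axis p 1) = wrd [p]"
proof -
  have "vec_elem (axis p 1) = (\<Sum>q\<in>UNIV. if q = p then wrd [q] else 0)"
    unfolding vec_elem_def by (intro sum.cong refl) (auto simp: axis_def)
  then show ?thesis by simp
qed

lemma grp_vec_elem: "grp g * vec_elem v = vec_elem (doubled_perm_rep g v) * grp g"
proof -
  have "vec_elem (doubled_perm_rep g v) = (\<Sum>p\<in>UNIV. scalar (v $ p) * wrd [lact g p])"
    unfolding vec_elem_def
    by (rule sum.reindex_bij_witness[of _ "lact g" "lact (inverse g)"]) auto
  moreover have "grp g * (scalar c * wrd [p]) = scalar c * wrd [lact g p] * grp g" for c p
    using grp_wrd[of g "[p]"] by (simp add: scalar_left_commute mult.assoc)
  ultimately show ?thesis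
    by (simp add: vec_elem_def sum_distrib_left sum_distrib_right)
qed

subsection \<open>Filtration by word length\<close>

text \<open>
  \<open>short m\<close> is the strict version of the word-length filtration; with this convention
  \<open>short 0\<close> is zero, and the piece below degree \<open>0\<close> needs no separate treatment.
\<close>

definition short :: "nat \<Rightarrow> 'n skew_alg set"
  where "short m = {f. \<forall>k\<in>Poly_Mapping.keys f. length (letters_of k) < m}"

definition homog :: "nat \<Rightarrow> 'n skew_alg set"
  where "homog m = {f. \<forall>k\<in>Poly_Mapping.keys f. length (letters_of k) = m}"

definition hcomp :: "nat \<Rightarrow> 'n skew_alg \<Rightarrow> 'n skew_alg"
  where "hcomp m f = (\<Sum>k\<in>Poly_Mapping.keys f.
     if length (letters_of k) = m then Poly_Mapping.single k (Poly_Mapping.lookup f k) else 0)"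

lemma short_iff: "f \<in> short m \<longleftrightarrow> (\<forall>k. m \<le> length (letters_of k) \<longrightarrow> Poly_Mapping.lookup f k = 0)"
  unfolding short_def by simp (metis in_keys_iff not_less)

lemma homog_iff: "f \<in> homog m \<longleftrightarrow> (\<forall>k. length (letters_of k) \<noteq> m \<longrightarrow> Poly_Mapping.lookup f k = 0)"
  unfolding homog_def by simp (metis in_keys_iff)

lemma additive_hcomp: "Modules.additive (hcomp m)"
  unfolding hcomp_def
  by (rule additive_sum_keys[of "\<lambda>k c. if length (letters_of k) = m then Poly_Mapping.single k c else 0"])
     (simp add: single_add)

lemma lookup_hcomp:
  "Poly_Mapping.lookup (hcomp m f) k = (if length (letters_of k) = m then Poly_Mapping.lookup f k else 0)"
proof -
  have "Modules.additive (\<lambda>f. Poly_Mapping.lookup (hcomp m f) k)"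
    by (simp add: Modules.additive_def Modules.additive.add[OF additive_hcomp] lookup_add)
  moreover have "Modules.additive (\<lambda>f. if length (letters_of k) = m then Poly_Mapping.lookup f k else 0)"
    by (simp add: Modules.additive_def lookup_add)
  moreover have "Poly_Mapping.lookup (hcomp m (Poly_Mapping.single l c)) k =
      (if length (letters_of k) = m then Poly_Mapping.lookup (Poly_Mapping.single l c) k else 0)" for l c
    using sum_keys_single[of "\<lambda>k c. if length (letters_of k) = m then Poly_Mapping.single k c else 0" l c]
    by (auto simp: hcomp_def lookup_single when_def)
  ultimately show ?thesis by (rule additive_ext)
qed

lemma short_0: "f \<in> short 0 \<longleftrightarrow> f = 0"
  by (auto simp: short_iff intro: poly_mapping_eqI)

lemma short_zero [simp]: "0 \<in> short m"
  and short_add: "f \<in> short m \<Longrightarrow> h \<in> short m \<Longrightarrow> f + h \<in> short m"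
  and short_minus: "f \<in> short m \<Longrightarrow> - f \<in> short m"
  and short_diff: "f \<in> short m \<Longrightarrow> h \<in> short m \<Longrightarrow> f - h \<in> short m"
  and short_mono: "f \<in> short m \<Longrightarrow> m \<le> m' \<Longrightarrow> f \<in> short m'"
  and short_scalar: "f \<in> short m \<Longrightarrow> scalar c * f \<in> short m"
  by (auto simp: short_iff lookup_add lookup_minus lookup_scalar_mult)

lemma short_sum: "(\<And>a. a \<in> A \<Longrightarrow> f a \<in> short m) \<Longrightarrow> sum f A \<in> short m"
  by (induction A rule: infinite_finite_induct) (auto intro: short_add)

lemma wrd_short: "length w < m \<Longrightarrow> wrd w \<in> short m"
  by (auto simp: short_def wrd_def)

lemma short_mult: "f \<in> short (Suc a) \<Longrightarrow> h \<in> short b \<Longrightarrow> f * h \<in> short (a + b)"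
proof -
  assume f: "f \<in> short (Suc a)" and h: "h \<in> short b"
  show ?thesis
    unfolding short_def
  proof (intro CollectI ballI)
    fix k assume "k \<in> Poly_Mapping.keys (f * h)"
    then obtain i j where "k = i + j" "i \<in> Poly_Mapping.keys f" "j \<in> Poly_Mapping.keys h"
      using keys_mult by blast
    then show "length (letters_of k) < a + b"
      using f h by (fastforce simp: short_def plus_twisted_word_def)
  qed
qed

lemma grp_short: "0 < m \<Longrightarrow> grp g \<in> short m"
  by (auto simp: short_def grp_def)

lemma short_mult_grp: "f \<in> short m \<Longrightarrow> f * grp g \<in> short m"
proof (cases m)
  case (Suc k)
  assume "f \<in> short m"
  then show ?thesis using short_mult[of f k "grp g" 1] grp_short[of 1 g] Suc by simp
qed (simp add: short_0)

lemma scalar_short: "0 < m \<Longrightarrow> scalar c \<in> short m"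
  by (auto simp: short_def scalar_def zero_twisted_word_def)

lemma vec_elem_short: "1 < m \<Longrightarrow> vec_elem v \<in> short m"
  unfolding vec_elem_def by (intro short_sum short_scalar wrd_short) simp

lemma homog_zero [simp]: "0 \<in> homog m"
  and homog_add: "f \<in> homog m \<Longrightarrow> h \<in> homog m \<Longrightarrow> f + h \<in> homog m"
  and homog_scalar: "f \<in> homog m \<Longrightarrow> scalar c * f \<in> homog m"
  by (auto simp: homog_iff lookup_add lookup_scalar_mult)

lemma homog_sum: "(\<And>a. a \<in> A \<Longrightarrow> f a \<in> homog m) \<Longrightarrow> sum f A \<in> homog m"
  by (induction A rule: infinite_finite_induct) (auto intro: homog_add)

lemma homog_mult: "f \<in> homog a \<Longrightarrow> h \<in> homog b \<Longrightarrow> f * h \<in> homog (a + b)"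
proof -
  assume f: "f \<in> homog a" and h: "h \<in> homog b"
  show ?thesis
    unfolding homog_def
  proof (intro CollectI ballI)
    fix k assume "k \<in> Poly_Mapping.keys (f * h)"
    then obtain i j where "k = i + j" "i \<in> Poly_Mapping.keys f" "j \<in> Poly_Mapping.keys h"
      using keys_mult by blast
    then show "length (letters_of k) = a + b"
      using f h by (fastforce simp: homog_def plus_twisted_word_def)
  qed
qed

lemma wrd_homog: "wrd w \<in> homog (length w)"
  by (auto simp: homog_def wrd_def)

lemma grp_homog: "grp g \<in> homog 0"
  by (auto simp: homog_def grp_def)

lemma homog_mult_grp: "f \<in> homog m \<Longrightarrow> f * grp g \<in> homog m"
  using homog_mult[OF _ grp_homog] by fastforce

lemma scalar_homog: "scalar c \<in> homog 0"
  by (auto simp: homog_def scalar_def zero_twisted_word_def)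

lemma hcomp_homog: "hcomp m f \<in> homog m"
  by (simp add: homog_iff lookup_hcomp)

lemma hcomp_id: "f \<in> homog m \<Longrightarrow> hcomp m f = f"
  by (rule poly_mapping_eqI) (auto simp: homog_iff lookup_hcomp)

lemma hcomp_other: "f \<in> homog m \<Longrightarrow> k \<noteq> m \<Longrightarrow> hcomp k f = 0"
  by (rule poly_mapping_eqI) (auto simp: homog_iff lookup_hcomp)

lemma homog_imp_short: "f \<in> homog m \<Longrightarrow> m < k \<Longrightarrow> f \<in> short k"
  by (auto simp: homog_iff short_iff)

lemma homog_short_zero: "f \<in> homog m \<Longrightarrow> f \<in> short m \<Longrightarrow> f = 0"
  by (rule poly_mapping_eqI) (metis homog_iff lookup_zero order_refl short_iff)

lemma hcomp_short: "f \<in> short m \<Longrightarrow> m \<le> k \<Longrightarrow> hcomp k f = 0"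
  by (rule poly_mapping_eqI) (auto simp: short_iff lookup_hcomp)

lemma short_Suc_hcomp: "f \<in> short (Suc m) \<Longrightarrow> f - hcomp m f \<in> short m"
  by (auto simp: short_iff lookup_minus lookup_hcomp)

lemma short_exists: "\<exists>m. f \<in> short m"
proof -
  obtain m where "\<forall>l\<in>(\<lambda>k. length (letters_of k)) ` Poly_Mapping.keys f. l < m"
    using finite_nat_set_iff_bounded by (metis finite_imageI finite_keys)
  then show ?thesis by (auto simp: short_def)
qed

lemma sum_hcomp: "f \<in> short m \<Longrightarrow> (\<Sum>k<m. hcomp k f) = f"
  by (rule poly_mapping_eqI) (auto simp: lookup_sum lookup_hcomp short_iff)

section \<open>Linear extension\<close>

text \<open>
  The \<open>\<complex>\<close>-linear and right \<open>S\<^sub>n\<close>-linear extension of a function on words.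
\<close>

definition lin :: "(('n + 'n) list \<Rightarrow> 'n skew_alg) \<Rightarrow> 'n skew_alg \<Rightarrow> 'n skew_alg"
  where "lin L f = (\<Sum>k\<in>Poly_Mapping.keys f.
     scalar (Poly_Mapping.lookup f k) * L (letters_of k) * grp (twist k))"

lemma additive_lin: "Modules.additive (lin L)"
  unfolding lin_def
  by (rule additive_sum_keys[of "\<lambda>k c. scalar c * L (letters_of k) * grp (twist k)"])
     (simp add: scalar_add algebra_simps)

lemmas lin_add = Modules.additive.add[OF additive_lin]
  and lin_diff = Modules.additive.diff[OF additive_lin]
  and lin_minus = Modules.additive.minus[OF additive_lin]
  and lin_zero [simp] = Modules.additive.zero[OF additive_lin]
  and lin_sum = Modules.additive.sum[OF additive_lin]

lemma lin_basis: "lin L (scalar c * wrd w * grp g) = scalar c * L w * grp g"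
  using sum_keys_single[of "\<lambda>k c. scalar c * L (letters_of k) * grp (twist k)" "TW w g" c]
  by (simp add: lin_def single_TW[symmetric])

lemma lin_basis_assoc: "lin L (scalar c * (wrd w * grp g)) = scalar c * (L w * grp g)"
  using lin_basis[of L c w g] by (simp only: mult.assoc)

lemma lin_wrd: "lin L (wrd w) = L w"
  using lin_basis[of L 1 w 1] by simp

lemma additive_compose:
  "Modules.additive F \<Longrightarrow> Modules.additive G \<Longrightarrow> Modules.additive (\<lambda>x. F (G x))"
  by (simp add: Modules.additive_def)

lemma lin_scalar: "lin L (scalar c * f) = scalar c * lin L f"
proof (rule skew_alg_ext[of "\<lambda>f. lin L (scalar c * f)" "\<lambda>f. scalar c * lin L f"])
  show "lin L (scalar c * (scalar d * wrd w * grp g)) = scalar c * lin L (scalar d * wrd w * grp g)" for d w g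
    using lin_basis_assoc[of L "c * d" w g] by (simp add: lin_basis_assoc scalar_mult mult.assoc)
qed (auto intro: additive_compose additive_lin additive_mult_left)

lemma lin_grp: "lin L (f * grp g) = lin L f * grp g"
proof (rule skew_alg_ext[of "\<lambda>f. lin L (f * grp g)" "\<lambda>f. lin L f * grp g"])
  show "lin L (scalar c * wrd w * grp h * grp g) = lin L (scalar c * wrd w * grp h) * grp g" for c w h
    using lin_basis_assoc[of L c w "h * g"] by (simp add: lin_basis_assoc grp_mult mult.assoc)
qed (auto intro: additive_compose additive_lin additive_mult_right)

lemma skew_expansion:
  "f = (\<Sum>k\<in>Poly_Mapping.keys f. scalar (Poly_Mapping.lookup f k) * wrd (letters_of k) * grp (twist k))"
proof -
  have "lin wrd f = f"
    by (rule skew_alg_ext[of "lin wrd" "\<lambda>f. f"])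
       (simp_all add: additive_lin lin_basis, simp add: Modules.additive_def)
  then show ?thesis by (simp add: lin_def)
qed

lemma lin_cong:
  "f \<in> short m \<Longrightarrow> (\<And>w. length w < m \<Longrightarrow> L w = L' w) \<Longrightarrow> lin L f = lin L' f"
  unfolding lin_def by (intro sum.cong) (auto simp: short_def)

lemma lin_short:
  "f \<in> short m \<Longrightarrow> (\<And>w. length w < m \<Longrightarrow> L w \<in> short m') \<Longrightarrow> lin L f \<in> short m'"
  unfolding lin_def
  by (intro short_sum short_mult_grp short_scalar) (auto simp: short_def)

lemma lin_diff_fun: "lin L f - lin L' f = lin (\<lambda>w. L w - L' w) f"
  by (simp add: lin_def sum_subtractf algebra_simps)

section \<open>Normal forms\<close>

definition word_content :: "'b list \<Rightarrow> 'b \<Rightarrow>\<^sub>0 nat"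
  where "word_content w = sum_list (map (\<lambda>p. Poly_Mapping.single p 1) w)"

lemma content_Nil [simp]: "word_content [] = 0"
  and content_Cons: "word_content (p # w) = Poly_Mapping.single p 1 + word_content w"
  and content_append: "word_content (v @ w) = word_content v + word_content w"
  by (simp_all add: word_content_def)

lemma lookup_content: "Poly_Mapping.lookup (word_content w) p = count (mset w) p"
  by (induction w) (auto simp: content_Cons lookup_add lookup_single when_def)

lemma content_eq_iff: "word_content v = word_content w \<longleftrightarrow> mset v = mset w"
  by (auto simp: poly_mapping_eq_iff fun_eq_iff lookup_content multiset_eq_iff)

lemma content_surj: "\<exists>w. word_content w = m"
proof (induction m rule: update_induct)
  case const
  show ?case by (rule exI[of _ "[]"]) simp
next
  case (update f a b)
  then obtain w where w: "word_content w = f" by blast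
  have "word_content (replicate b a @ w) = Poly_Mapping.update a b f"
    using update(1) by (intro poly_mapping_eqI)
      (auto simp: w[symmetric] lookup_content lookup_update in_keys_iff count_eq_zero_iff)
  then show ?case by blast
qed

text \<open>
  Each monomial of \<open>S(V)\<close> is represented by one chosen word, so that \<open>S(V)#S\<^sub>n\<close> is identified
  with the span of these words inside \<open>T(V)#S\<^sub>n\<close>.
\<close>

definition nf :: "('b \<Rightarrow>\<^sub>0 nat) \<Rightarrow> 'b list"
  where "nf m = (SOME w. word_content w = m)"

lemma content_nf [simp]: "word_content (nf m) = m"
  unfolding nf_def using content_surj by (rule someI_ex)

lemma length_nf_content [simp]: "length (nf (word_content w)) = length w"
  using content_nf[of "word_content w"] by (metis content_eq_iff size_mset)

lemma nf_content_short: "length w \<le> 1 \<Longrightarrow> nf (word_content w) = w"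
proof -
  assume "length w \<le> 1"
  moreover have "mset (nf (word_content w)) = mset w" using content_eq_iff content_nf by blast
  ultimately show ?thesis by (cases w) auto
qed

lemma content_swap: "word_content (u @ p # q # v) = word_content (u @ q # p # v)"
  by (simp add: content_append content_Cons algebra_simps)

abbreviation nform :: "'n skew_alg \<Rightarrow> 'n skew_alg"
  where "nform \<equiv> lin (\<lambda>w. wrd (nf (word_content w)))"

lemma lin_homog:
  "f \<in> homog m \<Longrightarrow> (\<And>w. length w = m \<Longrightarrow> L w \<in> homog m') \<Longrightarrow> lin L f \<in> homog m'"
  unfolding lin_def
  by (intro homog_sum homog_mult_grp homog_scalar) (auto simp: homog_def)

lemma nform_homog: "f \<in> homog m \<Longrightarrow> nform f \<in> homog m"
proof (rule lin_homog)
  show "wrd (nf (word_content w)) \<in> homog m" if "length w = m" for w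
    using wrd_homog[of "nf (word_content w)"] that by simp
qed

lemma nform_short: "f \<in> short m \<Longrightarrow> nform f \<in> short m"
  by (rule lin_short) (auto intro: wrd_short)

lemma nform_low: "f \<in> short 2 \<Longrightarrow> nform f = f"
proof -
  assume "f \<in> short 2"
  then have "nform f = lin wrd f" by (intro lin_cong) (auto simp: nf_content_short)
  then show ?thesis using skew_expansion[of f] by (simp add: lin_def)
qed

section \<open>Relations\<close>

locale cochain_pair =
  fixes \<kappa>L :: "'n::finite perm \<Rightarrow> complex ^ ('n + 'n) \<Rightarrow> complex ^ ('n + 'n) \<Rightarrow> complex ^ ('n + 'n)"
    and \<kappa>C :: "'n perm \<Rightarrow> complex ^ ('n + 'n) \<Rightarrow> complex ^ ('n + 'n) \<Rightarrow> complex"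
  assumes linL: "linear_cochain \<kappa>L" and linC: "constant_cochain \<kappa>C"
begin

lemma \<kappa>L_bilinear:
  "\<kappa>L g (u + u') v = \<kappa>L g u v + \<kappa>L g u' v" "\<kappa>L g (c *s u) v = c *s \<kappa>L g u v"
  "\<kappa>L g u (v + v') = \<kappa>L g u v + \<kappa>L g u v'" "\<kappa>L g u (c *s v) = c *s \<kappa>L g u v"
  and \<kappa>L_skew: "\<kappa>L g u v = - \<kappa>L g v u"
  using linL unfolding linear_cochain_def skew_bilinear_def Vector_Spaces.linear_def
    module_hom_def module_hom_axioms_def by metis+

lemma \<kappa>C_bilinear:
  "\<kappa>C g (u + u') v = \<kappa>C g u v + \<kappa>C g u' v" "\<kappa>C g (c *s u) v = c * \<kappa>C g u v"
  "\<kappa>C g u (v + v') = \<kappa>C g u v + \<kappa>C g u v'" "\<kappa>C g u (c *s v) = c * \<kappa>C g u v"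
  and \<kappa>C_skew: "\<kappa>C g u v = - \<kappa>C g v u"
  using linC unfolding constant_cochain_def skew_bilinear_def Vector_Spaces.linear_def
    module_hom_def module_hom_axioms_def by metis+

definition kap :: "complex ^ ('n + 'n) \<Rightarrow> complex ^ ('n + 'n) \<Rightarrow> 'n skew_alg"
  where "kap u v = (\<Sum>g\<in>UNIV. (vec_elem (\<kappa>L g u v) + scalar (\<kappa>C g u v)) * grp g)"

definition rel :: "complex ^ ('n + 'n) \<Rightarrow> complex ^ ('n + 'n) \<Rightarrow> 'n skew_alg"
  where "rel u v = vec_elem u * vec_elem v - vec_elem v * vec_elem u - kap u v"

text \<open>
  The set is closed under negation because \<open>a\<close> may be replaced by \<open>- a\<close>, so sums suffice.
\<close>

inductive_set rel_ideal :: "'n skew_alg set" where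
  gen: "a * rel u v * b \<in> rel_ideal"
| add: "x \<in> rel_ideal \<Longrightarrow> y \<in> rel_ideal \<Longrightarrow> x + y \<in> rel_ideal"

lemma kap_bilinear:
  "kap (u + u') v = kap u v + kap u' v" "kap (c *s u) v = scalar c * kap u v"
  "kap u (v + v') = kap u v + kap u v'" "kap u (c *s v) = scalar c * kap u v"
  and kap_skew: "kap u v = - kap v u"
proof -
  show "kap u v = - kap v u"
    unfolding kap_def sum_negf[symmetric]
    by (intro sum.cong refl, subst \<kappa>L_skew, subst \<kappa>C_skew)
      (simp add: vec_elem_minus scalar_minus algebra_simps)
qed (simp_all add: kap_def \<kappa>L_bilinear \<kappa>C_bilinear vec_elem_add vec_elem_scale scalar_add
      scalar_mult sum.distrib sum_distrib_left algebra_simps)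

lemma rel_bilinear:
  "rel (u + u') v = rel u v + rel u' v" "rel (c *s u) v = scalar c * rel u v"
  "rel u (v + v') = rel u v + rel u v'" "rel u (c *s v) = scalar c * rel u v"
  by (simp_all add: rel_def kap_bilinear vec_elem_add vec_elem_scale algebra_simps scalar_left_commute)

lemma kap_short: "kap u v \<in> short 2"
  unfolding kap_def
  by (intro short_sum short_mult_grp short_add vec_elem_short scalar_short) simp_all

lemma rel_sum: "rel (sum f A) v = (\<Sum>a\<in>A. rel (f a) v)"
  "rel u (sum f A) = (\<Sum>a\<in>A. rel u (f a))"
proof -
  have z: "rel 0 v = 0" "rel u 0 = 0" for u v
    using rel_bilinear(1)[of 0 0 v] rel_bilinear(3)[of u 0 0] by auto
  show "rel (sum f A) v = (\<Sum>a\<in>A. rel (f a) v)"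
    by (induction A rule: infinite_finite_induct) (simp_all add: rel_bilinear z)
  show "rel u (sum f A) = (\<Sum>a\<in>A. rel u (f a))"
    by (induction A rule: infinite_finite_induct) (simp_all add: rel_bilinear z)
qed

lemma rel_expansion:
  "rel u v = (\<Sum>p\<in>UNIV. \<Sum>q\<in>UNIV. scalar (u $ p * v $ q) * rel (axis p 1) (axis q 1))"
proof -
  have "rel u v = rel (\<Sum>p\<in>UNIV. (u $ p) *s axis p 1) (\<Sum>q\<in>UNIV. (v $ q) *s axis q 1)"
    by (simp only: basis_expansion)
  also have "\<dots> = (\<Sum>p\<in>UNIV. scalar (u $ p) * rel (axis p 1) (\<Sum>q\<in>UNIV. (v $ q) *s axis q 1))"
    by (simp only: rel_sum(1) rel_bilinear(2))
  finally show ?thesis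
    by (simp only: rel_sum(2) rel_bilinear(4) scalar_mult sum_distrib_left mult.assoc)
qed

lemma rel_ideal_zero: "0 \<in> rel_ideal"
  using gen[of 0 0 0 0] by simp

lemma rel_in_ideal: "rel u v \<in> rel_ideal"
  using gen[of 1 u v 1] by simp

lemma rel_ideal_mult:
  assumes "x \<in> rel_ideal" shows "a * x * b \<in> rel_ideal"
  using assms
proof induction
  case (gen c u v d)
  then show ?case using rel_ideal.gen[of "a * c" u v "d * b"] by (simp add: mult.assoc)
next
  case (add x y)
  then show ?case using rel_ideal.add by (simp add: algebra_simps)
qed

lemma rel_ideal_left: "x \<in> rel_ideal \<Longrightarrow> a * x \<in> rel_ideal"
  and rel_ideal_right: "x \<in> rel_ideal \<Longrightarrow> x * a \<in> rel_ideal"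
  and rel_ideal_minus: "x \<in> rel_ideal \<Longrightarrow> - x \<in> rel_ideal"
  using rel_ideal_mult[of x a 1] rel_ideal_mult[of x 1 a] rel_ideal_mult[of x "- 1" 1] by simp_all

lemma rel_ideal_diff: "x \<in> rel_ideal \<Longrightarrow> y \<in> rel_ideal \<Longrightarrow> x - y \<in> rel_ideal"
  using rel_ideal.add[OF _ rel_ideal_minus] by fastforce

lemma rel_ideal_sum: "(\<And>a. a \<in> A \<Longrightarrow> f a \<in> rel_ideal) \<Longrightarrow> sum f A \<in> rel_ideal"
  by (induction A rule: infinite_finite_induct) (auto intro: rel_ideal.add rel_ideal_zero)

subsection \<open>Every element can be straightened\<close>

text \<open>
  The preimage in \<open>T(V)#S\<^sub>n\<close> of the part of degree less than \<open>m\<close> in the quotient by the relations.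
\<close>

definition below :: "nat \<Rightarrow> 'n skew_alg set"
  where "below m = {f. \<exists>i\<in>rel_ideal. f - i \<in> short m}"

lemma below_add: "f \<in> below m \<Longrightarrow> h \<in> below m \<Longrightarrow> f + h \<in> below m"
proof -
  assume "f \<in> below m" "h \<in> below m"
  then obtain i j where i: "i \<in> rel_ideal" "f - i \<in> short m" and j: "j \<in> rel_ideal" "h - j \<in> short m"
    unfolding below_def by blast
  have "f + h - (i + j) \<in> short m"
    using short_add[OF i(2) j(2)] by (simp add: algebra_simps)
  then show ?thesis unfolding below_def using rel_ideal.add[OF i(1) j(1)] by blast
qed

lemma below_zero [simp]: "0 \<in> below m"
  unfolding below_def using rel_ideal_zero by force

lemma below_mult_left:
  "f \<in> below m \<Longrightarrow> a \<in> short (Suc k) \<Longrightarrow> a * f \<in> below (k + m)"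
proof -
  assume "f \<in> below m" and a: "a \<in> short (Suc k)"
  then obtain i where i: "i \<in> rel_ideal" "f - i \<in> short m" by (auto simp: below_def)
  have "a * f - a * i \<in> short (k + m)"
    using short_mult[OF a i(2)] by (simp add: algebra_simps)
  then show ?thesis unfolding below_def using rel_ideal_left[OF i(1)] by blast
qed

lemma below_mult_grp: "f \<in> below m \<Longrightarrow> f * grp g \<in> below m"
proof -
  assume "f \<in> below m"
  then obtain i where i: "i \<in> rel_ideal" "f - i \<in> short m" by (auto simp: below_def)
  have "f * grp g - i * grp g \<in> short m"
    using short_mult_grp[OF i(2)] by (simp add: algebra_simps)
  then show ?thesis unfolding below_def using rel_ideal_right[OF i(1)] by blast
qed

lemma below_minus: "f \<in> below m \<Longrightarrow> - f \<in> below m"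
  using below_mult_left[of f m "scalar (- 1)" 0] scalar_short[of "Suc 0" "- 1"]
  by (simp add: scalar_minus)

lemma below_sum: "(\<And>a. a \<in> A \<Longrightarrow> f a \<in> below m) \<Longrightarrow> sum f A \<in> below m"
  by (induction A rule: infinite_finite_induct) (auto intro: below_add)

lemma exchange_below: "wrd (p # q # w) - wrd (q # p # w) \<in> below (length w + 2)"
proof -
  have "wrd (p # q # w) - wrd (q # p # w) - rel (axis p 1) (axis q 1) * wrd w =
      kap (axis p 1) (axis q 1) * wrd w"
    by (simp add: rel_def vec_elem_axis wrd_Cons[of p "q # w"] wrd_Cons[of q "p # w"]
        wrd_Cons[of q w] wrd_Cons[of p w] algebra_simps)
  moreover have "kap (axis p 1) (axis q 1) * wrd w \<in> short (1 + Suc (length w))"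
    by (intro short_mult) (auto simp: kap_short numeral_2_eq_2[symmetric] wrd_short)
  ultimately have "wrd (p # q # w) - wrd (q # p # w) - rel (axis p 1) (axis q 1) * wrd w
      \<in> short (length w + 2)"
    by simp
  then show ?thesis
    unfolding below_def using rel_ideal_right[OF rel_in_ideal] by blast
qed

text \<open>
  Exchanging two adjacent letters costs only shorter words, because \<open>\<kappa>\<close> has values of degree at
  most one.  Moving a letter to the front is a sequence of such exchanges.
\<close>

lemma bring_to_front: "wrd (u @ p # v) - wrd (p # u @ v) \<in> below (length u + length v + 1)"
proof (induction u)
  case (Cons q u)
  have "wrd ((q # u) @ p # v) - wrd (p # (q # u) @ v) =
      wrd [q] * (wrd (u @ p # v) - wrd (p # u @ v)) + (wrd (q # p # u @ v) - wrd (p # q # u @ v))"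
    using wrd_Cons[of q "u @ p # v"] wrd_Cons[of q "p # u @ v"] by (simp add: algebra_simps)
  moreover have "wrd [q] * (wrd (u @ p # v) - wrd (p # u @ v)) \<in> below (1 + (length u + length v + 1))"
    by (rule below_mult_left[OF Cons]) (simp add: wrd_short)
  moreover have "wrd (q # p # u @ v) - wrd (p # q # u @ v) \<in> below (1 + (length u + length v + 1))"
    using exchange_below[of q p "u @ v"] by simp
  ultimately have "wrd ((q # u) @ p # v) - wrd (p # (q # u) @ v) \<in> below (1 + (length u + length v + 1))"
    by (simp only: below_add)
  then show ?case by simp
qed simp

lemma same_content_below: "mset v = mset w \<Longrightarrow> wrd v - wrd w \<in> below (length v)"
proof (induction v arbitrary: w)
  case (Cons p v)
  then obtain u t where w: "w = u @ p # t"
    by (metis list.set_intros(1) set_mset_mset split_list)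
  with Cons have *: "mset v = mset (u @ t)" by simp
  then have len: "length v = length u + length t" by (metis length_append size_mset)
  have "wrd (p # v) - wrd w =
      wrd [p] * (wrd v - wrd (u @ t)) + - (wrd (u @ p # t) - wrd (p # u @ t))"
    using wrd_Cons[of p v] wrd_Cons[of p "u @ t"] w by (simp add: algebra_simps)
  moreover have "wrd [p] * (wrd v - wrd (u @ t)) \<in> below (1 + length v)"
    by (rule below_mult_left[OF Cons.IH[OF *]]) (simp add: wrd_short)
  moreover have "- (wrd (u @ p # t) - wrd (p # u @ t)) \<in> below (1 + length v)"
    using below_minus[OF bring_to_front[of u p t]] len by simp
  ultimately show ?case using below_add by fastforce
qed simp

text \<open>
  In the quotient every element is, up to lower degree, equal to its normal form.  This is the
  half of the PBW property that holds for every \<open>\<kappa>\<close>: the associated graded algebra is a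
  quotient of \<open>S(V)#S\<^sub>n\<close>.
\<close>

lemma nform_below: "f \<in> homog m \<Longrightarrow> f - nform f \<in> below m"
proof -
  assume f: "f \<in> homog m"
  have "f - nform f = (\<Sum>k\<in>Poly_Mapping.keys f. scalar (Poly_Mapping.lookup f k) *
      (wrd (letters_of k) - wrd (nf (word_content (letters_of k)))) * grp (twist k))"
    by (subst skew_expansion[of f]) (simp add: lin_def sum_subtractf algebra_simps)
  moreover have "\<dots> \<in> below m"
  proof (intro below_sum below_mult_grp)
    fix k assume "k \<in> Poly_Mapping.keys f"
    then have "length (letters_of k) = m" using f by (auto simp: homog_def)
    moreover have "mset (letters_of k) = mset (nf (word_content (letters_of k)))"
      using content_eq_iff content_nf by metis
    ultimately have "wrd (letters_of k) - wrd (nf (word_content (letters_of k))) \<in> below m"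
      using same_content_below by metis
    then show "scalar (Poly_Mapping.lookup f k) *
        (wrd (letters_of k) - wrd (nf (word_content (letters_of k)))) \<in> below m"
      using below_mult_left[OF _ scalar_short[of "Suc 0"]] by fastforce
  qed
  ultimately show ?thesis by simp
qed

end

section \<open>The Jacobi identity modulo the relations\<close>

definition cyc :: "('v \<Rightarrow> 'v \<Rightarrow> 'v \<Rightarrow> 'z::plus) \<Rightarrow> 'v \<Rightarrow> 'v \<Rightarrow> 'v \<Rightarrow> 'z"
  where "cyc F u v w = F u v w + F v w u + F w u v"

lemma mult_sum_grp:
  "(\<Sum>g\<in>UNIV. \<Sum>h\<in>UNIV. F g h * grp (h * g)) = (\<Sum>h\<in>UNIV. (\<Sum>g\<in>UNIV. F g (h * inverse g)) * grp h)"
  for F :: "'n::finite perm \<Rightarrow> 'n perm \<Rightarrow> 'n skew_alg"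
proof -
  have "(\<Sum>h\<in>UNIV. F g h * grp (h * g)) = (\<Sum>h\<in>UNIV. F g (h * inverse g) * grp h)" for g
    by (rule sum.reindex_bij_witness[of _ "\<lambda>h. h * inverse g" "\<lambda>h. h * g"]) (auto simp: mult.assoc)
  then show ?thesis
    by (simp add: sum_distrib_right) (rule sum.swap)
qed

lemma perm_cancel [simp]:
  "g * (inverse g * h) = (h :: 'a perm)" "inverse g * (g * h) = (h :: 'a perm)"
  by (simp_all add: mult.assoc[symmetric])

lemma two_times_eq_0: "2 * (x :: 'n skew_alg) = 0 \<longleftrightarrow> x = 0"
proof
  assume "2 * x = 0"
  then have "x + x = 0" by (simp only: mult_2)
  then have "Poly_Mapping.lookup x k + Poly_Mapping.lookup x k = 0" for k
    by (metis lookup_add lookup_zero)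
  then show "x = 0" by (intro poly_mapping_eqI) (auto simp: field_simps)
qed simp

lemma scalar_2: "scalar 2 = (2 :: 'n skew_alg)"
proof -
  have "scalar (1 + 1) = (scalar 1 + scalar 1 :: 'n skew_alg)" by (rule scalar_add)
  then show ?thesis by simp
qed

context cochain_pair
begin

definition invariant :: bool
  where "invariant \<longleftrightarrow>
    (\<forall>g h u v. \<kappa>L (g * h * inverse g) (doubled_perm_rep g u) (doubled_perm_rep g v) =
       doubled_perm_rep g (\<kappa>L h u v)) \<and>
    (\<forall>g h u v. \<kappa>C (g * h * inverse g) (doubled_perm_rep g u) (doubled_perm_rep g v) = \<kappa>C h u v)"

text \<open>
  This coefficient and the two defects below are the components of degree two, one and zero of
  twice the Jacobi sum, that is of the cyclic sum of \<open>[\<kappa>(u, v), w]\<close>, once it is rewritten modulo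
  the relations: \<open>[\<kappa>(u, v), w] = \<Sum>\<^sub>g (\<kappa>\<^sub>g(u, v) (g w) - w \<kappa>\<^sub>g(u, v)) g\<close>, and the quadratic products in it
  are symmetrized at the price of a relation between \<open>\<kappa>\<^sup>L\<^sub>g(u, v)\<close> and \<open>w + g w\<close>.  Doubling avoids
  fractions.
\<close>

definition cocycle_coeff ::
    "'n perm \<Rightarrow> complex ^ ('n + 'n) \<Rightarrow> complex ^ ('n + 'n) \<Rightarrow> complex ^ ('n + 'n) \<Rightarrow>
     'n + 'n \<Rightarrow> 'n + 'n \<Rightarrow> complex"
  where "cocycle_coeff g u v w p q =
    cyc (\<lambda>u v w. \<kappa>L g u v $ p * (doubled_perm_rep g w - w) $ q +
                  \<kappa>L g u v $ q * (doubled_perm_rep g w - w) $ p) u v w"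

definition linear_defect ::
    "'n perm \<Rightarrow> complex ^ ('n + 'n) \<Rightarrow> complex ^ ('n + 'n) \<Rightarrow> complex ^ ('n + 'n) \<Rightarrow> complex ^ ('n + 'n)"
  where "linear_defect h u v w =
    cyc (\<lambda>u v w. (\<Sum>g\<in>UNIV. \<kappa>L (h * inverse g) (\<kappa>L g u v) (w + doubled_perm_rep g w)) +
                  (2 * \<kappa>C h u v) *s (doubled_perm_rep h w - w)) u v w"

definition constant_defect ::
    "'n perm \<Rightarrow> complex ^ ('n + 'n) \<Rightarrow> complex ^ ('n + 'n) \<Rightarrow> complex ^ ('n + 'n) \<Rightarrow> complex"
  where "constant_defect h u v w =
    cyc (\<lambda>u v w. \<Sum>g\<in>UNIV. \<kappa>C (h * inverse g) (\<kappa>L g u v) (w + doubled_perm_rep g w)) u v w"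

definition pbw_conditions :: bool
  where "pbw_conditions \<longleftrightarrow> invariant \<and>
    (\<forall>g u v w p q. cocycle_coeff g u v w p q = 0) \<and>
    (\<forall>h u v w. linear_defect h u v w = 0) \<and> (\<forall>h u v w. constant_defect h u v w = 0)"

definition jacobi :: "complex ^ ('n + 'n) \<Rightarrow> complex ^ ('n + 'n) \<Rightarrow> complex ^ ('n + 'n) \<Rightarrow> 'n skew_alg"
  where "jacobi = cyc (\<lambda>u v w. kap u v * vec_elem w - vec_elem w * kap u v)"

definition jacobi_rels :: "complex ^ ('n + 'n) \<Rightarrow> complex ^ ('n + 'n) \<Rightarrow> complex ^ ('n + 'n) \<Rightarrow> 'n skew_alg"
  where "jacobi_rels =
    cyc (\<lambda>u v w. \<Sum>g\<in>UNIV. rel (\<kappa>L g u v) (w + doubled_perm_rep g w) * grp g)"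

definition sym_part :: "complex ^ ('n + 'n) \<Rightarrow> complex ^ ('n + 'n) \<Rightarrow> 'n skew_alg"
  where "sym_part l d = vec_elem l * vec_elem d + vec_elem d * vec_elem l"

lemma vec_elem_mult:
  "vec_elem u * vec_elem v = (\<Sum>p\<in>UNIV. \<Sum>q\<in>UNIV. scalar (u $ p * v $ q) * wrd [p, q])"
  for u v :: "complex ^ ('m::finite + 'm)"
proof -
  have "scalar (u $ p) * wrd [p] * (scalar (v $ q) * wrd [q]) = scalar (u $ p * v $ q) * wrd [p, q]" for p q
    using scalar_left_commute[of "wrd [p]" "v $ q" "wrd [q]"] wrd_Cons[of p "[q]"]
    by (simp add: scalar_mult mult.assoc)
  then show ?thesis by (simp add: vec_elem_def sum_product)
qed

lemma sym_part_expansion: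
  "sym_part l d = (\<Sum>p\<in>UNIV. \<Sum>q\<in>UNIV. scalar (l $ p * d $ q + l $ q * d $ p) * wrd [p, q])"
  by (simp add: sym_part_def vec_elem_mult scalar_add algebra_simps sum.distrib)

lemma twice_commutator:
  "2 * (kap u v * vec_elem w - vec_elem w * kap u v) =
     (\<Sum>g\<in>UNIV. rel (\<kappa>L g u v) (w + doubled_perm_rep g w) * grp g) +
     (\<Sum>g\<in>UNIV. sym_part (\<kappa>L g u v) (doubled_perm_rep g w - w) * grp g) +
     (\<Sum>h\<in>UNIV. (vec_elem ((\<Sum>g\<in>UNIV. \<kappa>L (h * inverse g) (\<kappa>L g u v) (w + doubled_perm_rep g w)) +
                  (2 * \<kappa>C h u v) *s (doubled_perm_rep h w - w)) +
        scalar (\<Sum>g\<in>UNIV. \<kappa>C (h * inverse g) (\<kappa>L g u v) (w + doubled_perm_rep g w))) * grp h)"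
proof -
  let ?l = "\<lambda>g. \<kappa>L g u v" and ?gw = "\<lambda>g. doubled_perm_rep g w"
  have gw: "grp g * vec_elem w = vec_elem (?gw g) * grp g" for g by (rule grp_vec_elem)
  have collect: "2 * e = r * z + s * z + k * z + y * z"
    if "e = (x + c) * z" "2 * x = r + s + k" "2 * c = y" for e x c z r s k y :: "'n skew_alg"
  proof -
    have "2 * e = (2 * x + 2 * c) * z" using that(1) by (simp add: algebra_simps mult_2)
    then show ?thesis unfolding that(2,3) by (simp only: distrib_right)
  qed
  have summand: "2 * ((vec_elem (?l g) + scalar (\<kappa>C g u v)) * grp g * vec_elem w -
        vec_elem w * ((vec_elem (?l g) + scalar (\<kappa>C g u v)) * grp g)) =
      rel (?l g) (w + ?gw g) * grp g + sym_part (?l g) (?gw g - w) * grp g +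
      kap (?l g) (w + ?gw g) * grp g + vec_elem ((2 * \<kappa>C g u v) *s (?gw g - w)) * grp g" for g
  proof -
    have "(vec_elem (?l g) + scalar (\<kappa>C g u v)) * grp g * vec_elem w -
        vec_elem w * ((vec_elem (?l g) + scalar (\<kappa>C g u v)) * grp g) =
      (vec_elem (?l g) * vec_elem (?gw g) - vec_elem w * vec_elem (?l g)
        + scalar (\<kappa>C g u v) * vec_elem (?gw g - w)) * grp g"
      by (simp add: mult.assoc gw algebra_simps vec_elem_diff scalar_left_commute)
    moreover have "2 * (vec_elem (?l g) * vec_elem (?gw g) - vec_elem w * vec_elem (?l g)) =
      rel (?l g) (w + ?gw g) + sym_part (?l g) (?gw g - w) + kap (?l g) (w + ?gw g)"
      by (simp add: rel_def sym_part_def vec_elem_add vec_elem_diff algebra_simps mult_2)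
    moreover have "2 * (scalar (\<kappa>C g u v) * vec_elem (?gw g - w)) =
        vec_elem ((2 * \<kappa>C g u v) *s (?gw g - w))"
      by (simp only: vec_elem_scale scalar_mult scalar_2 mult.assoc)
    ultimately show ?thesis by (rule collect)
  qed
  have kk: "(\<Sum>g\<in>UNIV. kap (?l g) (w + ?gw g) * grp g) =
      (\<Sum>h\<in>UNIV. (vec_elem (\<Sum>g\<in>UNIV. \<kappa>L (h * inverse g) (?l g) (w + ?gw g)) +
        scalar (\<Sum>g\<in>UNIV. \<kappa>C (h * inverse g) (?l g) (w + ?gw g))) * grp h)"
    using mult_sum_grp[of "\<lambda>g h. vec_elem (\<kappa>L h (?l g) (w + ?gw g)) + scalar (\<kappa>C h (?l g) (w + ?gw g))"]
    by (simp add: kap_def sum_distrib_right mult.assoc grp_mult vec_elem_sum scalar_sum sum.distrib)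
  have "2 * (kap u v * vec_elem w - vec_elem w * kap u v) =
      (\<Sum>g\<in>UNIV. 2 * ((vec_elem (?l g) + scalar (\<kappa>C g u v)) * grp g * vec_elem w -
        vec_elem w * ((vec_elem (?l g) + scalar (\<kappa>C g u v)) * grp g)))"
    unfolding kap_def sum_distrib_left sum_distrib_right sum_subtractf[symmetric] ..
  also have "\<dots> = (\<Sum>g\<in>UNIV. rel (?l g) (w + ?gw g) * grp g) +
      (\<Sum>g\<in>UNIV. sym_part (?l g) (?gw g - w) * grp g) +
      ((\<Sum>g\<in>UNIV. kap (?l g) (w + ?gw g) * grp g) +
       (\<Sum>g\<in>UNIV. vec_elem ((2 * \<kappa>C g u v) *s (?gw g - w)) * grp g))"
    unfolding summand by (simp only: sum.distrib add.assoc)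
  finally show ?thesis
    unfolding kk sum.distrib[symmetric]
    by (simp only: vec_elem_add distrib_right add.assoc add.commute add.left_commute)
qed

text \<open>
  Twice the Jacobi sum is a combination of relations, plus a symmetric tensor, plus an affine
  part.  If the last two vanish, the Jacobi sum is a combination of relations of length two,
  which is shorter than the overlap of three letters that it comes from.  In any case the sum
  of the last two lies in the ideal, and the PBW property forces it to vanish.
\<close>

lemma twice_jacobi:
  "2 * jacobi u v w = jacobi_rels u v w +
     (\<Sum>g\<in>UNIV. (\<Sum>p\<in>UNIV. \<Sum>q\<in>UNIV. scalar (cocycle_coeff g u v w p q) * wrd [p, q]) * grp g) +
     (\<Sum>h\<in>UNIV. (vec_elem (linear_defect h u v w) + scalar (constant_defect h u v w)) * grp h)"
proof -
  have "(\<Sum>g\<in>UNIV. (\<Sum>p\<in>UNIV. \<Sum>q\<in>UNIV. scalar (cocycle_coeff g u v w p q) * wrd [p, q]) * grp g) =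
    cyc (\<lambda>u v w. \<Sum>g\<in>UNIV. sym_part (\<kappa>L g u v) (doubled_perm_rep g w - w) * grp g) u v w"
    unfolding cocycle_coeff_def cyc_def sym_part_expansion
    by (simp only: scalar_add distrib_right sum.distrib)
  moreover have "2 * jacobi u v w =
      cyc (\<lambda>u v w. 2 * (kap u v * vec_elem w - vec_elem w * kap u v)) u v w"
    unfolding jacobi_def cyc_def by (simp only: distrib_left)
  ultimately show ?thesis
    unfolding twice_commutator jacobi_rels_def linear_defect_def constant_defect_def cyc_def
      vec_elem_add scalar_add distrib_right sum.distrib
    by (simp only: add.assoc add.commute add.left_commute)
qed

text \<open>
  Invariance is what allows group elements to be moved past relations, so that the ideal is
  spanned by relations multiplied by words and a single group element on the right.
\<close>

lemma kap_grp:
  assumes invariant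
  shows "grp g * kap u v = kap (doubled_perm_rep g u) (doubled_perm_rep g v) * grp g"
proof -
  let ?K = "\<lambda>h u v. vec_elem (\<kappa>L h u v) + scalar (\<kappa>C h u v)"
  have "kap (doubled_perm_rep g u) (doubled_perm_rep g v) * grp g =
      (\<Sum>h\<in>UNIV. ?K h (doubled_perm_rep g u) (doubled_perm_rep g v) * grp h * grp g)"
    by (simp add: kap_def sum_distrib_right)
  also have "\<dots> = (\<Sum>h\<in>UNIV. ?K (g * h * inverse g) (doubled_perm_rep g u) (doubled_perm_rep g v) *
      grp (g * h * inverse g) * grp g)"
    by (rule sum.reindex_bij_witness[of _ "\<lambda>h. g * h * inverse g" "\<lambda>h. inverse g * h * g"])
       (auto simp: mult.assoc)
  also have "\<dots> = (\<Sum>h\<in>UNIV. grp g * (?K h u v * grp h))"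
  proof (rule sum.cong[OF refl])
    fix h
    have "?K (g * h * inverse g) (doubled_perm_rep g u) (doubled_perm_rep g v) =
        vec_elem (doubled_perm_rep g (\<kappa>L h u v)) + scalar (\<kappa>C h u v)"
      using assms unfolding invariant_def by metis
    moreover have "grp (g * h * inverse g) * grp g = grp g * grp h"
      by (simp add: grp_mult[symmetric] mult.assoc)
    ultimately show "?K (g * h * inverse g) (doubled_perm_rep g u) (doubled_perm_rep g v) *
      grp (g * h * inverse g) * grp g = grp g * (?K h u v * grp h)"
      using grp_vec_elem[of g "\<kappa>L h u v"]
      by (simp add: mult.assoc distrib_left distrib_right scalar_left_commute)
         (simp add: mult.assoc[symmetric])
  qed
  finally show ?thesis by (simp add: kap_def sum_distrib_left)
qed

lemma rel_grp:
  "invariant \<Longrightarrow> grp g * rel u v = rel (doubled_perm_rep g u) (doubled_perm_rep g v) * grp g"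
proof -
  assume inv: invariant
  have "grp g * (vec_elem u * vec_elem v) =
      vec_elem (doubled_perm_rep g u) * vec_elem (doubled_perm_rep g v) * grp g" for u v
    by (metis grp_vec_elem mult.assoc)
  then show ?thesis
    by (simp add: rel_def kap_grp[OF inv] right_diff_distrib left_diff_distrib)
qed

subsection \<open>Relations of bounded length\<close>

text \<open>
  Combinations of relations in which no word longer than \<open>n\<close> occurs, even before cancellation.
  These are the elements that a straightening of the words of length at most \<open>n\<close> kills.
\<close>

inductive_set rel_span :: "nat \<Rightarrow> 'n skew_alg set" for n where
  zero: "0 \<in> rel_span n"
| gen: "length u + 2 + length w \<le> n \<Longrightarrow>
    scalar c * (wrd u * rel (axis p 1) (axis q 1) * wrd w) * grp g \<in> rel_span n"
| add: "x \<in> rel_span n \<Longrightarrow> y \<in> rel_span n \<Longrightarrow> x + y \<in> rel_span n"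

lemma rel_span_sum: "(\<And>a. a \<in> A \<Longrightarrow> f a \<in> rel_span n) \<Longrightarrow> sum f A \<in> rel_span n"
  by (induction A rule: infinite_finite_induct) (auto intro: rel_span.add rel_span.zero)

lemma rel_span_mono: "x \<in> rel_span n \<Longrightarrow> n \<le> m \<Longrightarrow> x \<in> rel_span m"
  by (induction rule: rel_span.induct) (auto intro: rel_span.intros)

text \<open>
  Group elements inside the product are moved to the right by invariance; this permutes the
  letters and so preserves all lengths.
\<close>

lemma rel_span_gen:
  assumes inv: invariant and a: "a \<in> short (Suc j)" and b: "b \<in> short (Suc k)" and n: "j + 2 + k \<le> n"
  shows "a * rel u v * b \<in> rel_span n"
proof -
  have pull_scalars: "scalar c * x * g * (scalar e * r) * (scalar d * z) =
      scalar (d * e * c) * (x * (g * (r * z)))" for c d e and x g r z :: "'n skew_alg"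
  proof -
    have "scalar c * x * g * (scalar e * r) = scalar e * (scalar c * x * g * r)"
      by (rule scalar_left_commute)
    then have "scalar c * x * g * (scalar e * r) * (scalar d * z) =
        scalar d * (scalar e * (scalar c * x * g * r) * z)"
      by (metis scalar_left_commute)
    then show ?thesis by (simp only: scalar_mult mult.assoc)
  qed
  have basic: "scalar c * wrd x * grp g * (scalar e * rel (axis p 1) (axis q 1)) *
      (scalar d * wrd y * grp h) \<in> rel_span n"
    if "length x \<le> j" "length y \<le> k" for c d e x y g h p q
  proof -
    have "grp g * (rel (axis p 1) (axis q 1) * (wrd y * grp h)) =
        rel (axis (lact g p) 1) (axis (lact g q) 1) * (wrd (map (lact g) y) * grp (g * h))"
    proof -
      have "grp g * (rel (axis p 1) (axis q 1) * (wrd y * grp h)) =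
          (grp g * rel (axis p 1) (axis q 1)) * (wrd y * grp h)"
        by (simp only: mult.assoc)
      also have "\<dots> = rel (axis (lact g p) 1) (axis (lact g q) 1) * ((grp g * wrd y) * grp h)"
        by (simp only: rel_grp[OF inv] doubled_perm_rep_axis mult.assoc)
      finally show ?thesis by (simp only: grp_wrd grp_mult mult.assoc)
    qed
    then have "scalar c * wrd x * grp g * (scalar e * rel (axis p 1) (axis q 1)) *
        (scalar d * (wrd y * grp h)) =
      scalar (d * e * c) * (wrd x * (rel (axis (lact g p) 1) (axis (lact g q) 1) *
        (wrd (map (lact g) y) * grp (g * h))))"
      by (simp only: pull_scalars)
    then have "scalar c * wrd x * grp g * (scalar e * rel (axis p 1) (axis q 1)) *
        (scalar d * wrd y * grp h) =
      scalar (d * e * c) * (wrd x * rel (axis (lact g p) 1) (axis (lact g q) 1) * wrd (map (lact g) y)) *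
        grp (g * h)"
      by (simp only: mult.assoc)
    also have "\<dots> \<in> rel_span n"
      using that n by (intro rel_span.gen) simp
    finally show ?thesis .
  qed
  have "a * rel u v * b =
    (\<Sum>k\<in>Poly_Mapping.keys a. scalar (Poly_Mapping.lookup a k) * wrd (letters_of k) * grp (twist k)) *
    (\<Sum>p\<in>UNIV. \<Sum>q\<in>UNIV. scalar (u $ p * v $ q) * rel (axis p 1) (axis q 1)) *
    (\<Sum>k\<in>Poly_Mapping.keys b. scalar (Poly_Mapping.lookup b k) * wrd (letters_of k) * grp (twist k))"
    using skew_expansion[of a] skew_expansion[of b] rel_expansion[of u v] by simp
  also have "\<dots> \<in> rel_span n"
    unfolding sum_distrib_left sum_distrib_right
    using a b by (intro rel_span_sum basic) (auto simp: short_def less_Suc_eq_le)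
  finally show ?thesis .
qed

lemma rel_ideal_span:
  assumes inv: invariant and "f \<in> rel_ideal"
  shows "\<exists>n. f \<in> rel_span n"
  using assms(2)
proof induction
  case (gen a u v b)
  obtain j k where "a \<in> short j" "b \<in> short k" using short_exists by metis
  then have "a \<in> short (Suc j)" "b \<in> short (Suc k)" using short_mono by (metis le_SucI order_refl)+
  then show ?case using rel_span_gen[OF inv] by blast
next
  case (add x y)
  then obtain m n where "x \<in> rel_span m" "y \<in> rel_span n" by blast
  then have "x \<in> rel_span (max m n)" "y \<in> rel_span (max m n)"
    using rel_span_mono max.cobounded1[of m n] max.cobounded2[of n m] by blast+
  then show ?case using rel_span.add by blast
qed


section \<open>The PBW criterion\<close>

text \<open>
  Leading symbols of elements of the ideal vanish in \<open>S(V)#S\<^sub>n\<close>; equivalently, the surjection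
  from \<open>S(V)#S\<^sub>n\<close> onto the associated graded algebra is injective.
\<close>

definition pbw :: bool
  where "pbw \<longleftrightarrow> (\<forall>k f. f \<in> rel_ideal \<longrightarrow> f \<in> short (Suc k) \<longrightarrow> nform (hcomp k f) = 0)"

text \<open>
  \<open>L\<close> rewrites words of length at most \<open>n\<close> so that the exchange relations hold, without
  changing the leading normal form.  Its linear extension kills \<open>rel_span n\<close> and preserves
  leading symbols, which together exclude ideal elements with nonzero symbol.
\<close>

definition straightens :: "nat \<Rightarrow> (('n + 'n) list \<Rightarrow> 'n skew_alg) \<Rightarrow> bool"
  where "straightens n L \<longleftrightarrow>
    (\<forall>u p q v. length u + 2 + length v \<le> n \<longrightarrow>
       L (u @ p # q # v) - L (u @ q # p # v) = lin L (wrd u * kap (axis p 1) (axis q 1) * wrd v)) \<and>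
    (\<forall>w. length w \<le> n \<longrightarrow> L w - wrd (nf (word_content w)) \<in> short (length w))"

lemma straightens_leading:
  "straightens n L \<Longrightarrow> length w \<le> n \<Longrightarrow> length w \<le> m \<Longrightarrow>
    L w - wrd (nf (word_content w)) \<in> short m"
  unfolding straightens_def using short_mono by blast

lemma wrd_split: "wrd (u @ p # q # v) = wrd u * wrd [p] * wrd [q] * wrd v"
  by (simp add: wrd_append wrd_Cons[of p "q # v"] wrd_Cons[of q v] mult.assoc)

lemma rel_axis:
  "rel (axis p 1) (axis q 1) = wrd [p] * wrd [q] - wrd [q] * wrd [p] - kap (axis p 1) (axis q 1)"
  by (simp add: rel_def vec_elem_axis)

lemma lin_kills_rels:
  assumes L: "straightens n L" and f: "f \<in> rel_span n"
  shows "lin L f = 0"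
  using f
proof induction
  case (gen u w c p q g)
  have "wrd u * rel (axis p 1) (axis q 1) * wrd w =
      wrd (u @ p # q # w) - wrd (u @ q # p # w) - wrd u * kap (axis p 1) (axis q 1) * wrd w"
    by (simp add: rel_axis wrd_split algebra_simps)
  then have "lin L (wrd u * rel (axis p 1) (axis q 1) * wrd w) = 0"
    using L gen by (simp add: lin_diff lin_wrd straightens_def)
  then show ?case by (simp add: lin_grp lin_scalar)
qed (simp_all add: lin_add)

lemma middle_short:
  assumes "length u + 2 + length v = n"
  shows "wrd u * kap x y * wrd v \<in> short n"
proof -
  have "wrd u * kap x y \<in> short (length u + 2)"
    by (rule short_mult[OF wrd_short kap_short]) simp
  then have "wrd u * kap x y * wrd v \<in> short ((length u + 1) + Suc (length v))"
    by (intro short_mult wrd_short) (simp_all add: numeral_2_eq_2)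
  then show ?thesis using assms by (simp add: numeral_2_eq_2)
qed

lemma lin_straightens_short:
  assumes L: "straightens n L" and f: "f \<in> short m" "m \<le> Suc n"
  shows "lin L f \<in> short m"
proof (rule lin_short[OF f(1)])
  fix w :: "('n + 'n) list" assume w: "length w < m"
  then have "L w - wrd (nf (word_content w)) \<in> short m"
    using f(2) by (intro straightens_leading[OF L]) simp_all
  moreover have "wrd (nf (word_content w)) \<in> short m" using w by (simp add: wrd_short)
  ultimately show "L w \<in> short m" using short_add by fastforce
qed

text \<open>
  Under the PBW conditions twice the Jacobi sum is a combination of relations, and as such it
  is killed by \<open>L\<close> even inside a word, provided that the relations involved are short enough.
\<close>

lemma jacobi_vanishes:
  assumes cond: pbw_conditions and L: "straightens n L" and n: "length u + 2 + length v \<le> n"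
  shows "lin L (wrd u * jacobi x y z * wrd v) = 0"
proof -
  have inv: invariant and *: "2 * jacobi x y z = jacobi_rels x y z"
    using cond twice_jacobi[of x y z] by (auto simp: pbw_conditions_def)
  have "wrd u * rel a b * grp g * wrd v \<in> rel_span n" for a b g
    using rel_span_gen[OF inv, of "wrd u" "length u" "wrd (map (lact g) v) * grp g" "length v" n a b]
      n short_mult_grp[OF wrd_short, of "map (lact g) v" "Suc (length v)" g]
    by (simp add: wrd_short grp_wrd mult.assoc)
  then have "wrd u * jacobi_rels x y z * wrd v \<in> rel_span n"
    unfolding jacobi_rels_def cyc_def
    by (simp add: distrib_left distrib_right sum_distrib_left sum_distrib_right mult.assoc[symmetric])
       (intro rel_span.add rel_span_sum, simp_all)
  then have "lin L (wrd u * (2 * jacobi x y z) * wrd v) = 0"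
    using lin_kills_rels[OF L] * by simp
  moreover have "wrd u * (2 * jacobi x y z) * wrd v = 2 * (wrd u * jacobi x y z * wrd v)"
    by (simp add: mult_2 algebra_simps)
  ultimately have "2 * lin L (wrd u * jacobi x y z * wrd v) = 0"
    by (simp only: mult_2 lin_add)
  then show ?thesis by (simp only: two_times_eq_0)
qed

text \<open>
  On words of length \<open>n + 1\<close> an exchange has to change the value by \<open>L\<close> applied to words of length at
  most \<open>n\<close>, where \<open>L\<close> is already known.  Thus \<open>exchange_system\<close> applies: the two sides of far
  commutation differ by multiples of relations that involve only words of length at most \<open>n\<close>,
  and those of the braid relation by a Jacobi sum.
\<close>

lemma straightens_step:
  assumes cond: pbw_conditions and L: "straightens n L"
  shows "\<exists>L'. straightens (Suc n) L'"
proof -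
  have inv: invariant using cond by (simp add: pbw_conditions_def)
  let ?k = "\<lambda>p q. kap (axis p 1) (axis q 1)"
  \<comment> \<open>exchange terms are only prescribed in length \<open>n + 1\<close>; elsewhere zero is consistent\<close>
  define D where "D u p q v =
    (if length u + 2 + length v = Suc n then lin L (wrd u * ?k p q * wrd v) else 0)"
    for u p q v
  have kap_self: "kap x x = 0" for x
    using kap_skew[of x x] two_times_eq_0[of "kap x x"] by (simp add: mult_2 eq_neg_iff_add_eq_0)
  have far: "D u p q (v @ r # s # w) - D u p q (v @ s # r # w) =
      D (u @ p # q # v) r s w - D (u @ q # p # v) r s w" for u p q v r s w
  proof (cases "length u + 2 + length v + 2 + length w = Suc n")
    case True
    have A: "wrd u * ?k p q * wrd (v @ r # s # w) - wrd u * ?k p q * wrd (v @ s # r # w) =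
        (wrd u * ?k p q * wrd v) * rel (axis r 1) (axis s 1) * wrd w + wrd u * ?k p q * wrd v * ?k r s * wrd w"
      by (simp add: rel_axis wrd_split algebra_simps)
    have B: "wrd (u @ p # q # v) * ?k r s * wrd w - wrd (u @ q # p # v) * ?k r s * wrd w =
        wrd u * rel (axis p 1) (axis q 1) * (wrd v * ?k r s * wrd w) + wrd u * ?k p q * wrd v * ?k r s * wrd w"
      by (simp add: rel_axis wrd_split algebra_simps)
    have "(wrd u * ?k p q * wrd v) * rel (axis r 1) (axis s 1) * wrd w \<in> rel_span n"
      using middle_short[of u v "length u + 2 + length v" "axis p 1" "axis q 1"] True
      by (intro rel_span_gen[OF inv, of _ "length u + 1 + length v" _ "length w"])
         (auto simp: numeral_2_eq_2 wrd_short)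
    moreover have "wrd u * rel (axis p 1) (axis q 1) * (wrd v * ?k r s * wrd w) \<in> rel_span n"
      using middle_short[of v w "length v + 2 + length w" "axis r 1" "axis s 1"] True
      by (intro rel_span_gen[OF inv, of _ "length u" _ "length v + 1 + length w"])
         (auto simp: numeral_2_eq_2 wrd_short)
    ultimately have
      "lin L (wrd u * ?k p q * wrd (v @ r # s # w) - wrd u * ?k p q * wrd (v @ s # r # w)) =
       lin L (wrd (u @ p # q # v) * ?k r s * wrd w - wrd (u @ q # p # v) * ?k r s * wrd w)"
      unfolding A B lin_add using lin_kills_rels[OF L] by simp
    then show ?thesis using True by (simp add: D_def lin_diff)
  qed (simp add: D_def)
  have braid: "D u p q (r # v) + D (u @ [q]) p r v + D u q r (p # v) =
      D (u @ [p]) q r v + D u p r (q # v) + D (u @ [r]) p q v" for u p q r v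
  proof (cases "length u + 3 + length v = Suc n")
    case True
    have "wrd u * ?k p q * wrd (r # v) + wrd (u @ [q]) * ?k p r * wrd v + wrd u * ?k q r * wrd (p # v) =
        wrd u * jacobi (axis p 1) (axis q 1) (axis r 1) * wrd v +
        (wrd (u @ [p]) * ?k q r * wrd v + wrd u * ?k p r * wrd (q # v) + wrd (u @ [r]) * ?k p q * wrd v)"
      using kap_skew[of "axis r 1" "axis p 1"]
      by (simp add: jacobi_def cyc_def vec_elem_axis wrd_append wrd_Cons[of _ v] algebra_simps)
    then have "lin L (wrd u * ?k p q * wrd (r # v) + wrd (u @ [q]) * ?k p r * wrd v + wrd u * ?k q r * wrd (p # v)) =
        lin L (wrd (u @ [p]) * ?k q r * wrd v + wrd u * ?k p r * wrd (q # v) + wrd (u @ [r]) * ?k p q * wrd v)"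
      using jacobi_vanishes[OF cond L, of u v] True by (simp add: lin_add)
    then show ?thesis using True by (simp add: D_def lin_add)
  qed (simp add: D_def)
  interpret E: exchange_system to_nat D "\<lambda>w. wrd (nf (word_content w))"
  proof
    show "D u p q v = - D u q p v" for u p q v
      using kap_skew[of "axis p 1" "axis q 1"] by (simp add: D_def lin_minus)
    show "inj (to_nat :: 'n + 'n \<Rightarrow> nat)" by simp
  qed (rule far braid | simp add: D_def kap_self)+
  obtain S where S: "\<And>u p q v. S (u @ p # q # v) - S (u @ q # p # v) = D u p q v"
    and S0: "\<And>w. sorted (map to_nat w) \<Longrightarrow> S w = wrd (nf (word_content w))"
    using E.straightening_exists by blast
  have D_short: "D u p q v \<in> short (length u + 2 + length v)" for u p q v
    using lin_straightens_short[OF L middle_short[OF refl]] by (auto simp: D_def)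
  have S_short: "S w - wrd (nf (word_content w)) \<in> short (length w)" for w
  proof (induction w rule: E.exchange_induct)
    case (2 u p q v)
    have "S (u @ q # p # v) - wrd (nf (word_content (u @ q # p # v))) =
        (S (u @ p # q # v) - wrd (nf (word_content (u @ p # q # v)))) - D u p q v"
      using S[of u p q v] by (simp add: content_swap[of u p q v] algebra_simps)
    then show ?case using 2 short_diff[OF _ D_short] by (fastforce simp: numeral_2_eq_2)
  qed (simp add: S0)
  define L' where "L' w = (if length w \<le> n then L w else S w)" for w
  have "straightens (Suc n) L'"
    unfolding straightens_def
  proof (intro conjI allI impI)
    fix u v :: "('n + 'n) list" and p q
    assume le: "length u + 2 + length v \<le> Suc n"
    have same: "lin L' (wrd u * ?k p q * wrd v) = lin L (wrd u * ?k p q * wrd v)"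
      by (rule lin_cong[OF middle_short[OF refl]]) (use le in \<open>simp add: L'_def\<close>)
    show "L' (u @ p # q # v) - L' (u @ q # p # v) = lin L' (wrd u * ?k p q * wrd v)"
      using L le S[of u p q v] unfolding same
      by (cases "length u + 2 + length v = Suc n") (simp_all add: straightens_def L'_def D_def)
  next
    fix w :: "('n + 'n) list"
    show "L' w - wrd (nf (word_content w)) \<in> short (length w)"
      using L S_short by (simp add: L'_def straightens_def)
  qed
  then show ?thesis by blast
qed

lemma straightens_exists:
  assumes pbw_conditions
  shows "\<exists>L. straightens n L"
proof (induction n)
  case 0
  have "straightens 0 (\<lambda>w. wrd (nf (word_content w)))" by (simp add: straightens_def)
  then show ?case by blast
next
  case (Suc n)
  then show ?case using straightens_step[OF assms] by blast
qed

text \<open>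
  An element \<open>f\<close> of the ideal lies in \<open>rel_span n\<close> for some possibly large \<open>n\<close>.  A straightening
  map for that \<open>n\<close> kills \<open>f\<close> but agrees with the normal form in the leading degree.
\<close>

theorem pbw_sufficient:
  assumes cond: pbw_conditions
  shows pbw
  unfolding pbw_def
proof (intro allI impI)
  fix k f assume f: "f \<in> rel_ideal" "f \<in> short (Suc k)"
  have inv: invariant using cond by (simp add: pbw_conditions_def)
  obtain n where n: "f \<in> rel_span n" using rel_ideal_span[OF inv f(1)] by blast
  define m where "m = max n k"
  obtain L where L: "straightens m L" using straightens_exists[OF cond] by blast
  have "lin L f = 0"
    using lin_kills_rels[OF L] rel_span_mono[OF n, of m] by (simp add: m_def)
  moreover have "lin L f - nform f \<in> short k"
    unfolding lin_diff_fun
  proof (rule lin_short[OF f(2)])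
    fix w :: "('n + 'n) list" assume "length w < Suc k"
    then show "L w - wrd (nf (word_content w)) \<in> short k"
      by (intro straightens_leading[OF L]) (simp_all add: m_def)
  qed
  ultimately have "nform f \<in> short k" using short_minus by fastforce
  moreover have "nform (f - hcomp k f) \<in> short k"
    by (rule nform_short[OF short_Suc_hcomp[OF f(2)]])
  ultimately have "nform (hcomp k f) \<in> short k"
    using short_diff[of "nform f" k "nform (f - hcomp k f)"] by (simp add: lin_diff)
  then show "nform (hcomp k f) = 0"
    using homog_short_zero[OF nform_homog[OF hcomp_homog]] by blast
qed

subsection \<open>Necessity\<close>

text \<open>
  Words of length at most one are their own normal forms, so here leading symbols are the leading
  terms themselves.
\<close>

lemma ideal_short_zero: "pbw \<Longrightarrow> f \<in> rel_ideal \<Longrightarrow> f \<in> short 2 \<Longrightarrow> f = 0"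
proof -
  assume pbw: pbw and f: "f \<in> rel_ideal" "f \<in> short 2"
  have low: "hcomp k f = 0" if "f \<in> short (Suc k)" "k \<le> 1" for k
  proof -
    have "hcomp k f \<in> short 2" using homog_imp_short[OF hcomp_homog, of k 2] that(2) by simp
    then have "nform (hcomp k f) = hcomp k f" by (rule nform_low)
    then show ?thesis using pbw f(1) that(1) unfolding pbw_def by metis
  qed
  have "f \<in> short 1"
    using low[of 1] short_Suc_hcomp[of f 1] f(2) by (simp add: numeral_2_eq_2)
  then show "f = 0"
    using low[of 0] short_Suc_hcomp[of f 0] by (simp add: short_0)
qed

lemma lookup_basis: "Poly_Mapping.lookup (scalar c * wrd w * grp g) (TW v h) = (if w = v \<and> g = h then c else 0)"
  by (simp add: single_TW[symmetric] lookup_single when_def)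

definition affine :: "('n perm \<Rightarrow> complex ^ ('n + 'n)) \<Rightarrow> ('n perm \<Rightarrow> complex) \<Rightarrow> 'n skew_alg"
  where "affine a c = (\<Sum>h\<in>UNIV. (vec_elem (a h) + scalar (c h)) * grp h)"

lemma affine_short: "affine a c \<in> short 2"
  unfolding affine_def
  by (intro short_sum short_mult_grp short_add vec_elem_short scalar_short) simp_all

lemma affine_expansion:
  "affine a c = (\<Sum>h\<in>UNIV. (\<Sum>p\<in>UNIV. scalar (a h $ p) * wrd [p] * grp h) + scalar (c h) * wrd [] * grp h)"
  by (simp add: affine_def vec_elem_def sum_distrib_right distrib_right wrd_Nil)

lemma lookup_vec_elem_grp:
  "Poly_Mapping.lookup (vec_elem a * grp g) (TW [p] h) = (if g = h then a $ p else 0)"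
  by (cases "g = h") (simp_all add: vec_elem_def sum_distrib_right lookup_sum lookup_basis cong: if_cong)

lemma affine_zero:
  assumes "affine a c = 0"
  shows "a h = 0" "c h = 0"
proof -
  have "Poly_Mapping.lookup (affine a c) (TW [p] h) = a h $ p" for p
    using lookup_basis[of _ "[]" _ "[p]" h]
    by (simp add: affine_def distrib_right lookup_sum lookup_add lookup_vec_elem_grp wrd_Nil)
  then show "a h = 0" using assms by (simp add: vec_eq_iff)
  have "Poly_Mapping.lookup (affine a c) (TW [] h) = c h"
    unfolding affine_expansion by (simp add: lookup_sum lookup_add lookup_basis)
  then show "c h = 0" using assms by simp
qed

lemma pbw_imp_invariant:
  assumes pbw
  shows invariant
proof -
  have "\<kappa>L h (doubled_perm_rep g u) (doubled_perm_rep g v) =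
        doubled_perm_rep g (\<kappa>L (inverse g * h * g) u v) \<and>
      \<kappa>C h (doubled_perm_rep g u) (doubled_perm_rep g v) = \<kappa>C (inverse g * h * g) u v" for g h u v
  proof -
    let ?u = "doubled_perm_rep g u" and ?v = "doubled_perm_rep g v"
    have vv: "grp g * (vec_elem x * vec_elem y) * grp (inverse g) =
        vec_elem (doubled_perm_rep g x) * vec_elem (doubled_perm_rep g y)" for x y
    proof -
      have "grp g * (vec_elem x * vec_elem y) =
          vec_elem (doubled_perm_rep g x) * vec_elem (doubled_perm_rep g y) * grp g"
        by (metis grp_vec_elem mult.assoc)
      then show ?thesis by (simp add: mult.assoc)
    qed
    have "grp g * ((vec_elem (\<kappa>L k u v) + scalar (\<kappa>C k u v)) * grp k) * grp (inverse g) =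
        (vec_elem (doubled_perm_rep g (\<kappa>L k u v)) + scalar (\<kappa>C k u v)) * grp (g * k * inverse g)" for k
    proof -
      have "grp g * (vec_elem (\<kappa>L k u v) + scalar (\<kappa>C k u v)) =
          (vec_elem (doubled_perm_rep g (\<kappa>L k u v)) + scalar (\<kappa>C k u v)) * grp g"
        by (simp add: distrib_left distrib_right grp_vec_elem scalar_commute)
      then have "grp g * ((vec_elem (\<kappa>L k u v) + scalar (\<kappa>C k u v)) * grp k) * grp (inverse g) =
          (vec_elem (doubled_perm_rep g (\<kappa>L k u v)) + scalar (\<kappa>C k u v)) * grp g * grp k * grp (inverse g)"
        by (simp only: mult.assoc[symmetric])
      then show ?thesis by (simp only: grp_mult mult.assoc)
    qed
    then have "grp g * kap u v * grp (inverse g) =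
        (\<Sum>k\<in>UNIV. (vec_elem (doubled_perm_rep g (\<kappa>L k u v)) + scalar (\<kappa>C k u v)) * grp (g * k * inverse g))"
      by (simp only: kap_def sum_distrib_left sum_distrib_right)
    also have "\<dots> = (\<Sum>h\<in>UNIV. (vec_elem (doubled_perm_rep g (\<kappa>L (inverse g * h * g) u v)) +
        scalar (\<kappa>C (inverse g * h * g) u v)) * grp h)"
      by (rule sum.reindex_bij_witness[of _ "\<lambda>h. inverse g * h * g" "\<lambda>h. g * h * inverse g"])
         (auto simp: mult.assoc)
    finally have "grp g * rel u v * grp (inverse g) - rel ?u ?v =
        affine (\<lambda>h. \<kappa>L h ?u ?v - doubled_perm_rep g (\<kappa>L (inverse g * h * g) u v))
               (\<lambda>h. \<kappa>C h ?u ?v - \<kappa>C (inverse g * h * g) u v)"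
      by (simp add: rel_def right_diff_distrib left_diff_distrib vv kap_def affine_def
          vec_elem_diff scalar_diff distrib_right sum.distrib sum_subtractf)
    moreover have "grp g * rel u v * grp (inverse g) - rel ?u ?v \<in> rel_ideal"
      by (intro rel_ideal_diff rel_ideal_mult rel_in_ideal)
    ultimately have "affine (\<lambda>h. \<kappa>L h ?u ?v - doubled_perm_rep g (\<kappa>L (inverse g * h * g) u v))
               (\<lambda>h. \<kappa>C h ?u ?v - \<kappa>C (inverse g * h * g) u v) = 0"
      using ideal_short_zero[OF assms] affine_short by simp
    from affine_zero[OF this, of h] show ?thesis by simp
  qed
  then have "\<kappa>L (g * h * inverse g) (doubled_perm_rep g u) (doubled_perm_rep g v) =
        doubled_perm_rep g (\<kappa>L (inverse g * (g * h * inverse g) * g) u v) \<and>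
      \<kappa>C (g * h * inverse g) (doubled_perm_rep g u) (doubled_perm_rep g v) =
        \<kappa>C (inverse g * (g * h * inverse g) * g) u v" for g h u v
    by blast
  moreover have "inverse g * (g * h * inverse g) * g = h" for g h :: "'n perm"
    by (simp add: mult.assoc)
  ultimately show ?thesis unfolding invariant_def by simp
qed

lemma jacobi_in_ideal: "jacobi u v w \<in> rel_ideal"
proof -
  have "jacobi u v w = - cyc (\<lambda>u v w. rel u v * vec_elem w - vec_elem w * rel u v) u v w"
    by (simp add: jacobi_def cyc_def rel_def algebra_simps)
  then show ?thesis
    unfolding cyc_def
    by (simp only:) (intro rel_ideal_minus rel_ideal.add rel_ideal_diff rel_ideal_left rel_ideal_right rel_in_ideal)
qed

text \<open>
  The projection of \<open>V \<otimes> V\<close> to \<open>S\<^sup>2(V)\<close> is injective on symmetric tensors: the coefficient of the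
  monomial \<open>rs\<close> is \<open>T r s + T s r\<close> for \<open>r \<noteq> s\<close>.
\<close>

lemma quadratic_kernel:
  fixes T :: "'n perm \<Rightarrow> 'n + 'n \<Rightarrow> 'n + 'n \<Rightarrow> complex"
  assumes sym: "\<And>g p q. T g p q = T g q p"
    and zero: "nform (\<Sum>g\<in>UNIV. (\<Sum>p\<in>UNIV. \<Sum>q\<in>UNIV. scalar (T g p q) * wrd [p, q]) * grp g) = 0"
  shows "T g r s = 0"
proof -
  let ?t = "TW (nf (word_content [r, s])) g"
  have eq: "nf (word_content [p, q]) = nf (word_content [r, s]) \<longleftrightarrow> (p, q) \<in> {(r, s), (s, r)}" for p q
  proof -
    have "nf (word_content [p, q]) = nf (word_content [r, s]) \<longleftrightarrow> mset [p, q] = mset [r, s]"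
      by (metis content_eq_iff content_nf)
    then show ?thesis by (auto simp: add_eq_conv_ex)
  qed
  have expand: "nform (\<Sum>g\<in>UNIV. (\<Sum>p\<in>UNIV. \<Sum>q\<in>UNIV. scalar (T g p q) * wrd [p, q]) * grp g) =
      (\<Sum>g\<in>UNIV. \<Sum>p\<in>UNIV. \<Sum>q\<in>UNIV. scalar (T g p q) * wrd (nf (word_content [p, q])) * grp g)"
    by (simp add: lin_sum lin_grp lin_scalar lin_wrd sum_distrib_right)
  have "0 = Poly_Mapping.lookup (\<Sum>g\<in>UNIV. \<Sum>p\<in>UNIV. \<Sum>q\<in>UNIV.
      scalar (T g p q) * wrd (nf (word_content [p, q])) * grp g) ?t"
    unfolding expand[symmetric] zero by simp
  also have "\<dots> = (\<Sum>h\<in>UNIV. \<Sum>p\<in>UNIV. \<Sum>q\<in>UNIV.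
      if nf (word_content [p, q]) = nf (word_content [r, s]) \<and> h = g then T h p q else 0)"
    by (simp only: lookup_sum lookup_basis)
  also have "\<dots> = (\<Sum>h\<in>UNIV. if h = g then \<Sum>p\<in>UNIV. \<Sum>q\<in>UNIV.
      if (p, q) \<in> {(r, s), (s, r)} then T h p q else 0 else 0)"
    by (intro sum.cong refl) (simp add: eq)
  also have "\<dots> = (\<Sum>p\<in>UNIV. \<Sum>q\<in>UNIV. if (p, q) \<in> {(r, s), (s, r)} then T g p q else 0)"
    by (subst sum.delta) simp_all
  also have "\<dots> = (\<Sum>x\<in>UNIV. if x \<in> {(r, s), (s, r)} then T g (fst x) (snd x) else 0)"
    by (simp only: sum.cartesian_product UNIV_Times_UNIV case_prod_unfold prod.collapse)
  also have "\<dots> = (\<Sum>x\<in>{(r, s), (s, r)}. T g (fst x) (snd x))"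
    by (subst sum.inter_restrict[symmetric]) simp_all
  finally show ?thesis
    using sym[of g r s] by (cases "r = s") auto
qed

text \<open>
  The symmetric tensor in \<open>twice_jacobi\<close> is the leading term of an ideal element, hence
  vanishes; then the affine part is an ideal element of degree at most one, hence vanishes too.
\<close>

theorem pbw_necessary:
  assumes pbw
  shows pbw_conditions
proof -
  have "(\<forall>g p q. cocycle_coeff g u v w p q = 0) \<and> (\<forall>h. linear_defect h u v w = 0 \<and> constant_defect h u v w = 0)"
    for u v w
  proof -
    define Y where "Y = (\<Sum>g\<in>UNIV. (\<Sum>p\<in>UNIV. \<Sum>q\<in>UNIV. scalar (cocycle_coeff g u v w p q) * wrd [p, q]) * grp g)"
    define A where "A = affine (\<lambda>h. linear_defect h u v w) (\<lambda>h. constant_defect h u v w)"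
    have "Y + A = 2 * jacobi u v w - jacobi_rels u v w"
      using twice_jacobi[of u v w] by (simp add: Y_def A_def affine_def)
    moreover have "jacobi_rels u v w \<in> rel_ideal"
      unfolding jacobi_rels_def cyc_def
      by (intro rel_ideal.add rel_ideal_sum rel_ideal_right rel_in_ideal)
    ultimately have YA: "Y + A \<in> rel_ideal"
      using jacobi_in_ideal by (simp add: rel_ideal_diff rel_ideal_left)
    have hY: "Y \<in> homog 2"
      unfolding Y_def using wrd_homog[of "[_, _]"]
      by (intro homog_sum homog_mult_grp homog_scalar) (simp add: numeral_2_eq_2)
    have sA: "A \<in> short 2" unfolding A_def by (rule affine_short)
    have "Y + A \<in> short (Suc 2)"
      using homog_imp_short[OF hY, of 3] short_mono[OF sA, of 3] short_add by simp
    moreover have "hcomp 2 (Y + A) = Y"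
      using hY sA by (simp add: Modules.additive.add[OF additive_hcomp] hcomp_id hcomp_short)
    ultimately have "nform Y = 0" using assms YA unfolding pbw_def by metis
    moreover have "cocycle_coeff g u v w p q = cocycle_coeff g u v w q p" for g p q
      by (simp add: cocycle_coeff_def cyc_def)
    ultimately have coc: "cocycle_coeff g u v w p q = 0" for g p q
      unfolding Y_def by (rule quadratic_kernel[rotated])
    then have "A \<in> rel_ideal" using YA by (simp add: Y_def)
    then have "A = 0" using ideal_short_zero[OF assms] sA by blast
    then show ?thesis using coc affine_zero unfolding A_def by blast
  qed
  then show ?thesis using pbw_imp_invariant[OF assms] unfolding pbw_conditions_def by blast
qed

end

section \<open>Skew group algebras as algebras of functions on the group\<close>

text \<open>
  \<open>slice f\<close> is \<open>f\<close> written as the function \<open>g \<mapsto> r\<^sub>g\<close> with \<open>f = \<Sum>\<^sub>g r\<^sub>g \<otimes> g\<close>, and \<open>symbol f\<close> is the image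
  of that function in \<open>S(V)#S\<^sub>n\<close>.
\<close>

definition slice :: "'n skew_alg \<Rightarrow> 'n perm \<Rightarrow> ('n + 'n) tensor_alg"
  where "slice f g = Poly_Mapping.map_key (\<lambda>x. TW (letters x) g) f"

definition symbol :: "'n skew_alg \<Rightarrow> 'n perm \<Rightarrow> ('n + 'n) sym_alg"
  where "symbol f g = (\<Sum>k\<in>Poly_Mapping.keys f.
     if twist k = g then Poly_Mapping.single (word_content (letters_of k)) (Poly_Mapping.lookup f k) else 0)"

abbreviation TV :: "('n::finite perm \<Rightarrow> ('n + 'n) tensor_alg) ring"
  where "TV \<equiv> tensor_skew doubled_perm_rep"

abbreviation SV :: "('n::finite perm \<Rightarrow> ('n + 'n) sym_alg) ring"
  where "SV \<equiv> sym_skew doubled_perm_rep"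

lemma inj_TW: "inj (\<lambda>x. TW (letters x) g)"
  by (auto simp: inj_def fword.expand)

lemma lookup_slice: "Poly_Mapping.lookup (slice f g) x = Poly_Mapping.lookup f (TW (letters x) g)"
  by (simp add: slice_def map_key.rep_eq[OF inj_TW])

lemma slice_eq_iff [simp]: "slice f = slice h \<longleftrightarrow> f = h"
proof
  assume eq: "slice f = slice h"
  show "f = h"
  proof (rule poly_mapping_eqI)
    fix k
    show "Poly_Mapping.lookup f k = Poly_Mapping.lookup h k"
      using lookup_slice[of f "twist k" "FWord (letters_of k)"]
        lookup_slice[of h "twist k" "FWord (letters_of k)"] eq by simp
  qed
qed simp

lemma letters_eq_iff: "letters x = letters y \<longleftrightarrow> x = y"
  using fword.expand by blast

lemma slice_surj: "\<exists>f. s = slice f" for s :: "'n::finite perm \<Rightarrow> ('n + 'n) tensor_alg"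
proof -
  define f where "f = (\<Sum>g\<in>UNIV. \<Sum>x\<in>Poly_Mapping.keys (s g).
    scalar (Poly_Mapping.lookup (s g) x) * wrd (letters x) * grp g)"
  have "Poly_Mapping.lookup f (TW (letters y) h) = Poly_Mapping.lookup (s h) y" for y h
  proof -
    have "Poly_Mapping.lookup f (TW (letters y) h) = (\<Sum>g\<in>UNIV. \<Sum>x\<in>Poly_Mapping.keys (s g).
        if letters x = letters y \<and> g = h then Poly_Mapping.lookup (s g) x else 0)"
      by (simp add: f_def lookup_sum single_TW[symmetric] lookup_single when_def)
    also have "\<dots> = (\<Sum>g\<in>UNIV. if g = h then \<Sum>x\<in>Poly_Mapping.keys (s g).
        if x = y then Poly_Mapping.lookup (s g) x else 0 else 0)"
      by (intro sum.cong refl) (simp add: letters_eq_iff)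
    also have "\<dots> = (\<Sum>x\<in>Poly_Mapping.keys (s h). if x = y then Poly_Mapping.lookup (s h) x else 0)"
      by (subst sum.delta) simp_all
    also have "\<dots> = Poly_Mapping.lookup (s h) y"
      by (simp add: in_keys_iff)
    finally show ?thesis .
  qed
  then have "s = slice f"
    by (intro ext poly_mapping_eqI) (simp add: lookup_slice)
  then show ?thesis ..
qed

lemma slice_add: "slice (f + h) g = slice f g + slice h g"
  by (rule poly_mapping_eqI) (simp add: lookup_slice lookup_add)

lemma slice_0: "slice 0 g = 0"
  by (rule poly_mapping_eqI) (simp add: lookup_slice)

lemma slice_single:
  "slice (Poly_Mapping.single (TW w a) c) g = (if g = a then Poly_Mapping.single (FWord w) c else 0)"
  by (rule poly_mapping_eqI) (auto simp: lookup_slice lookup_single when_def fword.expand)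

lemma slice_sum: "slice (sum F A) g = (\<Sum>a\<in>A. slice (F a) g)"
  by (induction A rule: infinite_finite_induct) (simp_all add: slice_add slice_0)

lemma tensor_vec_axis: "tensor_vec (axis p 1) = Poly_Mapping.single (FWord [p]) 1"
proof -
  have "tensor_vec (axis p 1) = (\<Sum>q\<in>UNIV. if q = p then Poly_Mapping.single (FWord [q]) 1 else 0)"
    unfolding tensor_vec_def by (intro sum.cong refl) (auto simp: axis_def)
  then show ?thesis by simp
qed

lemma sym_vec_axis: "sym_vec (axis p 1) = Poly_Mapping.single (Poly_Mapping.single p 1) 1"
proof -
  have "sym_vec (axis p 1) = (\<Sum>q\<in>UNIV. if q = p then Poly_Mapping.single (Poly_Mapping.single q 1) 1 else 0)"
    unfolding sym_vec_def by (intro sum.cong refl) (auto simp: axis_def)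
  then show ?thesis by simp
qed

lemma additive_tensor_act: "Modules.additive (tensor_act \<rho> g)"
  unfolding tensor_act_def
  by (rule additive_sum_keys[of "\<lambda>w c. scalar c * prod_list (map (\<lambda>b. tensor_vec (\<rho> g (axis b 1))) (letters w))"])
     (simp add: scalar_add algebra_simps)

lemma additive_sym_act: "Modules.additive (sym_act \<rho> g)"
  unfolding sym_act_def
  by (rule additive_sum_keys[of "\<lambda>m c. scalar c * (\<Prod>b\<in>UNIV. sym_vec (\<rho> g (axis b 1)) ^ Poly_Mapping.lookup m b)"])
     (simp add: scalar_add algebra_simps)

lemma tensor_act_single:
  "tensor_act doubled_perm_rep g (Poly_Mapping.single (FWord w) c) =
     Poly_Mapping.single (FWord (map (lact g) w)) c"
proof -
  have "prod_list (map (\<lambda>b. Poly_Mapping.single (FWord [lact g b]) 1) w) =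
      (Poly_Mapping.single (FWord (map (lact g) w)) 1 :: (_ \<Rightarrow>\<^sub>0 complex))"
    by (induction w) (simp_all add: zero_fword_def[symmetric] mult_single plus_fword_def)
  then show ?thesis
    using sum_keys_single[of "\<lambda>w c. scalar c * prod_list (map (\<lambda>b. Poly_Mapping.single (FWord [lact g b]) 1) (letters w))" "FWord w" c]
    by (simp add: tensor_act_def doubled_perm_rep_axis tensor_vec_axis scalar_def mult_single
        zero_fword_def plus_fword_def)
qed

lemma prod_power_content:
  fixes x :: "'b::finite \<Rightarrow> 'c::comm_monoid_mult"
  shows "(\<Prod>b\<in>UNIV. x b ^ Poly_Mapping.lookup (word_content w) b) = prod_list (map x w)"
proof (induction w)
  case (Cons p w)
  have "(\<Prod>b\<in>UNIV. x b ^ Poly_Mapping.lookup (word_content (p # w)) b) =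
      (\<Prod>b\<in>UNIV. (if b = p then x b else 1) * x b ^ Poly_Mapping.lookup (word_content w) b)"
    by (intro prod.cong refl) (simp add: content_Cons lookup_add lookup_single when_def)
  then show ?case by (simp add: prod.distrib Cons)
qed simp

lemma sym_act_single:
  "sym_act doubled_perm_rep g (Poly_Mapping.single (word_content w) c) =
     Poly_Mapping.single (word_content (map (lact g) w)) c"
proof -
  have "prod_list (map (\<lambda>b. Poly_Mapping.single (Poly_Mapping.single (lact g b) 1) 1) w) =
      (Poly_Mapping.single (word_content (map (lact g) w)) 1 :: (_ \<Rightarrow>\<^sub>0 complex))"
    by (induction w) (simp_all add: mult_single content_Cons)
  then show ?thesis
    using sum_keys_single[of "\<lambda>m c. scalar c * (\<Prod>b\<in>UNIV.
        Poly_Mapping.single (Poly_Mapping.single (lact g b) 1) 1 ^ Poly_Mapping.lookup m b)" "word_content w" c]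
    by (simp add: sym_act_def doubled_perm_rep_axis sym_vec_axis prod_power_content scalar_def mult_single)
qed

lemma additive_symbol: "Modules.additive (\<lambda>f. symbol f g)"
  unfolding symbol_def
  by (rule additive_sum_keys[of "\<lambda>k c. if twist k = g then Poly_Mapping.single (word_content (letters_of k)) c else 0"])
     (simp add: single_add)

lemmas symbol_add = Modules.additive.add[OF additive_symbol]
  and symbol_sum = Modules.additive.sum[OF additive_symbol]

lemma symbol_single:
  "symbol (Poly_Mapping.single (TW w a) c) g = (if g = a then Poly_Mapping.single (word_content w) c else 0)"
  using sum_keys_single[of "\<lambda>k c. if twist k = g then Poly_Mapping.single (word_content (letters_of k)) c else 0" "TW w a" c]
  by (auto simp: symbol_def)

text \<open>
  Multiplicativity of \<open>slice\<close> and \<open>symbol\<close> has the same reason: both products are biadditive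
  and agree on monomials.
\<close>

lemma skew_mult_transfer:
  fixes T :: "'n::finite skew_alg \<Rightarrow> 'n perm \<Rightarrow> 'r::ring_1" and e :: "('n + 'n) list \<Rightarrow> complex \<Rightarrow> 'r"
  assumes T: "\<And>g. Modules.additive (\<lambda>f. T f g)"
    and single: "\<And>w a c g. T (Poly_Mapping.single (TW w a) c) g = (if g = a then e w c else 0)"
    and act: "\<And>g. Modules.additive (act g)"
    and e: "\<And>g v w c d. e v c * act g (e w d) = e (v @ map (lact g) w) (c * d)"
  shows "T (f * h) = T f \<otimes>\<^bsub>skew_group_ring act\<^esub> T h"
proof
  fix k
  define G where "G f h = (\<Sum>(a, b)\<in>{(a, b). a * b = k}. T f a * act a (T h b))" for f h
  have "T (f * h) k = G f h" for f h
  proof (rule additive_ext[of "\<lambda>f. T (f * h) k" "\<lambda>f. G f h"])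
    show "Modules.additive (\<lambda>f. T (f * h) k)"
      by (intro additive_compose[OF T] additive_mult_right)
    show "Modules.additive (\<lambda>f. G f h)"
      by (simp add: G_def Modules.additive_def Modules.additive.add[OF T] distrib_right
          case_prod_unfold sum.distrib)
    fix i :: "'n twisted_word" and c
    obtain v a where i: "i = TW v a" by (cases i) auto
    show "T (Poly_Mapping.single i c * h) k = G (Poly_Mapping.single i c) h"
    proof (rule additive_ext[of "\<lambda>h. T (Poly_Mapping.single i c * h) k" "G (Poly_Mapping.single i c)"])
      show "Modules.additive (\<lambda>h. T (Poly_Mapping.single i c * h) k)"
        by (intro additive_compose[OF T] additive_mult_left)
      show "Modules.additive (G (Poly_Mapping.single i c))"
        by (simp add: G_def Modules.additive_def Modules.additive.add[OF T]
            Modules.additive.add[OF act] distrib_left case_prod_unfold sum.distrib)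
      fix j :: "'n twisted_word" and d
      obtain w b where j: "j = TW w b" by (cases j) auto
      have "G (Poly_Mapping.single i c) (Poly_Mapping.single j d) =
          (\<Sum>x\<in>{(a, b). a * b = k}. if x = (a, b) then e v c * act a (e w d) else 0)"
        unfolding G_def i j
        by (intro sum.cong refl) (auto simp: single Modules.additive.zero[OF act] split: if_splits)
      also have "\<dots> = (if a * b = k then e v c * act a (e w d) else 0)"
        by (subst sum.delta) simp_all
      finally show "T (Poly_Mapping.single i c * Poly_Mapping.single j d) k =
          G (Poly_Mapping.single i c) (Poly_Mapping.single j d)"
        by (auto simp: i j mult_single TW_add single e)
    qed
  qed
  then show "T (f * h) k = (T f \<otimes>\<^bsub>skew_group_ring act\<^esub> T h) k"
    by (simp add: skew_group_ring_def G_def)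
qed

lemma slice_mult: "slice (f * h) = slice f \<otimes>\<^bsub>TV\<^esub> slice h"
  unfolding tensor_skew_def
  by (rule skew_mult_transfer[where e = "\<lambda>w c. Poly_Mapping.single (FWord w) c"])
     (auto simp: Modules.additive_def slice_add slice_single tensor_act_single mult_single
       plus_fword_def Modules.additive.add[OF additive_tensor_act])

lemma symbol_mult: "symbol (f * h) = symbol f \<otimes>\<^bsub>SV\<^esub> symbol h"
  unfolding sym_skew_def
  by (rule skew_mult_transfer[where e = "\<lambda>w c. Poly_Mapping.single (word_content w) c"])
     (auto simp: additive_symbol additive_sym_act symbol_single sym_act_single mult_single content_append)

lemma single_1: "(1 :: 'n skew_alg) = Poly_Mapping.single (TW [] 1) 1"
  by (simp add: zero_twisted_word_def[symmetric])

lemma scalar_single: "(scalar c :: 'n skew_alg) = Poly_Mapping.single (TW [] 1) c"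
  by (simp add: scalar_def zero_twisted_word_def)

lemma TV_simps:
  "carrier TV = UNIV" "slice (f + h) = slice f \<oplus>\<^bsub>TV\<^esub> slice h"
  "\<zero>\<^bsub>TV\<^esub> = slice 0" "\<one>\<^bsub>TV\<^esub> = slice 1"
  by (auto simp: tensor_skew_def skew_group_ring_def slice_add slice_0 fun_eq_iff
      single_1 slice_single zero_fword_def[symmetric])

lemma SV_simps:
  "carrier SV = UNIV" "symbol (f + h) = symbol f \<oplus>\<^bsub>SV\<^esub> symbol h" "\<one>\<^bsub>SV\<^esub> = symbol 1"
  by (auto simp: sym_skew_def skew_group_ring_def symbol_add fun_eq_iff single_1 symbol_single)

lemma slice_scalar: "slice (scalar c) = skew_scalar c"
  by (auto simp: fun_eq_iff skew_scalar_def scalar_single slice_single scalar_def zero_fword_def)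

lemma symbol_scalar: "symbol (scalar c) = skew_scalar c"
  by (auto simp: fun_eq_iff skew_scalar_def scalar_single symbol_single scalar_def)

lemma ring_TV: "ring TV"
proof -
  note simps = TV_simps(1,3,4) TV_simps(2)[symmetric] slice_mult[symmetric]
  have ex: "\<exists>f. x = slice f" for x :: "'a perm \<Rightarrow> ('a + 'a) tensor_alg" by (rule slice_surj)
  show ?thesis
  proof (intro ringI abelian_groupI monoidI)
    fix x y z :: "'a perm \<Rightarrow> ('a + 'a) tensor_alg"
    obtain f g h where [simp]: "x = slice f" "y = slice g" "z = slice h" using ex by meson
    show "x \<oplus>\<^bsub>TV\<^esub> y \<oplus>\<^bsub>TV\<^esub> z = x \<oplus>\<^bsub>TV\<^esub> (y \<oplus>\<^bsub>TV\<^esub> z)" by (simp add: simps add.assoc)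
    show "x \<oplus>\<^bsub>TV\<^esub> y = y \<oplus>\<^bsub>TV\<^esub> x" by (simp add: simps add.commute)
    show "\<zero>\<^bsub>TV\<^esub> \<oplus>\<^bsub>TV\<^esub> x = x" by (simp add: simps)
    show "\<exists>y\<in>carrier TV. y \<oplus>\<^bsub>TV\<^esub> x = \<zero>\<^bsub>TV\<^esub>"
      by (rule bexI[of _ "slice (- f)"]) (simp_all add: simps)
    show "x \<otimes>\<^bsub>TV\<^esub> y \<otimes>\<^bsub>TV\<^esub> z = x \<otimes>\<^bsub>TV\<^esub> (y \<otimes>\<^bsub>TV\<^esub> z)" by (simp add: simps mult.assoc)
    show "\<one>\<^bsub>TV\<^esub> \<otimes>\<^bsub>TV\<^esub> x = x" "x \<otimes>\<^bsub>TV\<^esub> \<one>\<^bsub>TV\<^esub> = x" by (simp_all add: simps)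
    show "(x \<oplus>\<^bsub>TV\<^esub> y) \<otimes>\<^bsub>TV\<^esub> z = x \<otimes>\<^bsub>TV\<^esub> z \<oplus>\<^bsub>TV\<^esub> y \<otimes>\<^bsub>TV\<^esub> z"
      "z \<otimes>\<^bsub>TV\<^esub> (x \<oplus>\<^bsub>TV\<^esub> y) = z \<otimes>\<^bsub>TV\<^esub> x \<oplus>\<^bsub>TV\<^esub> z \<otimes>\<^bsub>TV\<^esub> y"
      by (simp_all add: simps distrib_left distrib_right)
  qed (simp_all add: TV_simps)
qed

interpretation TV: ring TV by (rule ring_TV)

lemma TV_minus: "\<ominus>\<^bsub>TV\<^esub> slice f = slice (- f)"
proof -
  have "slice (- f) \<oplus>\<^bsub>TV\<^esub> slice f = \<zero>\<^bsub>TV\<^esub>"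
    by (simp only: TV_simps(2)[symmetric] TV_simps(3)) simp
  then show ?thesis using TV.minus_equality by (simp add: TV_simps(1))
qed

lemma TV_diff: "slice f \<ominus>\<^bsub>TV\<^esub> slice h = slice (f - h)"
  by (simp add: a_minus_def TV_minus TV_simps(2)[symmetric])

lemma skew_vec_slice: "skew_vec v = slice (vec_elem v)"
proof
  fix g
  have "slice (vec_elem v) g = (\<Sum>p\<in>UNIV. if g = 1 then Poly_Mapping.single (FWord [p]) (v $ p) else 0)"
    unfolding vec_elem_def slice_sum
    by (intro sum.cong refl) (metis single_TW slice_single grp_1 mult_1_right)
  then show "skew_vec v g = slice (vec_elem v) g"
    by (auto simp: skew_vec_def tensor_vec_def)
qed

lemma slice_mult_grp: "slice (f * grp h) g = slice f (g * inverse h)"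
proof (rule skew_alg_ext[of "\<lambda>f. slice (f * grp h) g" "\<lambda>f. slice f (g * inverse h)"])
  show "Modules.additive (\<lambda>f. slice (f * grp h) g)" "Modules.additive (\<lambda>f. slice f (g * inverse h))"
    by (simp_all add: Modules.additive_def slice_add distrib_right)
  fix c w a
  have "scalar c * wrd w * grp a * grp h = Poly_Mapping.single (TW w (a * h)) c"
    by (simp add: single_TW grp_mult mult.assoc)
  moreover have "g = a * h \<longleftrightarrow> g * inverse h = a"
    by (metis mult.assoc mult_1_right perm.left_inverse perm.right_inverse)
  ultimately show "slice (scalar c * wrd w * grp a * grp h) g = slice (scalar c * wrd w * grp a) (g * inverse h)"
    by (simp add: single_TW[symmetric] slice_single)
qed

lemma slice_sum_grp:
  fixes F :: "'n::finite perm \<Rightarrow> 'n skew_alg"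
  assumes "\<And>h. slice (F h) = (\<lambda>g. if g = 1 then e h else 0)"
  shows "slice (\<Sum>h\<in>UNIV. F h * grp h) g = e g"
proof -
  have "g * inverse h = 1 \<longleftrightarrow> h = g" for h :: "'n perm"
    by (metis mult.assoc mult_1_left mult_1_right perm.left_inverse perm.right_inverse)
  then have "slice (\<Sum>h\<in>UNIV. F h * grp h) g = (\<Sum>h\<in>UNIV. if h = g then e h else 0)"
    by (simp add: slice_sum slice_mult_grp assms)
  then show ?thesis by simp
qed

lemma cochainL_slice: "cochainL_elem \<kappa> u v = slice (\<Sum>h\<in>UNIV. vec_elem (\<kappa> h u v) * grp h)"
  using slice_sum_grp[of "\<lambda>h. vec_elem (\<kappa> h u v)" "\<lambda>h. tensor_vec (\<kappa> h u v)"]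
  by (auto simp: fun_eq_iff cochainL_elem_def skew_vec_slice[symmetric] skew_vec_def)

lemma cochainC_slice: "cochainC_elem \<kappa> u v = slice (\<Sum>h\<in>UNIV. scalar (\<kappa> h u v) * grp h)"
  using slice_sum_grp[of "\<lambda>h. scalar (\<kappa> h u v)" "\<lambda>h. scalar (\<kappa> h u v)"]
  by (auto simp: fun_eq_iff cochainC_elem_def slice_scalar skew_scalar_def)

lemma tensor_skew_filt_slice:
  "(tensor_skew_filt m :: ('n::finite perm \<Rightarrow> ('n + 'n) tensor_alg) set) = slice ` short (Suc m)"
proof -
  have filt_iff: "slice f \<in> tensor_skew_filt m \<longleftrightarrow> f \<in> short (Suc m)" for f :: "'n skew_alg"
  proof
    assume f: "slice f \<in> tensor_skew_filt m"
    show "f \<in> short (Suc m)"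
      unfolding short_def
    proof (intro CollectI ballI)
      fix k assume "k \<in> Poly_Mapping.keys f"
      then have "FWord (letters_of k) \<in> Poly_Mapping.keys (slice f (twist k))"
        by (simp add: in_keys_iff lookup_slice)
      then show "length (letters_of k) < Suc m"
        using f unfolding tensor_skew_filt_def by force
    qed
  next
    assume f: "f \<in> short (Suc m)"
    show "slice f \<in> tensor_skew_filt m"
      unfolding tensor_skew_filt_def
    proof (intro CollectI allI ballI)
      fix g x assume "x \<in> Poly_Mapping.keys (slice f g)"
      then have "TW (letters x) g \<in> Poly_Mapping.keys f" by (simp add: in_keys_iff lookup_slice)
      then show "length (letters x) \<le> m" using f unfolding short_def by force
    qed
  qed
  show ?thesis
  proof (rule Set.set_eqI)
    fix s :: "'n perm \<Rightarrow> ('n + 'n) tensor_alg"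
    obtain f where "s = slice f" using slice_surj[of s] by blast
    then show "s \<in> tensor_skew_filt m \<longleftrightarrow> s \<in> slice ` short (Suc m)"
      by (simp add: filt_iff image_iff)
  qed
qed

section \<open>Symbols and normal forms\<close>

text \<open>
  The section of \<open>symbol\<close> that picks the normal form words.
\<close>

definition unsymbol :: "('n::finite perm \<Rightarrow> ('n + 'n) sym_alg) \<Rightarrow> 'n skew_alg"
  where "unsymbol s = (\<Sum>g\<in>UNIV. \<Sum>m\<in>Poly_Mapping.keys (s g).
     scalar (Poly_Mapping.lookup (s g) m) * wrd (nf m) * grp g)"

lemma unsymbol_add: "unsymbol (\<lambda>g. r g + s g) = unsymbol r + unsymbol s"
  for r s :: "'n::finite perm \<Rightarrow> ('n + 'n) sym_alg"
proof -
  have "Modules.additive (\<lambda>p. \<Sum>m\<in>Poly_Mapping.keys p.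
      scalar (Poly_Mapping.lookup p m) * wrd (nf m) * grp g)" for g :: "'n perm"
    by (rule additive_sum_keys[of "\<lambda>m c. scalar c * wrd (nf m) * grp g"])
       (simp add: scalar_add distrib_right)
  from Modules.additive.add[OF this] show ?thesis
    by (simp only: unsymbol_def sum.distrib[symmetric])
qed

lemma unsymbol_symbol: "unsymbol (symbol f) = nform f"
proof (rule skew_alg_ext[of "\<lambda>f. unsymbol (symbol f)" nform])
  show "Modules.additive (\<lambda>f. unsymbol (symbol f))"
    by (simp add: Modules.additive_def symbol_add unsymbol_add[symmetric] fun_eq_iff)
       (metis (no_types, lifting) symbol_add ext)
  show "Modules.additive nform" by (rule additive_lin)
  fix c w a
  have "unsymbol (symbol (Poly_Mapping.single (TW w a) c)) =
      (\<Sum>g\<in>UNIV. if g = a then scalar c * wrd (nf (word_content w)) * grp g else 0)"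
    unfolding unsymbol_def
  proof (intro sum.cong refl)
    fix g
    show "(\<Sum>m\<in>Poly_Mapping.keys (symbol (Poly_Mapping.single (TW w a) c) g).
        scalar (Poly_Mapping.lookup (symbol (Poly_Mapping.single (TW w a) c) g) m) * wrd (nf m) * grp g) =
      (if g = a then scalar c * wrd (nf (word_content w)) * grp g else 0)"
      using sum_keys_single[of "\<lambda>m c. scalar c * wrd (nf m) * grp g" "word_content w" c]
      by (simp add: symbol_single)
  qed
  then show "unsymbol (symbol (scalar c * wrd w * grp a)) = nform (scalar c * wrd w * grp a)"
    by (simp add: single_TW lin_basis)
qed

lemma poly_mapping_sum_singles:
  "(\<Sum>k\<in>Poly_Mapping.keys p. Poly_Mapping.single k (Poly_Mapping.lookup p k)) = (p :: _ \<Rightarrow>\<^sub>0 'c::ab_group_add)"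
proof (rule additive_ext[of "\<lambda>p. \<Sum>k\<in>Poly_Mapping.keys p. Poly_Mapping.single k (Poly_Mapping.lookup p k)" "\<lambda>p. p"])
  show "Modules.additive (\<lambda>p. \<Sum>k\<in>Poly_Mapping.keys p.
      Poly_Mapping.single k (Poly_Mapping.lookup p k) :: _ \<Rightarrow>\<^sub>0 'c)"
    by (rule additive_sum_keys) (rule single_add)
qed (simp_all add: Modules.additive_def sum_keys_single[of Poly_Mapping.single])

lemma symbol_unsymbol: "symbol (unsymbol s) = s"
proof
  fix h
  have "symbol (unsymbol s) h = (\<Sum>g\<in>UNIV. if g = h then
      \<Sum>m\<in>Poly_Mapping.keys (s g). Poly_Mapping.single m (Poly_Mapping.lookup (s g) m) else 0)"
    unfolding unsymbol_def symbol_sum single_TW[symmetric] symbol_single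
    by (intro sum.cong refl) auto
  also have "\<dots> = (\<Sum>m\<in>Poly_Mapping.keys (s h). Poly_Mapping.single m (Poly_Mapping.lookup (s h) m))"
    by (subst sum.delta) simp_all
  finally show "symbol (unsymbol s) h = s h" by (simp add: poly_mapping_sum_singles)
qed

lemma symbol_eq_iff: "symbol f = symbol h \<longleftrightarrow> nform (f - h) = 0"
  for f h :: "'n::finite skew_alg"
proof
  assume "symbol f = symbol h"
  then have "unsymbol (symbol f) = unsymbol (symbol h)" by simp
  then have "nform f = nform h" by (simp only: unsymbol_symbol)
  then show "nform (f - h) = 0" by (simp add: lin_diff)
next
  assume "nform (f - h) = 0"
  then have "unsymbol (symbol f) = unsymbol (symbol h)" by (simp add: unsymbol_symbol lin_diff)
  then have "symbol (unsymbol (symbol f)) = symbol (unsymbol (symbol h))" by simp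
  then show "symbol f = symbol h" by (simp only: symbol_unsymbol)
qed

lemma content_degree: "(\<Sum>b\<in>UNIV. Poly_Mapping.lookup (word_content w) b) = length w"
  for w :: "'b::finite list"
  by (induction w) (simp_all add: content_Cons lookup_add lookup_single when_def sum.distrib)

lemma symbol_homog:
  "symbol ` homog m = (sym_skew_homog m :: ('n::finite perm \<Rightarrow> ('n + 'n) sym_alg) set)"
proof
  show "symbol ` homog m \<subseteq> (sym_skew_homog m :: ('n perm \<Rightarrow> ('n + 'n) sym_alg) set)"
  proof
    fix s :: "'n perm \<Rightarrow> ('n + 'n) sym_alg" assume "s \<in> symbol ` homog m"
    then obtain f where s: "s = symbol f" and f: "f \<in> homog m" by blast
    have "Poly_Mapping.lookup (s g) k = 0" if "(\<Sum>b\<in>UNIV. Poly_Mapping.lookup k b) \<noteq> m" for g k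
      unfolding s symbol_def lookup_sum
      using f that by (intro sum.neutral) (auto simp: homog_def lookup_single when_def content_degree)
    then show "s \<in> sym_skew_homog m"
      unfolding sym_skew_homog_def by (auto simp: in_keys_iff)
  qed
  show "(sym_skew_homog m :: ('n perm \<Rightarrow> ('n + 'n) sym_alg) set) \<subseteq> symbol ` homog m"
  proof
    fix s :: "'n perm \<Rightarrow> ('n + 'n) sym_alg" assume s: "s \<in> sym_skew_homog m"
    have "unsymbol s \<in> homog m"
      unfolding unsymbol_def
    proof (intro homog_sum homog_mult_grp homog_scalar)
      fix g k assume "k \<in> Poly_Mapping.keys (s g)"
      then have "length (nf k) = m"
        using s content_degree[of "nf k"] unfolding sym_skew_homog_def by simp
      then show "wrd (nf k) \<in> homog m" using wrd_homog by blast
    qed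
    then show "s \<in> symbol ` homog m" using symbol_unsymbol[of s] by (metis image_eqI)
  qed
qed

section \<open>The associated graded algebra\<close>

lemma (in vector_space) surjective_imp_trivial_kernel:
  assumes V: "subspace V" and fin: "finite A" "V \<subseteq> span A"
    and f: "Vector_Spaces.linear scale scale f" and surj: "f ` V = V"
    and x: "x \<in> V" "f x = 0"
  shows "x = 0"
proof -
  interpret vector_space_pair scale scale ..
  obtain B where B: "B \<subseteq> V" "independent B" "V \<subseteq> span B" "card B = dim V"
    using basis_exists by blast
  have finB: "finite B" using independent_span_bound[OF fin(1) B(2)] B(1) fin(2) by blast
  have span_B: "span B = V" using B V span_minimal by blast
  obtain C where C: "C \<subseteq> f ` B" "independent C" "f ` B \<subseteq> span C"
    using maximal_independent_subset[of "f ` B"] by blast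
  have "V = span (f ` B)"
    using surj span_B linear_span_image[OF f] by metis
  also have "\<dots> \<subseteq> span C" using C(3) span_minimal subspace_span by blast
  finally have "V \<subseteq> span C" .
  moreover have "C \<subseteq> V" using C(1) B(1) surj by blast
  ultimately have "card C = card B" using basis_card_eq_dim C(2) B(4) by metis
  moreover have "card C \<le> card (f ` B)" "card (f ` B) \<le> card B"
    using C(1) finB by (auto intro: card_mono card_image_le)
  ultimately have eq: "card C = card (f ` B)" "card (f ` B) = card B" by linarith+
  have "C = f ` B" using card_subset_eq[OF _ C(1) eq(1)] finB by simp
  moreover have "inj_on f B" using eq_card_imp_inj_on[OF finB eq(2)] .
  ultimately have "inj_on f (span B)"
    using linear_inj_on_span_iff_independent_image[OF f, of B] C(2) by blast
  then show "x = 0"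
    using x span_B linear_0[OF f] subspace_0[OF V] unfolding inj_on_def by metis
qed

lemma hcomp_mult: "hcomp m (f * h) = (\<Sum>i\<le>m. hcomp i f * hcomp (m - i) h)"
proof (rule additive_ext[of "\<lambda>f. hcomp m (f * h)" "\<lambda>f. \<Sum>i\<le>m. hcomp i f * hcomp (m - i) h"])
  show "Modules.additive (\<lambda>f. hcomp m (f * h))"
    by (intro additive_compose[OF additive_hcomp] additive_mult_right)
  show "Modules.additive (\<lambda>f. \<Sum>i\<le>m. hcomp i f * hcomp (m - i) h)"
    by (simp add: Modules.additive_def Modules.additive.add[OF additive_hcomp] distrib_right sum.distrib)
  fix k :: "'a twisted_word" and c :: complex
  let ?s = "Poly_Mapping.single k c"
  show "hcomp m (?s * h) = (\<Sum>i\<le>m. hcomp i ?s * hcomp (m - i) h)"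
  proof (rule additive_ext[of "\<lambda>h. hcomp m (?s * h)" "\<lambda>h. \<Sum>i\<le>m. hcomp i ?s * hcomp (m - i) h"])
    show "Modules.additive (\<lambda>h. hcomp m (?s * h))"
      by (intro additive_compose[OF additive_hcomp] additive_mult_left)
    show "Modules.additive (\<lambda>h. \<Sum>i\<le>m. hcomp i ?s * hcomp (m - i) h)"
      by (simp add: Modules.additive_def Modules.additive.add[OF additive_hcomp] distrib_left sum.distrib)
    fix l :: "'a twisted_word" and d :: complex
    have single: "hcomp i (Poly_Mapping.single k c) =
        (if length (letters_of k) = i then Poly_Mapping.single k c else 0)" for i k and c :: complex
      by (rule poly_mapping_eqI) (auto simp: lookup_hcomp lookup_single when_def)
    have "(\<Sum>i\<le>m. hcomp i ?s * hcomp (m - i) (Poly_Mapping.single l d)) =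
        (\<Sum>i\<le>m. if i = length (letters_of k) then
           if length (letters_of k) + length (letters_of l) = m then ?s * Poly_Mapping.single l d else 0 else 0)"
      by (intro sum.cong refl) (auto simp: single)
    also have "\<dots> = (if length (letters_of k) + length (letters_of l) = m then ?s * Poly_Mapping.single l d else 0)"
      by (subst sum.delta) auto
    finally show "hcomp m (?s * Poly_Mapping.single l d) =
        (\<Sum>i\<le>m. hcomp i ?s * hcomp (m - i) (Poly_Mapping.single l d))"
      by (simp add: single mult_single plus_twisted_word_def)
  qed
qed

lemma short_mult_right: "f \<in> short a \<Longrightarrow> h \<in> short (Suc b) \<Longrightarrow> f * h \<in> short (a + b)"
proof -
  assume f: "f \<in> short a" and h: "h \<in> short (Suc b)"
  show ?thesis
  proof (cases a)
    case 0
    then show ?thesis using f by (simp add: short_0)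
  next
    case (Suc k)
    then show ?thesis using short_mult[of f k h "Suc b"] f h by simp
  qed
qed

context cochain_pair
begin

abbreviation HI where "HI \<equiv> H_ideal doubled_perm_rep \<kappa>L \<kappa>C"
abbreviation HA where "HA \<equiv> H_alg doubled_perm_rep \<kappa>L \<kappa>C"
abbreviation HF where "HF \<equiv> H_filt doubled_perm_rep \<kappa>L \<kappa>C"
abbreviation GR where "GR \<equiv> assoc_graded HA HF"

lemma relation_slice:
  "skew_commutator doubled_perm_rep u v \<ominus>\<^bsub>TV\<^esub> cochainL_elem \<kappa>L u v \<ominus>\<^bsub>TV\<^esub> cochainC_elem \<kappa>C u v =
   slice (rel u v)"
  unfolding skew_commutator_def skew_vec_slice cochainL_slice cochainC_slice slice_mult[symmetric] TV_diff
  by (simp add: rel_def kap_def distrib_right sum.distrib)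

lemma ideal_slice: "ideal (slice ` rel_ideal) TV"
proof (rule idealI[OF ring_TV])
  show "subgroup (slice ` rel_ideal) (add_monoid TV)"
  proof
    show "x \<otimes>\<^bsub>add_monoid TV\<^esub> y \<in> slice ` rel_ideal"
      if "x \<in> slice ` rel_ideal" "y \<in> slice ` rel_ideal" for x y
      using that rel_ideal.add by (auto simp: TV_simps(2)[symmetric])
    show "\<one>\<^bsub>add_monoid TV\<^esub> \<in> slice ` rel_ideal"
      using rel_ideal_zero by (auto simp: TV_simps)
    show "inv\<^bsub>add_monoid TV\<^esub> x \<in> slice ` rel_ideal" if x: "x \<in> slice ` rel_ideal" for x
    proof -
      obtain f where "x = slice f" "f \<in> rel_ideal" using x by blast
      then have "inv\<^bsub>add_monoid TV\<^esub> x = slice (- f)" "- f \<in> rel_ideal"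
        using TV_minus[of f] rel_ideal_minus by (simp_all add: a_inv_def)
      then show ?thesis by blast
    qed
  qed (simp add: TV_simps)
next
  fix a x :: "'n perm \<Rightarrow> ('n + 'n) tensor_alg" assume "a \<in> slice ` rel_ideal"
  moreover obtain y where "x = slice y" using slice_surj[of x] by blast
  ultimately show "x \<otimes>\<^bsub>TV\<^esub> a \<in> slice ` rel_ideal" "a \<otimes>\<^bsub>TV\<^esub> x \<in> slice ` rel_ideal"
    using rel_ideal_left rel_ideal_right by (auto simp: slice_mult[symmetric])
qed

lemma H_ideal_slice: "HI = slice ` rel_ideal"
proof
  let ?G = "{skew_commutator doubled_perm_rep u v \<ominus>\<^bsub>TV\<^esub> cochainL_elem \<kappa>L u v
      \<ominus>\<^bsub>TV\<^esub> cochainC_elem \<kappa>C u v | u v. True}"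
  have HI: "HI = Idl\<^bsub>TV\<^esub> ?G" by (simp add: H_ideal_def)
  have "?G \<subseteq> slice ` rel_ideal"
    unfolding relation_slice using rel_in_ideal by blast
  then show "HI \<subseteq> slice ` rel_ideal"
    unfolding HI by (rule TV.genideal_minimal[OF ideal_slice])
  interpret I: ideal HI TV
    unfolding HI by (rule TV.genideal_ideal) (simp add: TV_simps)
  have "slice f \<in> HI" if "f \<in> rel_ideal" for f
    using that
  proof induction
    case (gen a u v b)
    have "slice (rel u v) \<in> ?G" unfolding relation_slice by blast
    then have "slice (rel u v) \<in> HI"
      unfolding HI using TV.genideal_self[of ?G] by (auto simp: TV_simps)
    then show ?case
      unfolding slice_mult using I.I_l_closed I.I_r_closed by (simp add: TV_simps)
  next
    case (add x y)
    then show ?case unfolding TV_simps(2) by (intro additive_subgroup.a_closed[OF I.is_additive_subgroup])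
  qed
  then show "slice ` rel_ideal \<subseteq> HI" by blast
qed

interpretation HI: ideal HI TV
  unfolding H_ideal_slice by (rule ideal_slice)

interpretation HA: ring HA
  unfolding H_alg_def by (rule HI.quotient_is_ring)

definition cls :: "'n skew_alg \<Rightarrow> ('n perm \<Rightarrow> ('n + 'n) tensor_alg) set"
  where "cls f = H_class doubled_perm_rep \<kappa>L \<kappa>C (slice f)"

lemma cls_eq_iff: "cls f = cls h \<longleftrightarrow> f - h \<in> rel_ideal"
proof -
  have "cls f = cls h \<longleftrightarrow> slice f \<ominus>\<^bsub>TV\<^esub> slice h \<in> HI"
    unfolding cls_def H_class_def
    by (rule TV.quotient_eq_iff_same_a_r_cos[symmetric, OF HI.ideal_axioms]) (simp_all add: TV_simps)
  then show ?thesis by (auto simp: TV_diff H_ideal_slice)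
qed

lemma HA_simps:
  "cls f \<otimes>\<^bsub>HA\<^esub> cls h = cls (f * h)" "cls f \<oplus>\<^bsub>HA\<^esub> cls h = cls (f + h)"
  "\<one>\<^bsub>HA\<^esub> = cls 1" "\<zero>\<^bsub>HA\<^esub> = cls 0" "cls f \<in> carrier HA"
proof -
  have hom: "(\<lambda>x. HI +>\<^bsub>TV\<^esub> x) \<in> ring_hom TV HA"
    unfolding H_alg_def by (rule HI.rcos_ring_hom)
  show "cls f \<otimes>\<^bsub>HA\<^esub> cls h = cls (f * h)" "cls f \<oplus>\<^bsub>HA\<^esub> cls h = cls (f + h)"
    unfolding cls_def H_class_def slice_mult TV_simps(2)
    by (simp_all add: ring_hom_mult[OF hom] ring_hom_add[OF hom] TV_simps(1))
  show "\<one>\<^bsub>HA\<^esub> = cls 1"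
    using ring_hom_one[OF hom] by (simp add: cls_def H_class_def TV_simps(4))
  show "cls f \<in> carrier HA"
    using ring_hom_closed[OF hom] by (simp add: cls_def H_class_def TV_simps(1))
  show "\<zero>\<^bsub>HA\<^esub> = cls 0"
    using ring_hom_zero[OF hom ring_TV HA.ring_axioms]
    by (simp add: cls_def H_class_def TV_simps(3))
qed

lemma HF_cls: "HF m = cls ` short (Suc m)"
  by (simp add: H_filt_def tensor_skew_filt_slice cls_def image_image)

lemma filt_below_cls: "filt_below HA HF m = cls ` short m"
proof (cases m)
  case 0
  then have "short m = {0 :: 'n skew_alg}" by (auto simp: short_0)
  then show ?thesis using 0 by (simp add: filt_below_def HA_simps(4))
qed (simp add: filt_below_def HF_cls)

text \<open>
  The coset \<open>F\<^sub>m\<^sub>-\<^sub>1 + f\<close> of the quotient algebra, in terms of representatives in \<open>T(V)#S\<^sub>n\<close>.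
\<close>

definition piece :: "nat \<Rightarrow> 'n skew_alg \<Rightarrow> ('n perm \<Rightarrow> ('n + 'n) tensor_alg) set set"
  where "piece m f = {cls h | h. h - f \<in> below m}"

lemma below_diff: "f \<in> below m \<Longrightarrow> h \<in> below m \<Longrightarrow> f - h \<in> below m"
  using below_add[OF _ below_minus] by fastforce

lemma short_below: "f \<in> short m \<Longrightarrow> f \<in> below m"
  unfolding below_def using rel_ideal_zero by force

lemma rel_ideal_below: "f \<in> rel_ideal \<Longrightarrow> f \<in> below m"
  unfolding below_def by force

lemma coset_piece: "filt_below HA HF m +>\<^bsub>HA\<^esub> cls f = piece m f"
proof
  show "filt_below HA HF m +>\<^bsub>HA\<^esub> cls f \<subseteq> piece m f"
    unfolding a_r_coset_def' filt_below_cls piece_def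
    by (auto simp: HA_simps(2)) (metis add_diff_cancel_right' short_below)
  show "piece m f \<subseteq> filt_below HA HF m +>\<^bsub>HA\<^esub> cls f"
  proof
    fix x assume "x \<in> piece m f"
    then obtain h i where h: "x = cls h" "i \<in> rel_ideal" "h - f - i \<in> short m"
      unfolding piece_def below_def by blast
    have "x = cls (h - f - i) \<oplus>\<^bsub>HA\<^esub> cls f"
      unfolding HA_simps(2) h(1) cls_eq_iff using h(2) by simp
    then show "x \<in> filt_below HA HF m +>\<^bsub>HA\<^esub> cls f"
      unfolding a_r_coset_def' filt_below_cls using h(3) by blast
  qed
qed

lemma piece_eq_iff: "piece m f = piece m h \<longleftrightarrow> f - h \<in> below m"
proof
  assume "piece m f = piece m h"
  moreover have "cls f \<in> piece m f" unfolding piece_def using below_zero by force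
  ultimately obtain k where k: "cls f = cls k" "k - h \<in> below m" unfolding piece_def by blast
  have "f - h = (f - k) + (k - h)" by simp
  then show "f - h \<in> below m"
    using k below_add rel_ideal_below unfolding cls_eq_iff by metis
next
  assume d: "f - h \<in> below m"
  have "k - f \<in> below m \<longleftrightarrow> k - h \<in> below m" for k
  proof
    assume "k - f \<in> below m"
    then show "k - h \<in> below m" using below_add[OF _ d, of "k - f"] by simp
  next
    assume "k - h \<in> below m"
    then show "k - f \<in> below m" using below_diff[OF _ d, of "k - h"] by simp
  qed
  then show "piece m f = piece m h" unfolding piece_def by simp
qed

lemma piece_zero: "filt_below HA HF m = piece m 0"
proof -
  have "filt_below HA HF m \<subseteq> carrier HA" using HA_simps(5) by (auto simp: filt_below_cls)
  then have "filt_below HA HF m = filt_below HA HF m +>\<^bsub>HA\<^esub> \<zero>\<^bsub>HA\<^esub>"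
    unfolding a_r_coset_def' by (auto simp: subset_iff intro!: bexI)
  then show ?thesis unfolding HA_simps(4) coset_piece .
qed

text \<open>
  The map from \<open>T(V)#S\<^sub>n\<close> to the associated graded algebra that sends a homogeneous element to
  its class.  It is a surjective graded homomorphism, so the associated graded algebra can be
  studied without choosing representatives of cosets.
\<close>

definition \<Theta> :: "'n skew_alg \<Rightarrow> nat \<Rightarrow> ('n perm \<Rightarrow> ('n + 'n) tensor_alg) set set"
  where "\<Theta> f m = piece m (hcomp m f)"

lemma \<Theta>_eq_iff: "\<Theta> f = \<Theta> h \<longleftrightarrow> (\<forall>m. hcomp m (f - h) \<in> below m)"
  by (simp add: fun_eq_iff \<Theta>_def piece_eq_iff Modules.additive.diff[OF additive_hcomp])

lemma \<Theta>_homog: "f \<in> homog m \<Longrightarrow> \<Theta> f k = (if k = m then piece m f else piece k 0)"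
  by (simp add: \<Theta>_def hcomp_id hcomp_other)

lemma carrier_GR: "carrier GR = range \<Theta>"
proof
  show "range \<Theta> \<subseteq> carrier GR"
  proof
    fix u assume "u \<in> range \<Theta>"
    then obtain f where u: "u = \<Theta> f" by blast
    obtain M where M: "f \<in> short M" using short_exists by blast
    have "{m. u m \<noteq> filt_below HA HF m} \<subseteq> {..<M}"
      using hcomp_short[OF M] by (auto simp: u \<Theta>_def piece_zero not_less[symmetric])
    then have "finite {m. u m \<noteq> filt_below HA HF m}" by (rule finite_subset) simp
    moreover have "\<exists>r\<in>HF m. u m = filt_below HA HF m +>\<^bsub>HA\<^esub> r" for m
      using homog_imp_short[OF hcomp_homog, of m "Suc m" f]
      by (auto simp: u \<Theta>_def HF_cls coset_piece[symmetric])
    ultimately show "u \<in> carrier GR" by (simp add: assoc_graded_def)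
  qed
  show "carrier GR \<subseteq> range \<Theta>"
  proof
    fix u assume "u \<in> carrier GR"
    then have ex: "\<forall>m. \<exists>r\<in>HF m. u m = filt_below HA HF m +>\<^bsub>HA\<^esub> r"
      and fin: "finite {m. u m \<noteq> filt_below HA HF m}"
      by (simp_all add: assoc_graded_def)
    have "\<forall>m. \<exists>f. f \<in> short (Suc m) \<and> u m = piece m f"
      using ex by (auto simp: HF_cls coset_piece)
    then obtain r where r: "\<And>m. r m \<in> short (Suc m)" "\<And>m. u m = piece m (r m)" by metis
    let ?M = "{m. u m \<noteq> filt_below HA HF m}"
    define f where "f = (\<Sum>m\<in>?M. hcomp m (r m))"
    have "u k = \<Theta> f k" for k
    proof -
      have "hcomp k f = (\<Sum>m\<in>?M. if m = k then hcomp k (r k) else 0)"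
        unfolding f_def Modules.additive.sum[OF additive_hcomp]
        by (intro sum.cong refl) (auto simp: hcomp_id[OF hcomp_homog] hcomp_other[OF hcomp_homog])
      then have k: "hcomp k f = (if k \<in> ?M then hcomp k (r k) else 0)"
        by (simp only: sum.delta[OF fin])
      show ?thesis
      proof (cases "k \<in> ?M")
        case True
        then show ?thesis
          using k r short_below[OF short_Suc_hcomp[OF r(1)]] by (simp add: \<Theta>_def piece_eq_iff)
      next
        case False
        then show ?thesis using k by (simp add: \<Theta>_def piece_zero)
      qed
    qed
    then show "u \<in> range \<Theta>" by blast
  qed
qed

lemma below_mult_right:
  assumes x: "x \<in> below i" and y: "y - h \<in> below j" and h: "h \<in> homog j"
  shows "x * y \<in> below (i + j)"
proof -
  obtain \<iota> where 1: "\<iota> \<in> rel_ideal" "x - \<iota> \<in> short i" using x unfolding below_def by blast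
  obtain \<iota>' where 2: "\<iota>' \<in> rel_ideal" "y - h - \<iota>' \<in> short j" using y unfolding below_def by blast
  have "y - \<iota>' \<in> short (Suc j)"
    using short_add[OF short_mono[OF 2(2)] homog_imp_short[OF h], of "Suc j"] by (simp add: algebra_simps)
  then have "(x - \<iota>) * (y - \<iota>') \<in> short (i + j)" by (rule short_mult_right[OF 1(2)])
  moreover have "x * y - (\<iota> * y + (x - \<iota>) * \<iota>') = (x - \<iota>) * (y - \<iota>')" by (simp add: algebra_simps)
  ultimately have "x * y - (\<iota> * y + (x - \<iota>) * \<iota>') \<in> short (i + j)" by (simp only:)
  moreover have "\<iota> * y + (x - \<iota>) * \<iota>' \<in> rel_ideal"
    by (intro rel_ideal.add rel_ideal_left rel_ideal_right 1 2)
  ultimately show ?thesis unfolding below_def by blast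
qed

lemma piece_mult:
  assumes "x - f \<in> below i" "y - h \<in> below j" "f \<in> homog i" "h \<in> homog j"
  shows "x * y - f * h \<in> below (i + j)"
proof -
  have "(x - f) * y \<in> below (i + j)" by (rule below_mult_right[OF assms(1,2,4)])
  moreover have "f * (y - h) \<in> below (i + j)"
    by (rule below_mult_left[OF assms(2)]) (simp add: homog_imp_short[OF assms(3)])
  moreover have "x * y - f * h = (x - f) * y + f * (y - h)" by (simp add: algebra_simps)
  ultimately show ?thesis using below_add by simp
qed

lemma finsum_cls: "finite A \<Longrightarrow> (\<Oplus>\<^bsub>HA\<^esub>i\<in>A. cls (F i)) = cls (\<Sum>i\<in>A. F i)"
  by (induction A rule: finite_induct) (simp_all add: HA_simps HA.finsum_insert Pi_def)

lemma GR_mult: "\<Theta> f \<otimes>\<^bsub>GR\<^esub> \<Theta> h = \<Theta> (f * h)"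
proof
  fix m
  have coset: "filt_below HA HF m +>\<^bsub>HA\<^esub> (\<Oplus>\<^bsub>HA\<^esub>i\<in>{..m}. a i \<otimes>\<^bsub>HA\<^esub> b (m - i)) = \<Theta> (f * h) m"
    if a: "\<forall>i. a i \<in> \<Theta> f i" and b: "\<forall>i. b i \<in> \<Theta> h i" for a b
  proof -
    obtain x where x: "\<And>i. a i = cls (x i)" "\<And>i. x i - hcomp i f \<in> below i"
      using a unfolding \<Theta>_def piece_def by (simp, metis)
    obtain y where y: "\<And>i. b i = cls (y i)" "\<And>i. y i - hcomp i h \<in> below i"
      using b unfolding \<Theta>_def piece_def by (simp, metis)
    have "(\<Sum>i\<le>m. x i * y (m - i)) - hcomp m (f * h) =
        (\<Sum>i\<le>m. x i * y (m - i) - hcomp i f * hcomp (m - i) h)"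
      by (simp add: hcomp_mult sum_subtractf)
    also have "\<dots> \<in> below m"
    proof (intro below_sum)
      fix i assume "i \<in> {..m}"
      then show "x i * y (m - i) - hcomp i f * hcomp (m - i) h \<in> below m"
        using piece_mult[OF x(2)[of i] y(2)[of "m - i"] hcomp_homog hcomp_homog] by simp
    qed
    finally show ?thesis
      by (simp add: x(1) y(1) HA_simps(1) finsum_cls coset_piece \<Theta>_def piece_eq_iff)
  qed
  have mem: "cls (hcomp i g) \<in> \<Theta> g i" for i g
    unfolding \<Theta>_def piece_def using below_zero by force
  have "(\<Theta> f \<otimes>\<^bsub>GR\<^esub> \<Theta> h) m = (\<Union>a\<in>{a. \<forall>i. a i \<in> \<Theta> f i}. \<Union>b\<in>{b. \<forall>i. b i \<in> \<Theta> h i}. \<Theta> (f * h) m)"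
    unfolding assoc_graded_def by (simp add: coset)
  also have "\<dots> = \<Theta> (f * h) m"
  proof -
    have "(\<lambda>i. cls (hcomp i f)) \<in> {a. \<forall>i. a i \<in> \<Theta> f i}" "(\<lambda>i. cls (hcomp i h)) \<in> {b. \<forall>i. b i \<in> \<Theta> h i}"
      using mem by auto
    then have "{a. \<forall>i. a i \<in> \<Theta> f i} \<noteq> {}" "{b. \<forall>i. b i \<in> \<Theta> h i} \<noteq> {}" by (auto simp only:)
    then show ?thesis by (simp only: UN_constant if_False)
  qed
  finally show "(\<Theta> f \<otimes>\<^bsub>GR\<^esub> \<Theta> h) m = \<Theta> (f * h) m" .
qed

lemma GR_add: "\<Theta> f \<oplus>\<^bsub>GR\<^esub> \<Theta> h = \<Theta> (f + h)"
proof
  fix m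
  have "piece m x <+>\<^bsub>HA\<^esub> piece m y = piece m (x + y)" for x y
  proof
    show "piece m x <+>\<^bsub>HA\<^esub> piece m y \<subseteq> piece m (x + y)"
    proof
      fix z assume "z \<in> piece m x <+>\<^bsub>HA\<^esub> piece m y"
      then obtain a b where ab: "z = cls (a + b)" "a - x \<in> below m" "b - y \<in> below m"
        unfolding set_add_def' piece_def by (auto simp: HA_simps(2))
      have "a + b - (x + y) \<in> below m" using below_add[OF ab(2,3)] by (simp add: algebra_simps)
      then show "z \<in> piece m (x + y)" unfolding piece_def ab(1) by blast
    qed
    show "piece m (x + y) \<subseteq> piece m x <+>\<^bsub>HA\<^esub> piece m y"
    proof
      fix z assume "z \<in> piece m (x + y)"
      then obtain k where k: "z = cls k" "k - (x + y) \<in> below m" unfolding piece_def by blast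
      have "z = cls (k - y) \<oplus>\<^bsub>HA\<^esub> cls y" by (simp add: HA_simps(2) k(1))
      moreover have "cls (k - y) \<in> piece m x" "cls y \<in> piece m y"
        using k(2) below_zero unfolding piece_def by (force simp: algebra_simps)+
      ultimately show "z \<in> piece m x <+>\<^bsub>HA\<^esub> piece m y" unfolding set_add_def' by blast
    qed
  qed
  then show "(\<Theta> f \<oplus>\<^bsub>GR\<^esub> \<Theta> h) m = \<Theta> (f + h) m"
    by (simp add: assoc_graded_def \<Theta>_def Modules.additive.add[OF additive_hcomp])
qed

lemma GR_scalar:
  "assoc_graded_scalar HA HF (\<lambda>c. H_class doubled_perm_rep \<kappa>L \<kappa>C (skew_scalar c)) c = \<Theta> (scalar c)"
  by (rule ext) (simp add: \<Theta>_homog[OF scalar_homog] assoc_graded_scalar_def slice_scalar[symmetric]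
      cls_def[symmetric] HA_simps(4) coset_piece)

lemma GR_one: "\<one>\<^bsub>GR\<^esub> = \<Theta> 1"
proof
  show "\<one>\<^bsub>GR\<^esub> m = \<Theta> 1 m" for m
    using \<Theta>_homog[OF scalar_homog, of 1 m] by (simp add: assoc_graded_def HA_simps(3,4) coset_piece)
qed

lemma GR_homog: "assoc_graded_homog HA HF m = \<Theta> ` homog m"
proof
  show "\<Theta> ` homog m \<subseteq> assoc_graded_homog HA HF m"
    by (auto simp: assoc_graded_homog_def carrier_GR \<Theta>_homog piece_zero)
  show "assoc_graded_homog HA HF m \<subseteq> \<Theta> ` homog m"
  proof
    fix u assume "u \<in> assoc_graded_homog HA HF m"
    then obtain f where u: "u = \<Theta> f" and z: "\<And>k. k \<noteq> m \<Longrightarrow> \<Theta> f k = piece k 0"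
      by (auto simp: assoc_graded_homog_def carrier_GR piece_zero)
    have "u = \<Theta> (hcomp m f)"
    proof
      show "u k = \<Theta> (hcomp m f) k" for k
        using z[of k] by (cases "k = m") (simp_all add: u \<Theta>_homog[OF hcomp_homog], simp add: \<Theta>_def)
    qed
    then show "u \<in> \<Theta> ` homog m" using hcomp_homog by blast
  qed
qed

section \<open>The PBW property\<close>

lemma \<Theta>_nform: "f \<in> homog m \<Longrightarrow> \<Theta> (nform f) = \<Theta> f"
proof -
  assume f: "f \<in> homog m"
  then have d: "nform f - f \<in> homog m"
    using homog_add[OF nform_homog[OF f] homog_scalar[OF f, of "- 1"]] by (simp add: scalar_minus)
  have "hcomp k (nform f - f) \<in> below k" for k
    using below_minus[OF nform_below[OF f]] hcomp_id[OF d] hcomp_other[OF d] by (cases "k = m") simp_all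
  then show ?thesis by (simp add: \<Theta>_eq_iff)
qed

text \<open>
  \<open>\<Theta>\<close> and \<open>symbol\<close> are two surjective graded homomorphisms out of \<open>T(V)#S\<^sub>n\<close>; with equal kernels their
  images are isomorphic.
\<close>

lemma pbw_imp_kernels_agree:
  assumes pbw
  shows "\<Theta> f = \<Theta> h \<longleftrightarrow> symbol f = symbol h"
proof -
  have comp: "hcomp m d \<in> below m \<longleftrightarrow> nform (hcomp m d) = 0" for m and d :: "'n skew_alg"
  proof
    assume "nform (hcomp m d) = 0"
    then show "hcomp m d \<in> below m" using nform_below[OF hcomp_homog, of m d] by simp
  next
    assume "hcomp m d \<in> below m"
    then obtain i where i: "i \<in> rel_ideal" "hcomp m d - i \<in> short m" unfolding below_def by blast
    have "hcomp m (hcomp m d - i) = 0" using hcomp_short[OF i(2)] by simp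
    then have same: "hcomp m i = hcomp m d"
      by (simp add: Modules.additive.diff[OF additive_hcomp] hcomp_id[OF hcomp_homog])
    have "i \<in> short (Suc m)"
      using short_diff[OF homog_imp_short[OF hcomp_homog, of m "Suc m" d] short_mono[OF i(2), of "Suc m"]] by simp
    then show "nform (hcomp m d) = 0" using assms i(1) same unfolding pbw_def by metis
  qed
  have hn: "hcomp m (nform d) = nform (hcomp m d)" for m and d :: "'n skew_alg"
  proof (rule skew_alg_ext[of "\<lambda>d. hcomp m (nform d)" "\<lambda>d. nform (hcomp m d)"])
    fix c w and g :: "'n perm"
    have *: "scalar c * wrd w * grp g \<in> homog (length w)"
      by (intro homog_mult_grp homog_scalar wrd_homog)
    show "hcomp m (nform (scalar c * wrd w * grp g)) = nform (hcomp m (scalar c * wrd w * grp g))"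
      using hcomp_id[OF *] hcomp_other[OF *] hcomp_id[OF nform_homog[OF *]] hcomp_other[OF nform_homog[OF *]]
      by (cases "m = length w") simp_all
  qed (rule additive_compose[OF additive_hcomp additive_lin] additive_compose[OF additive_lin additive_hcomp])+
  have "nform d = 0 \<longleftrightarrow> (\<forall>m. nform (hcomp m d) = 0)" for d :: "'n skew_alg"
  proof
    assume "nform d = 0"
    then show "\<forall>m. nform (hcomp m d) = 0"
      by (simp add: hn[symmetric] Modules.additive.zero[OF additive_hcomp])
  next
    assume z: "\<forall>m. nform (hcomp m d) = 0"
    obtain M where "nform d \<in> short M" using short_exists by blast
    from sum_hcomp[OF this] show "nform d = 0" using z by (simp add: hn)
  qed
  from this[of "f - h"] show ?thesis unfolding \<Theta>_eq_iff symbol_eq_iff comp by blast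
qed

theorem pbw_imp_drinfeld:
  assumes pbw
  shows "drinfeld_orbifold_algebra doubled_perm_rep \<kappa>L \<kappa>C"
proof -
  note ker = pbw_imp_kernels_agree[OF assms]
  define \<phi> where "\<phi> u = symbol (SOME f. \<Theta> f = u)" for u
  have \<phi>: "\<phi> (\<Theta> f) = symbol f" for f
    unfolding \<phi>_def using someI[of "\<lambda>h. \<Theta> h = \<Theta> f" f] ker by blast
  have "\<phi> \<in> ring_hom GR SV"
    by (rule ring_hom_memI)
       (auto simp: carrier_GR SV_simps GR_mult GR_add GR_one \<phi> symbol_mult)
  moreover have "bij_betw \<phi> (carrier GR) (carrier SV)"
    unfolding bij_betw_def
  proof
    show "inj_on \<phi> (carrier GR)" by (auto simp: inj_on_def carrier_GR \<phi> ker)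
    have "s \<in> \<phi> ` carrier GR" for s
      using symbol_unsymbol[of s] \<phi>[of "unsymbol s"] by (metis carrier_GR rangeI image_eqI)
    then show "\<phi> ` carrier GR = carrier SV" by (auto simp: SV_simps)
  qed
  moreover have "\<phi> ` assoc_graded_homog HA HF m = sym_skew_homog m" for m
    by (simp add: GR_homog image_image \<phi> symbol_homog)
  ultimately have "graded_algebra_iso GR
      (assoc_graded_scalar HA HF (\<lambda>c. H_class doubled_perm_rep \<kappa>L \<kappa>C (skew_scalar c)))
      (assoc_graded_homog HA HF) SV skew_scalar sym_skew_homog \<phi>"
    by (simp add: graded_algebra_iso_def ring_iso_def GR_scalar \<phi> symbol_scalar)
  then show ?thesis
    unfolding drinfeld_orbifold_algebra_def using linear_action_doubled_perm_rep linL linC by blast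
qed

text \<open>
  The given isomorphism need not be the inverse of the canonical surjection from \<open>S(V)#S\<^sub>n\<close> to
  the associated graded algebra.  But composing the two gives a surjective graded linear
  endomorphism of \<open>S(V)#S\<^sub>n\<close>, whose homogeneous components are finite-dimensional; hence it is
  injective, and so is the canonical surjection.
\<close>

theorem drinfeld_imp_pbw:
  assumes "drinfeld_orbifold_algebra doubled_perm_rep \<kappa>L \<kappa>C"
  shows pbw
  unfolding pbw_def
proof (intro allI impI)
  fix k f assume f: "f \<in> rel_ideal" "f \<in> short (Suc k)"
  obtain \<phi> :: "_ \<Rightarrow> 'n perm \<Rightarrow> ('n + 'n) sym_alg" where iso: "graded_algebra_iso GR
      (assoc_graded_scalar HA HF (\<lambda>c. H_class doubled_perm_rep \<kappa>L \<kappa>C (skew_scalar c)))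
      (assoc_graded_homog HA HF) SV skew_scalar sym_skew_homog \<phi>"
    using assms unfolding drinfeld_orbifold_algebra_def by blast
  then have hom: "\<phi> \<in> ring_hom GR SV" and sc: "\<And>c. \<phi> (\<Theta> (scalar c)) = skew_scalar c"
    and hg: "\<And>m. \<phi> ` \<Theta> ` homog m = sym_skew_homog m"
    by (auto simp: graded_algebra_iso_def ring_iso_def GR_scalar GR_homog)
  \<comment> \<open>restricted to normal forms, this is the composite endomorphism\<close>
  define \<tau> where "\<tau> x = unsymbol (\<phi> (\<Theta> x))" for x
  have \<tau>_add: "\<tau> (x + y) = \<tau> x + \<tau> y" for x y
  proof -
    have "\<phi> (\<Theta> (x + y)) = \<phi> (\<Theta> x) \<oplus>\<^bsub>SV\<^esub> \<phi> (\<Theta> y)"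
      using ring_hom_add[OF hom, of "\<Theta> x" "\<Theta> y"] by (simp add: carrier_GR GR_add)
    also have "\<dots> = (\<lambda>g. \<phi> (\<Theta> x) g + \<phi> (\<Theta> y) g)"
      by (simp add: sym_skew_def skew_group_ring_def)
    finally show ?thesis by (simp add: \<tau>_def unsymbol_add)
  qed
  have \<tau>_scalar: "\<tau> (scalar c * x) = scalar c * \<tau> x" for c x
  proof -
    have "\<phi> (\<Theta> (scalar c * x)) = skew_scalar c \<otimes>\<^bsub>SV\<^esub> \<phi> (\<Theta> x)"
      using ring_hom_mult[OF hom, of "\<Theta> (scalar c)" "\<Theta> x"] by (simp add: carrier_GR GR_mult sc)
    also have "\<dots> = symbol (scalar c * unsymbol (\<phi> (\<Theta> x)))"
      by (simp add: symbol_mult symbol_scalar symbol_unsymbol)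
    finally have "\<tau> (scalar c * x) = nform (scalar c * unsymbol (\<phi> (\<Theta> x)))"
      by (simp add: \<tau>_def unsymbol_symbol)
    also have "\<dots> = scalar c * unsymbol (symbol (unsymbol (\<phi> (\<Theta> x))))"
      by (simp add: lin_scalar unsymbol_symbol)
    finally show ?thesis by (simp add: \<tau>_def symbol_unsymbol)
  qed
  interpret VS: vector_space "\<lambda>c (x :: 'n skew_alg). scalar c * x"
    by standard (simp_all add: distrib_left scalar_add distrib_right scalar_mult mult.assoc)
  have \<tau>_linear: "Vector_Spaces.linear (\<lambda>c x. scalar c * x) (\<lambda>c x. scalar c * x) \<tau>"
    by unfold_locales (simp_all add: \<tau>_add \<tau>_scalar)
  define V where "V = nform ` (homog k :: 'n skew_alg set)"
  have sub: "VS.subspace V"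
    unfolding V_def
    by (rule VS.subspaceI)
       (auto simp: lin_add[symmetric] lin_scalar[symmetric] intro!: image_eqI homog_add homog_scalar
         lin_zero[symmetric])
  have fin: "finite ((\<lambda>(w, g). wrd w * grp g :: 'n skew_alg) ` ({w. length w = k} \<times> UNIV))"
    using finite_lists_length_eq[of "UNIV :: ('n + 'n) set" k] by simp
  have "x \<in> VS.span ((\<lambda>(w, g). wrd w * grp g) ` ({w. length w = k} \<times> UNIV))" if "x \<in> homog k" for x
  proof (subst skew_expansion, intro VS.span_sum)
    fix l assume "l \<in> Poly_Mapping.keys x"
    then have "wrd (letters_of l) * grp (twist l) \<in> (\<lambda>(w, g). wrd w * grp g) ` ({w. length w = k} \<times> UNIV)"
      using that by (force simp: homog_def)
    then show "scalar (Poly_Mapping.lookup x l) * wrd (letters_of l) * grp (twist l) \<in>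
        VS.span ((\<lambda>(w, g). wrd w * grp g) ` ({w. length w = k} \<times> UNIV))"
      unfolding mult.assoc by (intro VS.span_scale VS.span_base)
  qed
  then have span: "V \<subseteq> VS.span ((\<lambda>(w, g). wrd w * grp g) ` ({w. length w = k} \<times> UNIV))"
    unfolding V_def using nform_homog by blast
  have "\<tau> ` V = \<tau> ` homog k"
    unfolding V_def image_image by (intro image_cong refl) (simp add: \<tau>_def \<Theta>_nform)
  also have "\<dots> = unsymbol ` symbol ` homog k"
    unfolding \<tau>_def symbol_homog hg[symmetric] image_image ..
  finally have surj: "\<tau> ` V = V"
    by (simp add: V_def image_image unsymbol_symbol)
  let ?d = "hcomp k f"
  have "\<Theta> ?d = \<Theta> 0"
  proof -
    have "?d \<in> below k"
      unfolding below_def using f(1) short_minus[OF short_Suc_hcomp[OF f(2)]] by force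
    then have "hcomp m ?d \<in> below m" for m
      using hcomp_id[OF hcomp_homog, of k f] hcomp_other[OF hcomp_homog, of m k f] by (cases "m = k") simp_all
    then show ?thesis by (simp add: \<Theta>_eq_iff)
  qed
  then have "\<tau> (nform ?d) = \<tau> 0"
    by (simp add: \<tau>_def \<Theta>_nform[OF hcomp_homog])
  also have "\<tau> 0 = 0" using \<tau>_add[of 0 0] by simp
  finally show "nform ?d = 0"
    using VS.surjective_imp_trivial_kernel[OF sub fin span \<tau>_linear surj] hcomp_homog
    unfolding V_def by blast
qed

theorem drinfeld_iff_conditions:
  "drinfeld_orbifold_algebra doubled_perm_rep \<kappa>L \<kappa>C \<longleftrightarrow> pbw_conditions"
  using pbw_imp_drinfeld drinfeld_imp_pbw pbw_sufficient pbw_necessary by blast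

end

section \<open>Evaluation at one\<close>

context UP_ring
begin

text \<open>
  The coefficient ring may be noncommutative, but evaluation at the central element \<open>1\<close> is still a ring
  homomorphism; it sums the coefficients.
\<close>

abbreviation eval1 :: "(nat \<Rightarrow> 'a) \<Rightarrow> 'a"
  where "eval1 \<equiv> UnivPoly.eval R R (\<lambda>a. a) \<one>"

lemma eval1_bound:
  assumes p: "p \<in> carrier P" and N: "deg R p \<le> N"
  shows "eval1 p = (\<Oplus>i\<in>{..N}. coeff P p i)"
  using N
proof (induction N rule: dec_induct)
  case base
  have "eval1 p = (\<Oplus>i\<in>{..deg R p}. coeff P p i \<otimes> \<one> [^] i)"
    using p by (rule eval_on_carrier)
  also have "\<dots> = (\<Oplus>i\<in>{..deg R p}. coeff P p i)"
    by (rule R.finsum_cong') (use p in \<open>auto simp: Pi_def\<close>)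
  finally show ?case .
next
  case (step n)
  have "coeff P p (Suc n) = \<zero>" using step p by (intro deg_aboveD) auto
  then show ?case using step p by (simp add: Pi_def)
qed

lemma eval1_closed: "p \<in> carrier P \<Longrightarrow> eval1 p \<in> carrier R"
  by (simp add: eval1_bound[OF _ order_refl] Pi_def)

lemma eval1_mult:
  assumes p: "p \<in> carrier P" and q: "q \<in> carrier P"
  shows "eval1 (p \<otimes>\<^bsub>P\<^esub> q) = eval1 p \<otimes> eval1 q"
proof -
  have "eval1 (p \<otimes>\<^bsub>P\<^esub> q) = (\<Oplus>k\<in>{..deg R p + deg R q}. coeff P (p \<otimes>\<^bsub>P\<^esub> q) k)"
    using p q by (intro eval1_bound deg_mult_ring) simp_all
  also have "\<dots> = (\<Oplus>k\<in>{..deg R p + deg R q}. \<Oplus>i\<in>{..k}. coeff P p i \<otimes> coeff P q (k - i))"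
    using p q by (intro R.finsum_cong') (auto simp: Pi_def)
  also have "\<dots> = (\<Oplus>i\<in>{..deg R p}. coeff P p i) \<otimes> (\<Oplus>i\<in>{..deg R q}. coeff P q i)"
    using p q by (intro R.cauchy_product) (auto simp: Pi_def intro: deg_aboveD)
  finally show ?thesis
    using p q by (simp add: eval1_bound[OF _ order_refl])
qed

lemma eval1_add:
  assumes p: "p \<in> carrier P" and q: "q \<in> carrier P"
  shows "eval1 (p \<oplus>\<^bsub>P\<^esub> q) = eval1 p \<oplus> eval1 q"
proof -
  let ?N = "max (deg R p) (deg R q)"
  have "eval1 (p \<oplus>\<^bsub>P\<^esub> q) = (\<Oplus>k\<in>{..?N}. coeff P (p \<oplus>\<^bsub>P\<^esub> q) k)"
    using p q by (intro eval1_bound deg_add) simp_all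
  also have "\<dots> = (\<Oplus>k\<in>{..?N}. coeff P p k) \<oplus> (\<Oplus>k\<in>{..?N}. coeff P q k)"
    using p q by (simp add: R.finsum_addf Pi_def)
  finally show ?thesis
    using p q by (simp add: eval1_bound[of p ?N] eval1_bound[of q ?N])
qed

lemma eval1_monom: "a \<in> carrier R \<Longrightarrow> eval1 (monom P a n) = a"
proof -
  assume a: "a \<in> carrier R"
  have "eval1 (monom P a n) = (\<Oplus>i\<in>{..n}. coeff P (monom P a n) i)"
    using a by (intro eval1_bound deg_monom_le) simp_all
  also have "\<dots> = (\<Oplus>i\<in>{..n}. if n = i then a else \<zero>)"
    using a by (intro R.finsum_cong') (auto simp: Pi_def)
  also have "\<dots> = a"
    using a R.finsum_singleton[of n "{..n}" "\<lambda>_. a"] by (simp add: Pi_def)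
  finally show ?thesis .
qed

lemma eval1_minus:
  assumes p: "p \<in> carrier P" and q: "q \<in> carrier P"
  shows "eval1 (p \<ominus>\<^bsub>P\<^esub> q) = eval1 p \<ominus> eval1 q"
proof -
  have "eval1 (p \<ominus>\<^bsub>P\<^esub> q) \<oplus> eval1 q = eval1 ((p \<ominus>\<^bsub>P\<^esub> q) \<oplus>\<^bsub>P\<^esub> q)"
    using p q by (simp add: eval1_add)
  also have "(p \<ominus>\<^bsub>P\<^esub> q) \<oplus>\<^bsub>P\<^esub> q = p"
    using p q by (simp add: a_minus_def P.a_assoc P.l_neg)
  finally have *: "eval1 (p \<ominus>\<^bsub>P\<^esub> q) \<oplus> eval1 q = eval1 p" .
  have "eval1 p \<ominus> eval1 q = eval1 (p \<ominus>\<^bsub>P\<^esub> q) \<oplus> (eval1 q \<ominus> eval1 q)"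
    unfolding *[symmetric] using p q by (simp add: a_minus_def R.a_assoc eval1_closed)
  then show ?thesis
    using p q by (simp add: a_minus_def R.r_neg eval1_closed)
qed

end

interpretation PT: UP_ring TV "UP TV"
  by unfold_locales

context cochain_pair
begin

interpretation HI: ideal HI TV
  unfolding H_ideal_slice by (rule ideal_slice)

section \<open>The algebra over the polynomial ring\<close>

abbreviation PV :: "('n perm \<Rightarrow> ('n + 'n) tensor_alg, nat \<Rightarrow> 'n perm \<Rightarrow> ('n + 'n) tensor_alg) up_ring"
  where "PV \<equiv> UP TV"

definition relt :: "complex ^ ('n + 'n) \<Rightarrow> complex ^ ('n + 'n) \<Rightarrow> nat \<Rightarrow> 'n perm \<Rightarrow> ('n + 'n) tensor_alg"
  where "relt u v = monom PV (skew_commutator doubled_perm_rep u v) 0 \<ominus>\<^bsub>PV\<^esub>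
     monom PV (cochainL_elem \<kappa>L u v) 1 \<ominus>\<^bsub>PV\<^esub> monom PV (cochainC_elem \<kappa>C u v) 2"

lemma Ht_ideal_relt: "Ht_ideal doubled_perm_rep \<kappa>L \<kappa>C U = Idl\<^bsub>PV\<^esub> {relt u v | u v. u \<in> U \<and> v \<in> U}"
  by (simp add: Ht_ideal_def relt_def Let_def)

lemma relt_closed: "relt u v \<in> carrier PV"
  by (simp add: relt_def TV_simps)

lemma skew_commutator_slice:
  "skew_commutator doubled_perm_rep u v = slice (vec_elem u * vec_elem v - vec_elem v * vec_elem u)"
  unfolding skew_commutator_def skew_vec_slice slice_mult[symmetric] TV_diff ..

lemma coeff_relt:
  "coeff PV (relt u v) n = slice
     (if n = 0 then vec_elem u * vec_elem v - vec_elem v * vec_elem u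
      else if n = 1 then - (\<Sum>h\<in>UNIV. vec_elem (\<kappa>L h u v) * grp h)
      else if n = 2 then - (\<Sum>h\<in>UNIV. scalar (\<kappa>C h u v) * grp h) else 0)"
  unfolding relt_def skew_commutator_slice cochainL_slice cochainC_slice
  by (simp add: TV_simps(1,3) TV_diff)

lemma relt_add: "relt (u + u') v = relt u v \<oplus>\<^bsub>PV\<^esub> relt u' v" "relt u (v + v') = relt u v \<oplus>\<^bsub>PV\<^esub> relt u v'"
  by (rule PT.up_eqI; simp add: relt_closed coeff_relt TV_simps(2)[symmetric] vec_elem_add \<kappa>L_bilinear
      \<kappa>C_bilinear scalar_add algebra_simps sum.distrib)+

lemma relt_scale:
  "relt (c *s u) v = monom PV (slice (scalar c)) 0 \<otimes>\<^bsub>PV\<^esub> relt u v"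
  "relt u (c *s v) = monom PV (slice (scalar c)) 0 \<otimes>\<^bsub>PV\<^esub> relt u v"
  by (rule PT.up_eqI; simp add: relt_closed coeff_relt PT.monom_mult_is_smult TV_simps(1)
      slice_mult[symmetric] vec_elem_scale \<kappa>L_bilinear \<kappa>C_bilinear scalar_mult
      sum_distrib_left right_diff_distrib mult.assoc scalar_left_commute[of "vec_elem _"])+

lemma relt_zero: "relt 0 v = \<zero>\<^bsub>PV\<^esub>" "relt u 0 = \<zero>\<^bsub>PV\<^esub>"
  using relt_scale(1)[of 0 0 v] relt_scale(2)[of u 0 0]
  by (simp_all add: TV_simps(3)[symmetric] relt_closed)

text \<open>
  The relations depend bilinearly on the two vectors, so those for basis vectors imply all.
\<close>

lemma relt_in_ideal:
  assumes J: "ideal J PV" and gen: "\<And>p q. relt (axis p 1) (axis q 1) \<in> J"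
  shows "relt u v \<in> J"
proof -
  interpret J: ideal J PV by fact
  have scale: "monom PV (slice (scalar c)) 0 \<otimes>\<^bsub>PV\<^esub> x \<in> J" if "x \<in> J" for c x
    using that by (intro J.I_l_closed) (simp_all add: TV_simps)
  have add: "x \<oplus>\<^bsub>PV\<^esub> y \<in> J" if "x \<in> J" "y \<in> J" for x y
    using that additive_subgroup.a_closed[OF J.is_additive_subgroup] by blast
  have zero: "\<zero>\<^bsub>PV\<^esub> \<in> J"
    using additive_subgroup.zero_closed[OF J.is_additive_subgroup] .
  have 1: "relt (axis p 1) (\<Sum>q\<in>A. (v $ q) *s axis q 1) \<in> J" for p and A :: "('n + 'n) set"
    by (induction A rule: infinite_finite_induct)
       (simp_all add: relt_zero relt_add relt_scale add scale gen zero)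
  have 2: "relt (\<Sum>p\<in>A. (u $ p) *s axis p 1) v \<in> J" for A :: "('n + 'n) set"
    using 1[of _ UNIV] unfolding basis_expansion
    by (induction A rule: infinite_finite_induct)
       (simp_all add: relt_zero relt_add relt_scale add scale zero)
  show ?thesis using 2[of UNIV] unfolding basis_expansion .
qed

lemma xy_basis_axis: "xy_basis = range (\<lambda>p. axis p 1)"
proof -
  have "range (\<lambda>p :: 'a + 'a. axis p (1 :: complex)) = (\<lambda>p. axis p 1) ` (range Inl \<union> range Inr)"
    by (simp add: UNIV_sum)
  then show ?thesis
    by (auto simp: xy_basis_def x_vec_def y_vec_def image_Un image_image)
qed

lemma Ht_ideal_ideal: "ideal (Ht_ideal doubled_perm_rep \<kappa>L \<kappa>C U) PV"
  unfolding Ht_ideal_relt by (rule PT.genideal_ideal) (auto simp: relt_closed)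

lemma relt_Ht_ideal: "u \<in> U \<Longrightarrow> v \<in> U \<Longrightarrow> relt u v \<in> Ht_ideal doubled_perm_rep \<kappa>L \<kappa>C U"
  unfolding Ht_ideal_relt
  using PT.genideal_self[of "{relt u v | u v. u \<in> U \<and> v \<in> U}"] relt_closed by auto

lemma Ht_ideal_basis:
  "Ht_ideal doubled_perm_rep \<kappa>L \<kappa>C xy_basis = Ht_ideal doubled_perm_rep \<kappa>L \<kappa>C UNIV"
proof
  show "Ht_ideal doubled_perm_rep \<kappa>L \<kappa>C xy_basis \<subseteq> Ht_ideal doubled_perm_rep \<kappa>L \<kappa>C UNIV"
    unfolding Ht_ideal_relt[of xy_basis]
    by (rule PT.genideal_minimal[OF Ht_ideal_ideal]) (auto intro: relt_Ht_ideal)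
  have "relt u v \<in> Ht_ideal doubled_perm_rep \<kappa>L \<kappa>C xy_basis" for u v
    by (rule relt_in_ideal[OF Ht_ideal_ideal]) (auto intro!: relt_Ht_ideal simp: xy_basis_axis)
  then show "Ht_ideal doubled_perm_rep \<kappa>L \<kappa>C UNIV \<subseteq> Ht_ideal doubled_perm_rep \<kappa>L \<kappa>C xy_basis"
    unfolding Ht_ideal_relt[of UNIV] by (intro PT.genideal_minimal[OF Ht_ideal_ideal]) auto
qed

theorem Ht_alg_basis:
  "Ht_alg doubled_perm_rep \<kappa>L \<kappa>C xy_basis = Ht_alg doubled_perm_rep \<kappa>L \<kappa>C UNIV"
  by (simp add: Ht_alg_def Ht_ideal_basis)

lemma eval1_relt: "PT.eval1 (relt u v) = slice (rel u v)"
proof -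
  have "PT.eval1 (relt u v) = skew_commutator doubled_perm_rep u v \<ominus>\<^bsub>TV\<^esub> cochainL_elem \<kappa>L u v
      \<ominus>\<^bsub>TV\<^esub> cochainC_elem \<kappa>C u v"
    by (simp add: relt_def PT.eval1_minus PT.eval1_monom TV_simps(1))
  then show ?thesis by (simp add: relation_slice)
qed

text \<open>
  Evaluation is surjective, maps generators to generators, and constant polynomials supply the
  multipliers that are needed to reach the whole ideal.
\<close>

lemma eval1_Ht_ideal: "PT.eval1 ` Ht_ideal doubled_perm_rep \<kappa>L \<kappa>C xy_basis = HI"
proof
  let ?J = "Ht_ideal doubled_perm_rep \<kappa>L \<kappa>C UNIV"
  interpret J: ideal ?J PV by (rule Ht_ideal_ideal)
  have sub: "?J \<subseteq> carrier PV" using J.a_subset .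
  have "ideal {p \<in> carrier PV. PT.eval1 p \<in> HI} PV"
  proof (rule idealI[OF PT.UP_ring])
    show "subgroup {p \<in> carrier PV. PT.eval1 p \<in> HI} (add_monoid PV)"
    proof
      fix x y assume xy: "x \<in> {p \<in> carrier PV. PT.eval1 p \<in> HI}" "y \<in> {p \<in> carrier PV. PT.eval1 p \<in> HI}"
      then show "x \<otimes>\<^bsub>add_monoid PV\<^esub> y \<in> {p \<in> carrier PV. PT.eval1 p \<in> HI}"
        using additive_subgroup.a_closed[OF HI.is_additive_subgroup] by (auto simp: PT.eval1_add)
    next
      have "PT.eval1 (monom PV \<zero>\<^bsub>TV\<^esub> 0) = \<zero>\<^bsub>TV\<^esub>" by (rule PT.eval1_monom) simp
      then show "\<one>\<^bsub>add_monoid PV\<^esub> \<in> {p \<in> carrier PV. PT.eval1 p \<in> HI}"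
        using additive_subgroup.zero_closed[OF HI.is_additive_subgroup] by simp
    next
      fix x assume x: "x \<in> {p \<in> carrier PV. PT.eval1 p \<in> HI}"
      have z: "PT.eval1 (monom PV \<zero>\<^bsub>TV\<^esub> 0) = \<zero>\<^bsub>TV\<^esub>" by (rule PT.eval1_monom) simp
      have "\<ominus>\<^bsub>PV\<^esub> x = \<zero>\<^bsub>PV\<^esub> \<ominus>\<^bsub>PV\<^esub> x" using x by (simp add: a_minus_def)
      then have "PT.eval1 (\<ominus>\<^bsub>PV\<^esub> x) = \<zero>\<^bsub>TV\<^esub> \<ominus>\<^bsub>TV\<^esub> PT.eval1 x"
        using x z by (simp add: PT.eval1_minus)
      also have "\<dots> = \<ominus>\<^bsub>TV\<^esub> PT.eval1 x" by (simp add: a_minus_def TV_simps(1))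
      also have "\<dots> \<in> HI"
        using x additive_subgroup.a_inv_closed[OF HI.is_additive_subgroup] by simp
      finally show "inv\<^bsub>add_monoid PV\<^esub> x \<in> {p \<in> carrier PV. PT.eval1 p \<in> HI}"
        using x PT.UP_a_inv_closed by (simp add: a_inv_def)
    qed auto
  next
    fix a x assume "a \<in> {p \<in> carrier PV. PT.eval1 p \<in> HI}" "x \<in> carrier PV"
    then show "x \<otimes>\<^bsub>PV\<^esub> a \<in> {p \<in> carrier PV. PT.eval1 p \<in> HI}"
      "a \<otimes>\<^bsub>PV\<^esub> x \<in> {p \<in> carrier PV. PT.eval1 p \<in> HI}"
      by (auto simp: PT.eval1_mult HI.I_l_closed HI.I_r_closed PT.eval1_closed)
  qed
  then have "?J \<subseteq> {p \<in> carrier PV. PT.eval1 p \<in> HI}"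
    unfolding Ht_ideal_relt
    by (rule PT.genideal_minimal) (auto simp: relt_closed eval1_relt H_ideal_slice rel_in_ideal)
  then show "PT.eval1 ` Ht_ideal doubled_perm_rep \<kappa>L \<kappa>C xy_basis \<subseteq> HI"
    unfolding Ht_ideal_basis by blast
  have "slice f \<in> PT.eval1 ` ?J" if "f \<in> rel_ideal" for f
    using that
  proof induction
    case (gen a u v b)
    let ?p = "monom PV (slice a) 0 \<otimes>\<^bsub>PV\<^esub> relt u v \<otimes>\<^bsub>PV\<^esub> monom PV (slice b) 0"
    have "?p \<in> ?J"
      by (intro J.I_r_closed J.I_l_closed relt_Ht_ideal) (simp_all add: TV_simps)
    moreover have "PT.eval1 ?p = slice (a * rel u v * b)"
      by (simp add: PT.eval1_mult PT.eval1_monom eval1_relt relt_closed TV_simps(1) slice_mult)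
    ultimately show ?case by (metis image_eqI)
  next
    case (add x y)
    then obtain p q where pq: "p \<in> ?J" "q \<in> ?J" "slice x = PT.eval1 p" "slice y = PT.eval1 q" by blast
    then have "slice (x + y) = PT.eval1 (p \<oplus>\<^bsub>PV\<^esub> q)"
      using sub by (simp add: TV_simps(2) PT.eval1_add subset_iff)
    moreover have "p \<oplus>\<^bsub>PV\<^esub> q \<in> ?J"
      using pq additive_subgroup.a_closed[OF J.is_additive_subgroup] by blast
    ultimately show ?case by blast
  qed
  then show "HI \<subseteq> PT.eval1 ` Ht_ideal doubled_perm_rep \<kappa>L \<kappa>C xy_basis"
    unfolding Ht_ideal_basis H_ideal_slice by blast
qed

theorem specialization_at_one:
  "Ht_specialization doubled_perm_rep \<kappa>L \<kappa>C xy_basis 1 = HA"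
proof -
  have "(skew_scalar 1 :: 'n perm \<Rightarrow> ('n + 'n) tensor_alg) = \<one>\<^bsub>TV\<^esub>"
    by (simp add: slice_scalar[symmetric] TV_simps(4))
  then show ?thesis
    by (simp add: Ht_specialization_def H_alg_def eval1_Ht_ideal[symmetric])
qed

end

section \<open>The explicit cochains\<close>

text \<open>
  The skew form supported on the image of \<open>1 - (ij)\<close>: the determinant of the two coordinate
  differences.  The component of \<open>\<kappa>\<^sup>L\<close> at \<open>(ij)\<close> is this form times \<open>kappa_vec a a' b b' i j\<close>.
\<close>

definition om :: "'n \<Rightarrow> 'n \<Rightarrow> complex ^ ('n::finite + 'n) \<Rightarrow> complex ^ ('n + 'n) \<Rightarrow> complex"
  where "om i j u v = (u $ Inl i - u $ Inl j) * (v $ Inr i - v $ Inr j) -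
                      (u $ Inr i - u $ Inr j) * (v $ Inl i - v $ Inl j)"

text \<open>
  Indicator of \<open>g = (ijk)\<close>.  Every 3-cycle is written as \<open>(ijk)\<close> in three ways, and sums over all
  triples count each of them.
\<close>

definition three :: "'n perm \<Rightarrow> 'n \<Rightarrow> 'n \<Rightarrow> 'n \<Rightarrow> complex"
  where "three g i j k = of_bool (i \<noteq> j \<and> j \<noteq> k \<and> k \<noteq> i \<and> g = Perm.cycle [i, j, k])"

lemma om_bilinear:
  "om i j (u + u') v = om i j u v + om i j u' v" "om i j (s *s u) v = s * om i j u v"
  "om i j u (v + v') = om i j u v + om i j u v'" "om i j u (s *s v) = s * om i j u v"
  and om_skew: "om i j u v = - om i j v u" and om_sym: "om j i u v = om i j u v"
  and om_same: "om i i u v = 0"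
  by (simp_all add: om_def algebra_simps)

lemma apply_swap: "Perm.apply (Perm.swap i j) k = (if k = i then j else if k = j then i else k)"
  by auto

lemma apply_cycle:
  assumes "i \<noteq> j" "j \<noteq> k" "k \<noteq> i"
  shows "Perm.apply (Perm.cycle [i, j, k]) m = (if m = i then j else if m = j then k else if m = k then i else m)"
  using assms by (auto simp: apply_times apply_swap)

lemma cycle_rotate:
  assumes "i \<noteq> j" "j \<noteq> k" "k \<noteq> i"
  shows "Perm.cycle [j, k, i] = Perm.cycle [i, j, k]"
  using assms apply_cycle[of j k i] apply_cycle[of i j k] by (auto intro!: perm_eqI simp del: cycle.simps)

lemma three_rotate: "three g j k i = three g i j k"
  unfolding three_def using cycle_rotate[of i j k] by (auto simp del: cycle.simps)

lemma sum_rotate: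
  fixes F :: "'n::finite \<Rightarrow> 'n \<Rightarrow> 'n \<Rightarrow> 'c::comm_monoid_add"
  shows "(\<Sum>i\<in>UNIV. \<Sum>j\<in>UNIV. \<Sum>k\<in>UNIV. F j k i) = (\<Sum>i\<in>UNIV. \<Sum>j\<in>UNIV. \<Sum>k\<in>UNIV. F i j k)"
proof -
  have "(\<Sum>i\<in>UNIV. \<Sum>j\<in>UNIV. \<Sum>k\<in>UNIV. F j k i) = (\<Sum>j\<in>UNIV. \<Sum>i\<in>UNIV. \<Sum>k\<in>UNIV. F j k i)"
    by (rule sum.swap)
  also have "\<dots> = (\<Sum>j\<in>UNIV. \<Sum>k\<in>UNIV. \<Sum>i\<in>UNIV. F j k i)"
    by (intro sum.cong refl sum.swap)
  finally show ?thesis .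
qed

lemma three_sum_rotate:
  fixes F :: "'n::finite \<Rightarrow> 'n \<Rightarrow> 'n \<Rightarrow> complex"
  shows "(\<Sum>i\<in>UNIV. \<Sum>j\<in>UNIV. \<Sum>k\<in>UNIV. three g i j k * F j k i) =
         (\<Sum>i\<in>UNIV. \<Sum>j\<in>UNIV. \<Sum>k\<in>UNIV. three g i j k * F i j k)"
  using sum_rotate[of "\<lambda>i j k. three g i j k * F i j k"] by (simp only: three_rotate)

text \<open>
  Since the indicator is invariant under rotation, a sum over triples only depends on the
  rotation-symmetric part of the summand.
\<close>

lemma three_sum_zero:
  fixes F :: "'n::finite \<Rightarrow> 'n \<Rightarrow> 'n \<Rightarrow> complex"
  assumes "\<And>i j k. i \<noteq> j \<Longrightarrow> j \<noteq> k \<Longrightarrow> k \<noteq> i \<Longrightarrow> g = Perm.cycle [i, j, k] \<Longrightarrow>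
    F i j k + F j k i + F k i j = 0"
  shows "(\<Sum>i\<in>UNIV. \<Sum>j\<in>UNIV. \<Sum>k\<in>UNIV. three g i j k * F i j k) = 0" (is "?S F = 0")
proof -
  have 1: "?S (\<lambda>i j k. F j k i) = ?S F" by (rule three_sum_rotate)
  have 2: "?S (\<lambda>i j k. F k i j) = ?S F"
    using three_sum_rotate[of g "\<lambda>i j k. F j k i"] 1 by simp
  have "three g i j k * (F i j k + F j k i + F k i j) = 0" for i j k
    using assms[of i j k] by (cases "three g i j k = 0") (auto simp: three_def simp del: cycle.simps)
  then have "?S (\<lambda>i j k. F i j k + F j k i + F k i j) = 0" by (simp only: sum.neutral_const)
  moreover have "?S (\<lambda>i j k. F i j k + F j k i + F k i j) =
      ?S F + ?S (\<lambda>i j k. F j k i) + ?S (\<lambda>i j k. F k i j)"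
    by (simp only: distrib_left sum.distrib)
  ultimately have "3 * ?S F = 0" using 1 2 by simp
  then show ?thesis by simp
qed

lemma bilinear_expansion:
  fixes F :: "complex ^ 'm::finite \<Rightarrow> complex ^ 'm \<Rightarrow> complex"
  assumes "\<And>u u' v. F (u + u') v = F u v + F u' v" "\<And>s u v. F (s *s u) v = s * F u v"
    and "\<And>u v v'. F u (v + v') = F u v + F u v'" "\<And>s u v. F u (s *s v) = s * F u v"
  shows "F u v = (\<Sum>p\<in>UNIV. \<Sum>q\<in>UNIV. (u $ p * v $ q) * F (axis p 1) (axis q 1))"
proof -
  have z: "F 0 v = 0" "F v 0 = 0" for v using assms(2)[of 0 0 v] assms(4)[of v 0 0] by simp_all
  have 1: "F (\<Sum>p\<in>A. (u $ p) *s axis p 1) v = (\<Sum>p\<in>A. u $ p * F (axis p 1) v)" for A v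
    by (induction A rule: infinite_finite_induct) (simp_all add: assms z)
  have 2: "F w (\<Sum>q\<in>A. (v $ q) *s axis q 1) = (\<Sum>q\<in>A. v $ q * F w (axis q 1))" for A w
    by (induction A rule: infinite_finite_induct) (simp_all add: assms z)
  show ?thesis
    using 1[of UNIV v] 2[of _ UNIV] unfolding basis_expansion by (simp add: sum_distrib_left mult.assoc)
qed

lemma sum_if_const:
  "(\<Sum>l\<in>A. if P then X l else (0 :: 'c::comm_monoid_add)) = (if P then \<Sum>l\<in>A. X l else 0)"
  by simp

text \<open>
  The evaluation of \<open>om k l x\<^sub>i y\<^sub>j\<close>, summed over all \<open>k\<close> and \<open>l\<close> against a symmetric weight: for
  \<open>i = j\<close> the pairs containing \<open>i\<close> remain, otherwise only the pair of \<open>i\<close> and \<open>j\<close>, with a negative sign.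
\<close>

lemma delta_pairs:
  fixes T :: "'n::finite \<Rightarrow> 'n \<Rightarrow> complex"
  assumes "\<And>k l. T l k = T k l"
  shows "(\<Sum>k\<in>UNIV. \<Sum>l\<in>UNIV. (of_bool (k = i) - of_bool (l = i)) * (of_bool (k = j) - of_bool (l = j)) * T k l) =
    2 * (of_bool (i = j) * (\<Sum>l\<in>UNIV. T i l) - T i j)"
proof -
  have "(of_bool (k = i) - of_bool (l = i)) * (of_bool (k = j) - of_bool (l = j)) * T k l =
     (if k = i then of_bool (i = j) * T i l else 0) - (if k = i then if l = j then T i j else 0 else 0)
     - (if k = j then if l = i then T j i else 0 else 0) + (if l = i then of_bool (i = j) * T k i else 0)" for k l
    by auto
  note expand = this
  have "(\<Sum>k\<in>UNIV. \<Sum>l\<in>UNIV. (of_bool (k = i) - of_bool (l = i)) * (of_bool (k = j) - of_bool (l = j)) * T k l) =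
    (\<Sum>l\<in>UNIV. of_bool (i = j) * T i l) - T i j - T j i + (\<Sum>k\<in>UNIV. of_bool (i = j) * T k i)"
    unfolding expand sum.distrib sum_subtractf sum_if_const by (simp only: sum.delta finite UNIV_I if_True)
  then show ?thesis using assms by (simp add: sum_distrib_left)
qed

lemma om_axis:
  "om k l (axis (Inl i) 1) (axis (Inl j) 1) = 0" "om k l (axis (Inr i) 1) (axis (Inr j) 1) = 0"
  "om k l (axis (Inl i) 1) (axis (Inr j) 1) =
     (of_bool (k = i) - of_bool (l = i)) * (of_bool (k = j) - of_bool (l = j))"
  "om k l (axis (Inr j) 1) (axis (Inl i) 1) =
     - ((of_bool (k = i) - of_bool (l = i)) * (of_bool (k = j) - of_bool (l = j)))"
  by (auto simp: om_def axis_def)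

lemma kappa_vec_nth:
  "kappa_vec a a' b b' i j $ Inl m = (a - a') * (of_bool (m = i) + of_bool (m = j)) + a'"
  "kappa_vec a a' b b' i j $ Inr m = (b - b') * (of_bool (m = i) + of_bool (m = j)) + b'"
  by (auto simp: kappa_vec_def x_vec_def y_vec_def axis_def)

lemma kappa_vec_sym: "kappa_vec a a' b b' j i = kappa_vec a a' b b' i j"
  by (simp add: kappa_vec_def add.commute)

lemma delta_pairs_swap:
  fixes \<mu> :: "'n::finite \<Rightarrow> 'n \<Rightarrow> complex"
  assumes "\<And>k l. \<mu> l k = \<mu> k l"
  shows "(1/2) * (\<Sum>k\<in>UNIV. \<Sum>l\<in>UNIV. of_bool (g = Perm.swap k l) *
      ((of_bool (k = i) - of_bool (l = i)) * (of_bool (k = j) - of_bool (l = j))) * \<mu> k l) =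
    (if i = j then \<Sum>l\<in>- {i}. of_bool (g = Perm.swap i l) * \<mu> i l
     else - (of_bool (g = Perm.swap i j) * \<mu> i j))"
proof -
  let ?T = "\<lambda>k l. of_bool (g = Perm.swap k l) * \<mu> k l"
  have "(\<Sum>k\<in>UNIV. \<Sum>l\<in>UNIV. of_bool (g = Perm.swap k l) *
      ((of_bool (k = i) - of_bool (l = i)) * (of_bool (k = j) - of_bool (l = j))) * \<mu> k l) =
      2 * (of_bool (i = j) * (\<Sum>l\<in>UNIV. ?T i l) - ?T i j)"
    using delta_pairs[of ?T i j] assms by (simp add: swap_sym mult_ac)
  note lhs = this
  define A where "A = (\<Sum>l\<in>UNIV. ?T i l)"
  define A' where "A' = (\<Sum>l\<in>- {i}. ?T i l)"
  define t where "t = ?T i j"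
  have "A = ?T i i + A'"
    unfolding A_def A'_def Compl_eq_Diff_UNIV by (rule sum.remove) simp_all
  then show ?thesis
    unfolding lhs unfolding A_def[symmetric] A'_def[symmetric] unfolding t_def[symmetric]
    by (cases "i = j") (simp_all add: t_def)
qed

text \<open>
  The factor \<open>1/2\<close> compensates for \<open>(ij) = (ji)\<close>; terms with \<open>i = j\<close> vanish with \<open>om\<close>.
\<close>

lemma kappaL_nth:
  "kappaL a a' b b' g u v $ p =
     (1/2) * (\<Sum>i\<in>UNIV. \<Sum>j\<in>UNIV. of_bool (g = Perm.swap i j) * om i j u v * kappa_vec a a' b b' i j $ p)"
  (is "_ = ?F u v")
proof -
  have expand: "?F u v = (\<Sum>r\<in>UNIV. \<Sum>q\<in>UNIV. (u $ r * v $ q) * ?F (axis r 1) (axis q 1))"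
    by (rule bilinear_expansion)
       (simp_all add: om_bilinear algebra_simps sum.distrib sum_distrib_left)
  have basis: "?F (axis r 1) (axis q 1) = kappaL_basis a a' b b' r q g $ p" for r q
  proof -
    note swap = delta_pairs_swap[of "\<lambda>i j. kappa_vec a a' b b' i j $ p" g, OF arg_cong[OF kappa_vec_sym]]
    show ?thesis
      using swap
      by (cases r; cases q)
         (auto simp: om_axis kappaL_xy_def sum_negf)
  qed
  have lhs: "kappaL a a' b b' g u v $ p = (\<Sum>r\<in>UNIV. \<Sum>q\<in>UNIV. (u $ r * v $ q) * kappaL_basis a a' b b' r q g $ p)"
    by (simp add: kappaL_def)
  show ?thesis unfolding lhs expand basis ..
qed

text \<open>
  The linear forms out of which the 3-cycle components of \<open>\<kappa>\<^sup>C\<close> are built: \<open>x\<^sub>i\<close> is sent to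
  \<open>- (b - b')\<close> and \<open>y\<^sub>i\<close> to \<open>a - a'\<close>, both placed at the index \<open>i\<close>.  The forms arise as
  contractions of \<open>om\<close> with \<open>kappa_vec\<close>, see \<open>om_kappa_vec\<close>.
\<close>

definition sharp :: "complex \<Rightarrow> complex \<Rightarrow> complex \<Rightarrow> complex \<Rightarrow> complex ^ ('n::finite + 'n) \<Rightarrow> 'n \<Rightarrow> complex"
  where "sharp a a' b b' u i = (a - a') * u $ Inr i - (b - b') * u $ Inl i"

text \<open>
  The invariant skew form on \<open>V\<close> with value \<open>\<alpha>\<close> on \<open>(x\<^sub>i, y\<^sub>i)\<close> and \<open>\<beta>\<close> on \<open>(x\<^sub>i, y\<^sub>j)\<close> for
  \<open>i \<noteq> j\<close>; it is the component of \<open>\<kappa>\<^sup>C\<close> at the identity.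
\<close>

definition invform :: "complex \<Rightarrow> complex \<Rightarrow> complex ^ ('n::finite + 'n) \<Rightarrow> complex ^ ('n + 'n) \<Rightarrow> complex"
  where "invform \<alpha> \<beta> u v =
    (\<alpha> - \<beta>) * (\<Sum>i\<in>UNIV. u $ Inl i * v $ Inr i - u $ Inr i * v $ Inl i) +
    \<beta> * ((\<Sum>i\<in>UNIV. u $ Inl i) * (\<Sum>i\<in>UNIV. v $ Inr i) - (\<Sum>i\<in>UNIV. u $ Inr i) * (\<Sum>i\<in>UNIV. v $ Inl i))"

definition three_form ::
    "complex \<Rightarrow> complex \<Rightarrow> complex \<Rightarrow> complex \<Rightarrow> 'n::finite perm \<Rightarrow>
     complex ^ ('n + 'n) \<Rightarrow> complex ^ ('n + 'n) \<Rightarrow> complex"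
  where "three_form a a' b b' g u v = (\<Sum>i\<in>UNIV. \<Sum>j\<in>UNIV. \<Sum>k\<in>UNIV. three g i j k *
     (sharp a a' b b' u i * sharp a a' b b' v j - sharp a a' b b' u j * sharp a a' b b' v i))"

lemma sharp_linear:
  "sharp a a' b b' (u + v) i = sharp a a' b b' u i + sharp a a' b b' v i"
  "sharp a a' b b' (s *s u) i = s * sharp a a' b b' u i"
  by (simp_all add: sharp_def algebra_simps)

lemma sharp_axis:
  "sharp a a' b b' (axis (Inl i) 1) r = - (b - b') * of_bool (r = i)"
  "sharp a a' b b' (axis (Inr i) 1) r = (a - a') * of_bool (r = i)"
  by (auto simp: sharp_def axis_def)

lemma invform_bilinear:
  fixes u u' v v' :: "complex ^ ('b::finite + 'b)"
  shows "invform \<alpha> \<beta> (u + u') v = invform \<alpha> \<beta> u v + invform \<alpha> \<beta> u' v"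
  "invform \<alpha> \<beta> (s *s u) v = s * invform \<alpha> \<beta> u v"
  "invform \<alpha> \<beta> u (v + v') = invform \<alpha> \<beta> u v + invform \<alpha> \<beta> u v'"
  "invform \<alpha> \<beta> u (s *s v) = s * invform \<alpha> \<beta> u v"
proof -
  have scale: "(\<Sum>i\<in>UNIV. (s *s u) $ f i) = s * (\<Sum>i\<in>UNIV. u $ f i)" for f :: "'b \<Rightarrow> 'b + 'b" and u
    by (simp add: sum_distrib_left)
  have pair: "(\<Sum>i\<in>UNIV. (s *s u) $ Inl i * v $ Inr i - (s *s u) $ Inr i * v $ Inl i) =
      s * (\<Sum>i\<in>UNIV. u $ Inl i * v $ Inr i - u $ Inr i * v $ Inl i)"
    "(\<Sum>i\<in>UNIV. u $ Inl i * (s *s v) $ Inr i - u $ Inr i * (s *s v) $ Inl i) =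
      s * (\<Sum>i\<in>UNIV. u $ Inl i * v $ Inr i - u $ Inr i * v $ Inl i)" for u v :: "complex ^ ('b + 'b)"
    by (simp_all add: sum_distrib_left algebra_simps)
  show "invform \<alpha> \<beta> (s *s u) v = s * invform \<alpha> \<beta> u v" "invform \<alpha> \<beta> u (s *s v) = s * invform \<alpha> \<beta> u v"
    unfolding invform_def scale pair by (simp_all add: algebra_simps)
qed (simp_all add: invform_def algebra_simps sum.distrib sum_subtractf)

lemma invform_skew: "invform \<alpha> \<beta> u v = - invform \<alpha> \<beta> v u"
  by (simp add: invform_def algebra_simps sum_subtractf)

lemma invform_axis:
  "invform \<alpha> \<beta> (axis (Inl i) 1) (axis (Inl j) 1) = 0"
  "invform \<alpha> \<beta> (axis (Inr i) 1) (axis (Inr j) 1) = 0"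
  "invform \<alpha> \<beta> (axis (Inl i) 1) (axis (Inr j) 1) = (if i = j then \<alpha> else \<beta>)"
  "invform \<alpha> \<beta> (axis (Inr j) 1) (axis (Inl i) 1) = - (if i = j then \<alpha> else \<beta>)"
  by (auto simp: invform_def axis_def if_distrib[of "\<lambda>x. x * _"] if_distrib[of "\<lambda>x. _ * x"] sum_negf cong: if_cong)

lemma three_form_bilinear:
  "three_form a a' b b' g (u + u') v = three_form a a' b b' g u v + three_form a a' b b' g u' v"
  "three_form a a' b b' g (s *s u) v = s * three_form a a' b b' g u v"
  "three_form a a' b b' g u (v + v') = three_form a a' b b' g u v + three_form a a' b b' g u v'"
  "three_form a a' b b' g u (s *s v) = s * three_form a a' b b' g u v"
  by (simp_all add: three_form_def sharp_linear algebra_simps sum.distrib sum_subtractf sum_distrib_left)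

lemma three_form_skew: "three_form a a' b b' g u v = - three_form a a' b b' g v u"
  by (simp add: three_form_def sum_negf[symmetric] algebra_simps)

lemma three_cycles_three:
  "(\<Sum>k\<in>UNIV. three g i j k) - (\<Sum>k\<in>UNIV. three g j i k) = (if i = j then 0 else three_cycles i j g)"
proof (cases "i = j")
  case False
  have "(\<Sum>k\<in>UNIV. three g i j k) - (\<Sum>k\<in>UNIV. three g j i k) = (\<Sum>k\<in>UNIV. three g i j k - three g j i k)"
    by (simp add: sum_subtractf)
  also have "\<dots> = (\<Sum>k\<in>- {i, j}. three g i j k - three g j i k)"
    by (rule sum.mono_neutral_right) (auto simp: three_def)
  also have "\<dots> = three_cycles i j g"
    unfolding three_cycles_def
  proof (intro sum.cong refl)
    fix k assume "k \<in> - {i, j}"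
    then have k: "k \<noteq> i" "k \<noteq> j" "i \<noteq> k" "j \<noteq> k" "j \<noteq> i" using False by auto
    have "Perm.cycle [j, i, k] = Perm.cycle [k, j, i]"
      by (rule cycle_rotate) (use k in simp_all)
    then show "three g i j k - three g j i k =
        of_bool (g = Perm.cycle [i, j, k]) - of_bool (g = Perm.cycle [k, j, i])"
      using k False by (simp only: three_def simp_thms)
  qed
  finally show ?thesis using False by simp
qed simp

lemma three_delta:
  "(\<Sum>r\<in>UNIV. \<Sum>s\<in>UNIV. \<Sum>t\<in>UNIV. three g r s t *
      (x * of_bool (r = i) * (y * of_bool (s = j)) - x * of_bool (s = i) * (y * of_bool (r = j)))) =
    x * y * (if i = j then 0 else three_cycles i j g)"
proof -
  have 1: "(\<Sum>r\<in>UNIV. \<Sum>s\<in>UNIV. \<Sum>t\<in>UNIV. if r = i then if s = j then x * y * three g r s t else 0 else 0) =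
      (\<Sum>t\<in>UNIV. x * y * three g i j t)" for i j
    unfolding sum_if_const by (simp only: sum.delta finite UNIV_I if_True)
  have "(\<Sum>r\<in>UNIV. \<Sum>s\<in>UNIV. \<Sum>t\<in>UNIV. three g r s t *
      (x * of_bool (r = i) * (y * of_bool (s = j)) - x * of_bool (s = i) * (y * of_bool (r = j)))) =
      (\<Sum>r\<in>UNIV. \<Sum>s\<in>UNIV. \<Sum>t\<in>UNIV. (if r = i then if s = j then x * y * three g r s t else 0 else 0) -
        (if r = j then if s = i then x * y * three g r s t else 0 else 0))"
    by (intro sum.cong refl) auto
  also have "\<dots> = x * y * ((\<Sum>t\<in>UNIV. three g i j t) - (\<Sum>t\<in>UNIV. three g j i t))"
    by (simp only: sum_subtractf 1 sum_distrib_left right_diff_distrib)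
  finally show ?thesis by (simp only: three_cycles_three)
qed

lemma kappaC_formula:
  "kappaC a a' b b' c \<alpha> \<beta> g u v = of_bool (g = 1) * invform \<alpha> \<beta> u v +
     (1/2) * (\<Sum>i\<in>UNIV. \<Sum>j\<in>UNIV. of_bool (g = Perm.swap i j) * om i j u v * c) +
     three_form a a' b b' g u v"
  (is "_ = ?F u v")
proof -
  have "?F u v = (\<Sum>r\<in>UNIV. \<Sum>q\<in>UNIV. (u $ r * v $ q) * ?F (axis r 1) (axis q 1))"
    by (rule bilinear_expansion)
       (simp_all add: om_bilinear invform_bilinear three_form_bilinear algebra_simps sum.distrib sum_distrib_left)
  moreover have "?F (axis r 1) (axis q 1) = kappaC_basis a a' b b' c \<alpha> \<beta> r q g" for r q
  proof -
    note swap = delta_pairs_swap[of "\<lambda>i j. c" g, OF refl]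
    have xx: "three_form a a' b b' g (axis (Inl i) 1) (axis (Inl j) 1) = (b - b')\<^sup>2 * (if i = j then 0 else three_cycles i j g)"
      and yy: "three_form a a' b b' g (axis (Inr i) 1) (axis (Inr j) 1) = (a - a')\<^sup>2 * (if i = j then 0 else three_cycles i j g)"
      and xy: "three_form a a' b b' g (axis (Inl i) 1) (axis (Inr j) 1) =
        - (a - a') * (b - b') * (if i = j then 0 else three_cycles i j g)" for i j
      using three_delta[of g "- (b - b')" i "- (b - b')" j] three_delta[of g "a - a'" i "a - a'" j]
        three_delta[of g "- (b - b')" i "a - a'" j]
      unfolding three_form_def sharp_axis by (simp_all add: power2_eq_square algebra_simps)
    have yx: "three_form a a' b b' g (axis (Inr j) 1) (axis (Inl i) 1) =
        (a - a') * (b - b') * (if i = j then 0 else three_cycles i j g)" for i j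
      using three_form_skew[of a a' b b' g "axis (Inr j) 1" "axis (Inl i) 1"] unfolding xy
      by (cases "i = j") (simp_all add: algebra_simps)
    show ?thesis
    proof (cases r; cases q)
      fix i j assume "r = Inl i" "q = Inl j"
      then show ?thesis by (simp add: om_axis invform_axis xx)
    next
      fix i j assume "r = Inr i" "q = Inr j"
      then show ?thesis by (simp add: om_axis invform_axis yy)
    next
      fix i j assume r: "r = Inl i" "q = Inr j"
      show ?thesis
        unfolding r om_axis swap invform_axis xy
        by (cases "i = j") (simp_all add: kappaC_xy_def sum_distrib_left algebra_simps)
    next
      fix j i assume r: "r = Inr j" "q = Inl i"
      have "(1/2) * (\<Sum>k\<in>UNIV. \<Sum>l\<in>UNIV. of_bool (g = Perm.swap k l) * om k l (axis (Inr j) 1) (axis (Inl i) 1) * c) =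
        - (if i = j then \<Sum>l\<in>- {i}. of_bool (g = Perm.swap i l) * c else - (of_bool (g = Perm.swap i j) * c))"
        unfolding swap[symmetric] om_axis by (simp add: sum_negf)
      then show ?thesis
        unfolding r invform_axis yx
        by (cases "i = j") (simp_all add: kappaC_xy_def sum_distrib_left algebra_simps)
    qed
  qed
  ultimately show ?thesis by (simp add: kappaC_def)
qed

lemma linearI:
  assumes "\<And>u v. f (u + v) = f u + f v" "\<And>s u. f (s *s u) = s *s f u"
  shows "Vector_Spaces.linear (*s) (*s) (f :: complex ^ 'm \<Rightarrow> complex ^ 'm)"
  unfolding Vector_Spaces.linear_def module_hom_def module_hom_axioms_def
  using assms by (auto simp: vec.vector_space_axioms vec.module_axioms)

lemma linear_functionalI:
  assumes "\<And>u v. f (u + v) = f u + f v" "\<And>s u. f (s *s u) = s * f u"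
  shows "Vector_Spaces.linear (*s) (*) (f :: complex ^ 'm \<Rightarrow> complex)"
  by unfold_locales (simp_all add: assms algebra_simps)

lemma cochain_pair_kappa: "cochain_pair (kappaL a a' b b') (kappaC a a' b b' c \<alpha> \<beta>)"
proof
  have skewL: "kappaL a a' b b' g u v = - kappaL a a' b b' g v u" for g u v
    by (simp add: vec_eq_iff kappaL_nth om_skew[of _ _ u v] sum_negf)
  have skewC: "kappaC a a' b b' c \<alpha> \<beta> g u v = - kappaC a a' b b' c \<alpha> \<beta> g v u" for g u v
    by (simp add: kappaC_formula om_skew[of _ _ u v] invform_skew[of _ _ u v] three_form_skew[of _ _ _ _ _ u v] sum_negf)
  show "linear_cochain (kappaL a a' b b')"
    unfolding linear_cochain_def skew_bilinear_def
    by (intro allI conjI linearI skewL)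
       (simp_all add: vec_eq_iff kappaL_nth om_bilinear algebra_simps sum.distrib sum_distrib_left)
  show "constant_cochain (kappaC a a' b b' c \<alpha> \<beta>)"
    unfolding constant_cochain_def skew_bilinear_def
    by (intro allI conjI linear_functionalI skewC)
       (simp_all add: kappaC_formula om_bilinear invform_bilinear three_form_bilinear algebra_simps sum.distrib sum_distrib_left)
qed

section \<open>The explicit cochains satisfy the PBW conditions\<close>

lemma conj_swap: "g * Perm.swap i j * inverse g = Perm.swap (Perm.apply g i) (Perm.apply g j)"
proof (rule perm_eqI)
  fix m
  have inv: "Perm.apply (inverse g) m = k \<longleftrightarrow> m = Perm.apply g k" for k
    by (metis apply_sequence perm.left_inverse perm.right_inverse apply_one id_apply)
  show "Perm.apply (g * Perm.swap i j * inverse g) m = Perm.apply (Perm.swap (Perm.apply g i) (Perm.apply g j)) m"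
    by (auto simp: apply_times apply_swap inv) (metis inv)
qed

lemma conj_eq_iff: "g * h * inverse g = g * k * inverse g \<longleftrightarrow> h = (k :: 'a perm)"
proof
  assume "g * h * inverse g = g * k * inverse g"
  then have "inverse g * (g * h * inverse g) * g = inverse g * (g * k * inverse g) * g" by simp
  then show "h = k" by (simp add: mult.assoc)
qed simp

lemma conj_swap_eq:
  "g * h * inverse g = Perm.swap (Perm.apply g i) (Perm.apply g j) \<longleftrightarrow> h = Perm.swap i j"
  by (simp only: conj_swap[symmetric] conj_eq_iff)

lemma conj_cycle:
  "g * Perm.cycle [i, j, k] * inverse g = Perm.cycle [Perm.apply g i, Perm.apply g j, Perm.apply g k]"
proof -
  have "g * Perm.cycle [i, j, k] * inverse g =
      (g * Perm.swap i k * inverse g) * (g * Perm.swap i j * inverse g)"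
    by (simp add: mult.assoc)
  then show ?thesis by (simp add: conj_swap)
qed

lemma three_conj: "three (g * h * inverse g) (Perm.apply g i) (Perm.apply g j) (Perm.apply g k) = three h i j k"
  unfolding three_def conj_cycle[symmetric] conj_eq_iff by (simp only: apply_inj)

lemma lact_simps [simp]: "lact g (Inl i) = Inl (Perm.apply g i)" "lact g (Inr i) = Inr (Perm.apply g i)"
  by (simp_all add: lact_def)

lemma apply_inverse_apply [simp]:
  "Perm.apply (inverse g) (Perm.apply g i) = i" "Perm.apply g (Perm.apply (inverse g) i) = i"
  by (metis apply_sequence perm.left_inverse apply_one id_apply)
     (metis apply_sequence perm.right_inverse apply_one id_apply)

lemma sum_perm: "(\<Sum>i\<in>UNIV. F (Perm.apply g i)) = (\<Sum>i\<in>UNIV. F i)" for g :: "'n::finite perm"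
  by (rule sum.reindex_bij_witness[of _ "Perm.apply (inverse g)" "Perm.apply g"]) auto

lemma om_perm:
  "om (Perm.apply g i) (Perm.apply g j) (doubled_perm_rep g u) (doubled_perm_rep g v) = om i j u v"
  by (simp add: om_def)

lemma sharp_perm: "sharp a a' b b' (doubled_perm_rep g u) (Perm.apply g i) = sharp a a' b b' u i"
  by (simp add: sharp_def)

lemma kappa_vec_perm:
  "kappa_vec a a' b b' (Perm.apply g i) (Perm.apply g j) = doubled_perm_rep g (kappa_vec a a' b b' i j)"
proof -
  have "Perm.apply (inverse g) m = k \<longleftrightarrow> m = Perm.apply g k" for m k
    by (metis apply_inverse_apply)
  then have "kappa_vec a a' b b' (Perm.apply g i) (Perm.apply g j) $ p =
      doubled_perm_rep g (kappa_vec a a' b b' i j) $ p" for p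
    by (cases p) (simp_all add: kappa_vec_nth)
  then show ?thesis by (simp add: vec_eq_iff)
qed

lemma invform_perm: "invform \<alpha> \<beta> (doubled_perm_rep g u) (doubled_perm_rep g v) = invform \<alpha> \<beta> u v"
  using sum_perm[of "\<lambda>i. u $ Inl i" "inverse g"] sum_perm[of "\<lambda>i. u $ Inr i" "inverse g"]
    sum_perm[of "\<lambda>i. v $ Inl i" "inverse g"] sum_perm[of "\<lambda>i. v $ Inr i" "inverse g"]
    sum_perm[of "\<lambda>i. u $ Inl i * v $ Inr i - u $ Inr i * v $ Inl i" "inverse g"]
  by (simp add: invform_def)

lemma sum_perm2:
  "(\<Sum>i\<in>UNIV. \<Sum>j\<in>UNIV. F (Perm.apply g i) (Perm.apply g j)) = (\<Sum>i\<in>UNIV. \<Sum>j\<in>UNIV. F i j)"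
  for g :: "'n::finite perm"
  using sum_perm[of "\<lambda>i. \<Sum>j\<in>UNIV. F i j" g] sum_perm[of "F _" g] by simp

lemma sum_perm3:
  "(\<Sum>i\<in>UNIV. \<Sum>j\<in>UNIV. \<Sum>k\<in>UNIV. F (Perm.apply g i) (Perm.apply g j) (Perm.apply g k)) =
   (\<Sum>i\<in>UNIV. \<Sum>j\<in>UNIV. \<Sum>k\<in>UNIV. F i j k)" for g :: "'n::finite perm"
  using sum_perm2[of "\<lambda>i j. \<Sum>k\<in>UNIV. F i j k" g] sum_perm[of "F _ _" g] by simp

lemma kappa_invariant:
  "cochain_pair.invariant (kappaL a a' b b' :: 'n::finite perm \<Rightarrow> _) (kappaC a a' b b' c \<alpha> \<beta>)"
proof -
  have "kappaL a a' b b' (g * h * inverse g) (doubled_perm_rep g u) (doubled_perm_rep g v) $ p =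
      doubled_perm_rep g (kappaL a a' b b' h u v) $ p" for g h :: "'n perm" and u v p
    using sum_perm2[of "\<lambda>i j. of_bool (g * h * inverse g = Perm.swap i j) *
      om i j (doubled_perm_rep g u) (doubled_perm_rep g v) * kappa_vec a a' b b' i j $ p" g]
    by (simp add: kappaL_nth conj_swap_eq om_perm kappa_vec_perm)
  moreover have "kappaC a a' b b' c \<alpha> \<beta> (g * h * inverse g) (doubled_perm_rep g u) (doubled_perm_rep g v) =
      kappaC a a' b b' c \<alpha> \<beta> h u v" for g h :: "'n perm" and u v
  proof -
    have "g * h * inverse g = 1 \<longleftrightarrow> h = 1" using conj_eq_iff[of g h 1] by simp
    moreover have "three_form a a' b b' (g * h * inverse g) (doubled_perm_rep g u) (doubled_perm_rep g v) =
        three_form a a' b b' h u v"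
      unfolding three_form_def
      by (subst sum_perm3[of _ g, symmetric]) (simp only: three_conj sharp_perm)
    ultimately show ?thesis
      using sum_perm2[of "\<lambda>i j. of_bool (g * h * inverse g = Perm.swap i j) *
        om i j (doubled_perm_rep g u) (doubled_perm_rep g v) * c" g]
      by (simp add: kappaC_formula conj_swap_eq om_perm invform_perm)
  qed
  ultimately show ?thesis
    unfolding cochain_pair.invariant_def[OF cochain_pair_kappa] by (simp only: vec_eq_iff simp_thms)
qed

lemma linear_kappaL:
  fixes \<Phi> :: "complex ^ ('n::finite + 'n) \<Rightarrow> complex"
  assumes add: "\<And>x y. \<Phi> (x + y) = \<Phi> x + \<Phi> y" and scale: "\<And>s x. \<Phi> (s *s x) = s * \<Phi> x"
  shows "\<Phi> (kappaL a a' b b' g u v) =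
    (1/2) * (\<Sum>i\<in>UNIV. \<Sum>j\<in>UNIV. of_bool (g = Perm.swap i j) * om i j u v * \<Phi> (kappa_vec a a' b b' i j))"
proof -
  have z: "\<Phi> 0 = 0" using scale[of 0 0] by simp
  have sum: "\<Phi> (sum F A) = (\<Sum>x\<in>A. \<Phi> (F x))" for F and A :: "'n set"
    by (induction A rule: infinite_finite_induct) (simp_all add: z add)
  have "kappaL a a' b b' g u v =
      (1/2) *s (\<Sum>i\<in>UNIV. \<Sum>j\<in>UNIV. (of_bool (g = Perm.swap i j) * om i j u v) *s kappa_vec a a' b b' i j)"
    by (simp add: vec_eq_iff kappaL_nth)
  then show ?thesis by (simp add: scale sum)
qed

lemma sum_over_swaps:
  fixes \<Psi> :: "'n::finite perm \<Rightarrow> 'n \<Rightarrow> 'n \<Rightarrow> complex"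
  shows "(\<Sum>g\<in>UNIV. \<Sum>i\<in>UNIV. \<Sum>j\<in>UNIV. of_bool (g = s i j) * \<Psi> g i j) = (\<Sum>i\<in>UNIV. \<Sum>j\<in>UNIV. \<Psi> (s i j) i j)"
proof -
  have "(\<Sum>g\<in>UNIV. \<Sum>i\<in>UNIV. \<Sum>j\<in>UNIV. of_bool (g = s i j) * \<Psi> g i j) =
      (\<Sum>i\<in>UNIV. \<Sum>g\<in>UNIV. \<Sum>j\<in>UNIV. of_bool (g = s i j) * \<Psi> g i j)"
    by (rule sum.swap)
  also have "\<dots> = (\<Sum>i\<in>UNIV. \<Sum>j\<in>UNIV. \<Sum>g\<in>UNIV. of_bool (g = s i j) * \<Psi> g i j)"
    by (intro sum.cong refl sum.swap)
  also have "\<dots> = (\<Sum>i\<in>UNIV. \<Sum>j\<in>UNIV. \<Sum>g\<in>UNIV. if g = s i j then \<Psi> g i j else 0)"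
    by (intro sum.cong refl) auto
  finally show ?thesis by (simp only: sum.delta finite UNIV_I if_True)
qed

lemma delta_antisym:
  fixes X :: "'n::finite \<Rightarrow> 'n \<Rightarrow> complex"
  assumes "\<And>k l. X l k = - X k l"
  shows "(\<Sum>k\<in>UNIV. \<Sum>l\<in>UNIV. (of_bool (k = i) + of_bool (k = j) - of_bool (l = i) - of_bool (l = j)) * X k l) =
    2 * ((\<Sum>l\<in>UNIV. X i l) + (\<Sum>l\<in>UNIV. X j l))"
proof -
  have *: "(of_bool (k = i) + of_bool (k = j) - of_bool (l = i) - of_bool (l = j)) * X k l =
      (if k = i then X i l else 0) + (if k = j then X j l else 0) -
      (if l = i then X k i else 0) - (if l = j then X k j else 0)" for k l
    by auto
  have "(\<Sum>k\<in>UNIV. \<Sum>l\<in>UNIV. (of_bool (k = i) + of_bool (k = j) - of_bool (l = i) - of_bool (l = j)) * X k l) =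
      (\<Sum>l\<in>UNIV. X i l) + (\<Sum>l\<in>UNIV. X j l) - (\<Sum>k\<in>UNIV. X k i) - (\<Sum>k\<in>UNIV. X k j)"
    unfolding * sum.distrib sum_subtractf sum_if_const by (simp only: sum.delta finite UNIV_I if_True)
  moreover have "(\<Sum>k\<in>UNIV. X k m) = - (\<Sum>k\<in>UNIV. X m k)" for m
    unfolding sum_negf[symmetric] by (intro sum.cong refl assms)
  ultimately show ?thesis by simp
qed

lemma om_kappa_vec:
  "om k l (kappa_vec a a' b b' i j) z =
     (of_bool (k = i) + of_bool (k = j) - of_bool (l = i) - of_bool (l = j)) *
     (sharp a a' b b' z k - sharp a a' b b' z l)"
  by (simp add: om_def kappa_vec_nth sharp_def algebra_simps)

text \<open>
  The composition of two transposition components, which occurs in the linear defect (with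
  \<open>\<mu>\<close> a coordinate of \<open>kappa_vec\<close>) and in the constant defect (with \<open>\<mu> = c\<close>).  The contraction of
  \<open>om k l\<close> with \<open>kappa_vec i j\<close> vanishes unless \<open>{k, l}\<close> meets \<open>{i, j}\<close> in exactly one index, so that only
  products \<open>(il)(ij) = (ijl)\<close> contribute.
\<close>

lemma swap_product:
  fixes u v w :: "complex ^ ('n::finite + 'n)" and \<mu> :: "'n \<Rightarrow> 'n \<Rightarrow> complex"
  assumes \<mu>: "\<And>k l. \<mu> l k = \<mu> k l"
  shows "(\<Sum>g\<in>UNIV. (1/2) * (\<Sum>k\<in>UNIV. \<Sum>l\<in>UNIV. of_bool (h * inverse g = Perm.swap k l) *
      om k l (kappaL a a' b b' g u v) (w + doubled_perm_rep g w) * \<mu> k l)) =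
    (\<Sum>i\<in>UNIV. \<Sum>j\<in>UNIV. \<Sum>l\<in>UNIV. three h i j l * (om i j u v *
      (sharp a a' b b' w i + sharp a a' b b' w j - 2 * sharp a a' b b' w l) * \<mu> i l))"
proof -
  let ?f = "sharp a a' b b'" and ?z = "\<lambda>g. w + doubled_perm_rep g w"
  define \<Phi> where "\<Phi> g x = (1/2) * (\<Sum>k\<in>UNIV. \<Sum>l\<in>UNIV. of_bool (h * inverse g = Perm.swap k l) *
      om k l x (?z g) * \<mu> k l)" for g x
  define X where "X i j k l = of_bool (h * Perm.swap i j = Perm.swap k l) *
      ((?f (?z (Perm.swap i j)) k - ?f (?z (Perm.swap i j)) l) * \<mu> k l)" for i j k l
  have \<Phi>_lin: "\<Phi> g (x + y) = \<Phi> g x + \<Phi> g y" "\<Phi> g (s *s x) = s * \<Phi> g x" for g x y s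
    by (simp_all add: \<Phi>_def om_bilinear algebra_simps sum.distrib sum_distrib_left)
  have \<Phi>_swap: "\<Phi> (Perm.swap i j) (kappa_vec a a' b b' i j) = (\<Sum>l\<in>UNIV. X i j i l) + (\<Sum>l\<in>UNIV. X i j j l)" for i j
  proof -
    have calc: "\<Phi> (Perm.swap i j) (kappa_vec a a' b b' i j) = (1/2) * (\<Sum>k\<in>UNIV. \<Sum>l\<in>UNIV.
        (of_bool (k = i) + of_bool (k = j) - of_bool (l = i) - of_bool (l = j)) * X i j k l)"
      unfolding \<Phi>_def X_def om_kappa_vec inverse_swap by (simp only: mult_ac)
    have anti: "X i j l k = - X i j k l" for k l
      using \<mu>[of k l] swap_sym[of k l] by (simp add: X_def algebra_simps)
    show ?thesis unfolding calc delta_antisym[OF anti] by simp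
  qed
  \<comment> \<open>the two ends of the transposition contribute equally, by the symmetry of \<open>om i j\<close>\<close>
  have X_sym: "X j i = X i j" for i j
    by (simp add: X_def fun_eq_iff swap_sym)
  have expand: "\<Phi> g (kappaL a a' b b' g u v) = (1/2) * (\<Sum>i\<in>UNIV. \<Sum>j\<in>UNIV.
      of_bool (g = Perm.swap i j) * om i j u v * \<Phi> g (kappa_vec a a' b b' i j))" for g
    by (rule linear_kappaL[OF \<Phi>_lin])
  have "(\<Sum>g\<in>UNIV. \<Phi> g (kappaL a a' b b' g u v)) =
      (1/2) * (\<Sum>g\<in>UNIV. \<Sum>i\<in>UNIV. \<Sum>j\<in>UNIV. of_bool (g = Perm.swap i j) * (om i j u v * \<Phi> g (kappa_vec a a' b b' i j)))"
    by (simp only: expand sum_distrib_left mult.assoc)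
  also have "\<dots> = (1/2) * (\<Sum>i\<in>UNIV. \<Sum>j\<in>UNIV. om i j u v * \<Phi> (Perm.swap i j) (kappa_vec a a' b b' i j))"
    by (simp only: sum_over_swaps)
  also have "\<dots> = (1/2) * ((\<Sum>i\<in>UNIV. \<Sum>j\<in>UNIV. om i j u v * (\<Sum>l\<in>UNIV. X i j i l)) +
      (\<Sum>i\<in>UNIV. \<Sum>j\<in>UNIV. om i j u v * (\<Sum>l\<in>UNIV. X i j j l)))"
    by (simp only: \<Phi>_swap distrib_left sum.distrib)
  also have "(\<Sum>i\<in>UNIV. \<Sum>j\<in>UNIV. om i j u v * (\<Sum>l\<in>UNIV. X i j j l)) =
      (\<Sum>i\<in>UNIV. \<Sum>j\<in>UNIV. om i j u v * (\<Sum>l\<in>UNIV. X i j i l))"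
    by (subst sum.swap) (simp only: X_sym om_sym)
  finally have "(\<Sum>g\<in>UNIV. \<Phi> g (kappaL a a' b b' g u v)) =
      (\<Sum>i\<in>UNIV. \<Sum>j\<in>UNIV. \<Sum>l\<in>UNIV. om i j u v * X i j i l)"
    by (simp add: sum_distrib_left)
  moreover have "om i j u v * X i j i l = three h i j l * (om i j u v * (?f w i + ?f w j - 2 * ?f w l) * \<mu> i l)" for i j l
  proof (cases "i = j \<or> l = i \<or> l = j")
    case True
    then show ?thesis
      by (auto simp: X_def three_def om_same sharp_def apply_swap add.commute)
  next
    case False
    then have d: "i \<noteq> j" "j \<noteq> l" "l \<noteq> i" "l \<noteq> j" by auto
    have "h * Perm.swap i j = Perm.swap i l \<longleftrightarrow> h = Perm.cycle [i, j, l]"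
    proof
      assume "h * Perm.swap i j = Perm.swap i l"
      then have "h * Perm.swap i j * Perm.swap i j = Perm.swap i l * Perm.swap i j" by simp
      then show "h = Perm.cycle [i, j, l]" by (simp add: mult.assoc)
    qed (simp add: mult.assoc)
    moreover have "?f (?z (Perm.swap i j)) i - ?f (?z (Perm.swap i j)) l = ?f w i + ?f w j - 2 * ?f w l"
      using d by (simp add: sharp_def apply_swap algebra_simps)
    ultimately show ?thesis using d by (simp add: X_def three_def mult_ac del: cycle.simps)
  qed
  ultimately show ?thesis unfolding \<Phi>_def by simp
qed

lemma swap_fixed_point:
  "doubled_perm_rep (Perm.swap i j) w = w \<longleftrightarrow> w $ Inl i = w $ Inl j \<and> w $ Inr i = w $ Inr j"
proof
  assume eq: "doubled_perm_rep (Perm.swap i j) w = w"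
  have "w $ Inl i = doubled_perm_rep (Perm.swap i j) w $ Inl i" "w $ Inr i = doubled_perm_rep (Perm.swap i j) w $ Inr i"
    by (simp_all only: eq)
  then show "w $ Inl i = w $ Inl j \<and> w $ Inr i = w $ Inr j" by simp
next
  assume *: "w $ Inl i = w $ Inl j \<and> w $ Inr i = w $ Inr j"
  have "doubled_perm_rep (Perm.swap i j) w $ p = w $ p" for p
    using * by (cases p) (auto simp: apply_swap)
  then show "doubled_perm_rep (Perm.swap i j) w = w" by (simp add: vec_eq_iff)
qed

text \<open>
  The displacement \<open>(ij) w - w\<close> only involves the coordinate differences of \<open>w\<close>, and the cyclic
  sum is the expansion of a 3 by 3 determinant of differences with two equal rows.
\<close>

lemma om_cocycle:
  "cyc (\<lambda>u v w. om i j u v * (doubled_perm_rep (Perm.swap i j) w - w) $ p) u v w = 0"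
proof (cases p)
  case (Inl m)
  then show ?thesis
    by (cases "m = i"; cases "m = j") (simp_all add: cyc_def om_def apply_swap algebra_simps)
next
  case (Inr m)
  then show ?thesis
    by (cases "m = i"; cases "m = j") (simp_all add: cyc_def om_def apply_swap algebra_simps)
qed

lemma swap_sum_cocycle:
  "cyc (\<lambda>u v w. (1/2) * (\<Sum>i\<in>UNIV. \<Sum>j\<in>UNIV. of_bool (h = Perm.swap i j) * om i j u v * M i j) *
     (doubled_perm_rep h w - w) $ p) u v w = 0"
proof -
  have "cyc (\<lambda>u v w. (1/2) * (\<Sum>i\<in>UNIV. \<Sum>j\<in>UNIV. of_bool (h = Perm.swap i j) * om i j u v * M i j) *
     (doubled_perm_rep h w - w) $ p) u v w =
    (\<Sum>i\<in>UNIV. \<Sum>j\<in>UNIV. (1/2) * of_bool (h = Perm.swap i j) * M i j *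
      cyc (\<lambda>u v w. om i j u v * (doubled_perm_rep h w - w) $ p) u v w)"
    by (simp only: cyc_def distrib_left sum.distrib sum_distrib_left sum_distrib_right mult_ac)
  also have "\<dots> = 0"
  proof (intro sum.neutral ballI)
    fix i j
    show "(1/2) * of_bool (h = Perm.swap i j) * M i j *
      cyc (\<lambda>u v w. om i j u v * (doubled_perm_rep h w - w) $ p) u v w = 0"
    proof (cases "h = Perm.swap i j")
      case True
      show ?thesis unfolding True om_cocycle by simp
    qed simp
  qed
  finally show ?thesis .
qed

lemma kappa_cocycle: "cochain_pair.cocycle_coeff (kappaL a a' b b') g u v w p q = 0"
proof -
  have "cochain_pair.cocycle_coeff (kappaL a a' b b') g u v w p q =
      cyc (\<lambda>u v w. kappaL a a' b b' g u v $ p * (doubled_perm_rep g w - w) $ q) u v w +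
      cyc (\<lambda>u v w. kappaL a a' b b' g u v $ q * (doubled_perm_rep g w - w) $ p) u v w"
    unfolding cochain_pair.cocycle_coeff_def[OF cochain_pair_kappa] cyc_def by (simp only: ac_simps)
  then show ?thesis unfolding kappaL_nth swap_sum_cocycle by simp
qed

text \<open>
  The cyclic sum over \<open>u, v, w\<close> of the summand in \<open>swap_product\<close> without its weight \<open>\<mu>\<close>.
\<close>

definition mean ::
    "complex \<Rightarrow> complex \<Rightarrow> complex \<Rightarrow> complex \<Rightarrow> 'n::finite \<Rightarrow> 'n \<Rightarrow> 'n \<Rightarrow>
     complex ^ ('n + 'n) \<Rightarrow> complex ^ ('n + 'n) \<Rightarrow> complex ^ ('n + 'n) \<Rightarrow> complex"
  where "mean a a' b b' i j l = cyc (\<lambda>u v w. om i j u v *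
    (sharp a a' b b' w i + sharp a a' b b' w j - 2 * sharp a a' b b' w l))"

definition wedge ::
    "complex \<Rightarrow> complex \<Rightarrow> complex \<Rightarrow> complex \<Rightarrow> 'n::finite \<Rightarrow> 'n \<Rightarrow>
     complex ^ ('n + 'n) \<Rightarrow> complex ^ ('n + 'n) \<Rightarrow> complex"
  where "wedge a a' b b' i j u v =
    sharp a a' b b' u i * sharp a a' b b' v j - sharp a a' b b' u j * sharp a a' b b' v i"

text \<open>
  The component of \<open>\<kappa>\<^sup>C\<close> at \<open>(ijk)\<close>: the three terms belong to the rotations of the triple.
\<close>

definition vol ::
    "complex \<Rightarrow> complex \<Rightarrow> complex \<Rightarrow> complex \<Rightarrow> 'n::finite \<Rightarrow> 'n \<Rightarrow> 'n \<Rightarrow>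
     complex ^ ('n + 'n) \<Rightarrow> complex ^ ('n + 'n) \<Rightarrow> complex"
  where "vol a a' b b' i j k u v =
    wedge a a' b b' i j u v + wedge a a' b b' j k u v + wedge a a' b b' k i u v"

lemma vol_rotate: "vol a a' b b' j k i = vol a a' b b' i j k"
  by (simp add: vol_def fun_eq_iff)

lemma mean_rotate_sum: "mean a a' b b' i j k u v w + mean a a' b b' j k i u v w + mean a a' b b' k i j u v w = 0"
proof -
  define d where "d = a - a'"
  define e where "e = b - b'"
  show ?thesis
    unfolding mean_def cyc_def om_def sharp_def d_def[symmetric] e_def[symmetric]
    by (simp add: algebra_simps)
qed

text \<open>
  The polynomial identity that fixes the 3-cycle part of \<open>\<kappa>\<^sup>C\<close> in terms of \<open>\<kappa>\<^sup>L\<close>, in the coordinates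
  \<open>x\<close>; the one for \<open>y\<close> is the next lemma.
\<close>

lemma mean_vol_Inl:
  "(a - a') * mean a a' b b' k i j u v w = 2 * cyc (\<lambda>u v w. vol a a' b b' i j k u v * (w $ Inl k - w $ Inl i)) u v w"
proof -
  define d where "d = a - a'"
  define e where "e = b - b'"
  show ?thesis
    unfolding mean_def cyc_def om_def sharp_def vol_def wedge_def d_def[symmetric] e_def[symmetric]
    by (simp add: algebra_simps)
qed

lemma mean_vol_Inr:
  "(b - b') * mean a a' b b' k i j u v w = 2 * cyc (\<lambda>u v w. vol a a' b b' i j k u v * (w $ Inr k - w $ Inr i)) u v w"
proof -
  define d where "d = a - a'"
  define e where "e = b - b'"
  show ?thesis
    unfolding mean_def cyc_def om_def sharp_def vol_def wedge_def d_def[symmetric] e_def[symmetric]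
    by (simp add: algebra_simps)
qed

lemma apply_cycle_inverse:
  assumes "i \<noteq> j" "j \<noteq> k" "k \<noteq> i"
  shows "Perm.apply (inverse (Perm.cycle [i, j, k])) m =
    (if m = i then k else if m = j then i else if m = k then j else m)" (is "_ = ?r")
proof -
  have "Perm.apply (Perm.cycle [i, j, k]) ?r = m"
    unfolding apply_cycle[OF assms] using assms by auto
  from arg_cong[OF this, of "Perm.apply (inverse (Perm.cycle [i, j, k]))"] show ?thesis
    by (simp only: apply_inverse_apply(1))
qed

text \<open>
  The linear defect at \<open>(ijk)\<close>: the three factorizations of the cycle into transpositions, weighted by
  \<open>kappa_vec\<close>, cancel against the displacement by the cycle.  In \<open>kappa_vec\<close> the part common to all
  coordinates drops out by \<open>mean_rotate_sum\<close>; the rest lives at the coordinates \<open>i, j, k\<close> and is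
  matched one by one by \<open>mean_vol_Inl\<close> and \<open>mean_vol_Inr\<close>.
\<close>

lemma cycle_balance:
  assumes d: "i \<noteq> j" "j \<noteq> k" "k \<noteq> i"
  shows "mean a a' b b' i j k u v w * kappa_vec a a' b b' i k $ p +
    mean a a' b b' j k i u v w * kappa_vec a a' b b' j i $ p +
    mean a a' b b' k i j u v w * kappa_vec a a' b b' k j $ p +
    2 * cyc (\<lambda>u v w. vol a a' b b' i j k u v *
      (doubled_perm_rep (Perm.cycle [i, j, k]) w - w) $ p) u v w = 0" (is "?M + 2 * ?C = 0")
proof -
  let ?m = "\<lambda>i j k. mean a a' b b' i j k u v w"
  have "x = - y - z" if "x + y + z = 0" for x y z :: complex
  proof -
    have "x - (- y - z) = 0" using that by (simp add: algebra_simps)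
    then show ?thesis by (simp only: right_minus_eq)
  qed
  then have m1: "?m i j k = - ?m j k i - ?m k i j" using mean_rotate_sum by blast
  show ?thesis
  proof (cases p)
    case (Inl m)
    let ?D = "a - a'"
    have M: "?M = ?D * (?m i j k * (of_bool (m = i) + of_bool (m = k)) + ?m j k i * (of_bool (m = j) + of_bool (m = i)) +
        ?m k i j * (of_bool (m = k) + of_bool (m = j))) + a' * (?m i j k + ?m j k i + ?m k i j)"
      by (simp add: Inl kappa_vec_nth algebra_simps)
    have C: "?C = cyc (\<lambda>u v w. vol a a' b b' i j k u v *
        (w $ Inl (if m = i then k else if m = j then i else if m = k then j else m) - w $ Inl m)) u v w"
      by (simp add: Inl apply_cycle_inverse[OF d] del: cycle.simps)
    consider "m = i" | "m = j" | "m = k" | "m \<noteq> i" "m \<noteq> j" "m \<noteq> k" by blast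
    then show ?thesis
    proof cases
      case 1
      then show ?thesis
        using mean_vol_Inl[of a a' b b' k i j u v w] d unfolding M C by (simp add: m1 algebra_simps)
    next
      case 2
      then show ?thesis
        using mean_vol_Inl[of a a' b b' i j k u v w] d unfolding M C by (simp add: m1 vol_rotate algebra_simps)
    next
      case 3
      then show ?thesis
        using mean_vol_Inl[of a a' b b' j k i u v w] d unfolding M C
        by (simp add: m1 vol_rotate[of a a' b b' k i j] vol_rotate[of a a' b b' i j k] algebra_simps)
    next
      case 4
      then show ?thesis unfolding M C by (simp add: m1 cyc_def)
    qed
  next
    case (Inr m)
    let ?D = "b - b'"
    have M: "?M = ?D * (?m i j k * (of_bool (m = i) + of_bool (m = k)) + ?m j k i * (of_bool (m = j) + of_bool (m = i)) +
        ?m k i j * (of_bool (m = k) + of_bool (m = j))) + b' * (?m i j k + ?m j k i + ?m k i j)"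
      by (simp add: Inr kappa_vec_nth algebra_simps)
    have C: "?C = cyc (\<lambda>u v w. vol a a' b b' i j k u v *
        (w $ Inr (if m = i then k else if m = j then i else if m = k then j else m) - w $ Inr m)) u v w"
      by (simp add: Inr apply_cycle_inverse[OF d] del: cycle.simps)
    consider "m = i" | "m = j" | "m = k" | "m \<noteq> i" "m \<noteq> j" "m \<noteq> k" by blast
    then show ?thesis
    proof cases
      case 1
      then show ?thesis
        using mean_vol_Inr[of b b' a a' k i j u v w] d unfolding M C by (simp add: m1 algebra_simps)
    next
      case 2
      then show ?thesis
        using mean_vol_Inr[of b b' a a' i j k u v w] d unfolding M C by (simp add: m1 vol_rotate algebra_simps)
    next
      case 3
      then show ?thesis
        using mean_vol_Inr[of b b' a a' j k i u v w] d unfolding M C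
        by (simp add: m1 vol_rotate[of a a' b b' k i j] vol_rotate[of a a' b b' i j k] algebra_simps)
    next
      case 4
      then show ?thesis unfolding M C by (simp add: m1 cyc_def)
    qed
  qed
qed

text \<open>
  The component of \<open>\<kappa>\<^sup>C\<close> at the identity has zero displacement, the one at a transposition is a
  cocycle by itself, and on 3-cycles \<open>cycle_balance\<close> applies.
\<close>

lemma kappa_linear_defect:
  "cochain_pair.linear_defect (kappaL a a' b b') (kappaC a a' b b' c \<alpha> \<beta>) h u v w = 0"
proof -
  have "cochain_pair.linear_defect (kappaL a a' b b') (kappaC a a' b b' c \<alpha> \<beta>) h u v w $ p = 0" for p
  proof -
    let ?d = "\<lambda>w. (doubled_perm_rep h w - w) $ p"
    define S where "S u v = (1/2) * (\<Sum>i\<in>UNIV. \<Sum>j\<in>UNIV. of_bool (h = Perm.swap i j) * om i j u v * c)"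
      for u v :: "complex ^ ('a + 'a)"
    define G where "G i j l u v w = om i j u v *
      (sharp a a' b b' w i + sharp a a' b b' w j - 2 * sharp a a' b b' w l) * kappa_vec a a' b b' i l $ p"
      for i j l and u v w :: "complex ^ ('a + 'a)"
    define F where "F i j l u v w = G i j l u v w + 2 * (wedge a a' b b' i j u v * ?d w)"
      for i j l and u v w :: "complex ^ ('a + 'a)"
    have L: "(\<Sum>g\<in>UNIV. kappaL a a' b b' (h * inverse g) (kappaL a a' b b' g u v) (w + doubled_perm_rep g w) $ p) =
        (\<Sum>i\<in>UNIV. \<Sum>j\<in>UNIV. \<Sum>l\<in>UNIV. three h i j l * G i j l u v w)" for u v w
      unfolding kappaL_nth[of _ _ _ _ "h * inverse _"] G_def
      by (rule swap_product) (simp add: kappa_vec_sym)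
    have C: "2 * kappaC a a' b b' c \<alpha> \<beta> h u v * ?d w = 2 * (S u v * ?d w) +
        (\<Sum>i\<in>UNIV. \<Sum>j\<in>UNIV. \<Sum>l\<in>UNIV. three h i j l * (2 * (wedge a a' b b' i j u v * ?d w)))" for u v w
    proof -
      have "of_bool (h = 1) * invform \<alpha> \<beta> u v * ?d w = 0" by (cases "h = 1") simp_all
      then have "2 * kappaC a a' b b' c \<alpha> \<beta> h u v * ?d w = 2 * (S u v * ?d w) + 2 * (three_form a a' b b' h u v * ?d w)"
        unfolding kappaC_formula S_def[symmetric] by (simp only: distrib_left distrib_right mult.assoc) simp
      moreover have "2 * (three_form a a' b b' h u v * ?d w) =
        (\<Sum>i\<in>UNIV. \<Sum>j\<in>UNIV. \<Sum>l\<in>UNIV. three h i j l * (2 * (wedge a a' b b' i j u v * ?d w)))"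
        unfolding three_form_def wedge_def[symmetric]
        by (simp only: sum_distrib_left sum_distrib_right mult_ac)
      ultimately show ?thesis by (simp only:)
    qed
    have "cochain_pair.linear_defect (kappaL a a' b b') (kappaC a a' b b' c \<alpha> \<beta>) h u v w $ p =
      cyc (\<lambda>u v w. (\<Sum>g\<in>UNIV. kappaL a a' b b' (h * inverse g) (kappaL a a' b b' g u v) (w + doubled_perm_rep g w) $ p) +
        2 * kappaC a a' b b' c \<alpha> \<beta> h u v * ?d w) u v w"
      unfolding cochain_pair.linear_defect_def[OF cochain_pair_kappa] cyc_def
      by (simp only: vector_add_component sum_component vector_smult_component)
    also have "\<dots> = (\<Sum>i\<in>UNIV. \<Sum>j\<in>UNIV. \<Sum>l\<in>UNIV. three h i j l * cyc (F i j l) u v w) +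
        2 * cyc (\<lambda>u v w. S u v * ?d w) u v w"
      unfolding L C cyc_def F_def by (simp only: distrib_left sum.distrib ac_simps)
    also have "cyc (\<lambda>u v w. S u v * ?d w) u v w = 0"
      unfolding S_def by (rule swap_sum_cocycle)
    also have "(\<Sum>i\<in>UNIV. \<Sum>j\<in>UNIV. \<Sum>l\<in>UNIV. three h i j l * cyc (F i j l) u v w) = 0"
    proof (rule three_sum_zero)
      fix i j k assume d: "i \<noteq> j" "j \<noteq> k" "k \<noteq> i" and h: "h = Perm.cycle [i, j, k]"
      have G: "cyc (G i j l) u v w = mean a a' b b' i j l u v w * kappa_vec a a' b b' i l $ p" for i j l
        by (simp only: G_def mean_def cyc_def distrib_right)
      have F: "cyc (F i j l) u v w = cyc (G i j l) u v w + 2 * cyc (\<lambda>u v w. wedge a a' b b' i j u v * ?d w) u v w" for i j l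
        by (simp only: F_def cyc_def distrib_left ac_simps)
      have V: "cyc (\<lambda>u v w. vol a a' b b' i j k u v * ?d w) u v w =
        cyc (\<lambda>u v w. wedge a a' b b' i j u v * ?d w) u v w + cyc (\<lambda>u v w. wedge a a' b b' j k u v * ?d w) u v w +
        cyc (\<lambda>u v w. wedge a a' b b' k i u v * ?d w) u v w"
        by (simp only: vol_def cyc_def distrib_right add_ac)
      show "cyc (F i j k) u v w + cyc (F j k i) u v w + cyc (F k i j) u v w = 0"
        using cycle_balance[OF d, of a a' b b' u v w p] unfolding F G h[symmetric] V
        by (simp only: distrib_left ac_simps)
    qed
    finally show ?thesis by simp
  qed
  then show ?thesis by (simp add: vec_eq_iff)
qed

text \<open>
  All contractions \<open>sharp (kappa_vec i j) r\<close> are equal, so the 3-cycle form, which only sees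
  differences, annihilates the values of \<open>\<kappa>\<^sup>L\<close>.
\<close>

lemma three_form_kappaL: "three_form a a' b b' h (kappaL a a' b b' g u v) z = 0"
proof -
  have "sharp a a' b b' (kappaL a a' b b' g u v) i = (1/2) * (\<Sum>r\<in>UNIV. \<Sum>s\<in>UNIV.
      of_bool (g = Perm.swap r s) * om r s u v * ((a - a') * b' - (b - b') * a'))" for i
  proof -
    have "sharp a a' b b' (kappa_vec a a' b b' r s) i = (a - a') * b' - (b - b') * a'" for r s
      by (simp add: sharp_def kappa_vec_nth algebra_simps)
    then show ?thesis
      using linear_kappaL[of "\<lambda>x. sharp a a' b b' x i" a a' b b' g u v] by (simp only: sharp_linear)
  qed
  then obtain S where S: "\<And>i. sharp a a' b b' (kappaL a a' b b' g u v) i = S" by blast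
  show ?thesis
    unfolding three_form_def S by (rule three_sum_zero) simp
qed

text \<open>
  Of the three parts of \<open>\<kappa>\<^sup>C\<close> only the identity component survives: the transposition part cancels
  by \<open>mean_rotate_sum\<close>, and the 3-cycle part annihilates the values of \<open>\<kappa>\<^sup>L\<close>.
\<close>

lemma kappa_constant_defect:
  "cochain_pair.constant_defect (kappaL a a' b b') (kappaC a a' b b' c \<alpha> \<beta>) h u v w =
   cyc (\<lambda>u v w. invform \<alpha> \<beta> (kappaL a a' b b' h u v) (w + doubled_perm_rep h w)) u v w"
proof -
  define F where "F i j l u v w = om i j u v *
      (sharp a a' b b' w i + sharp a a' b b' w j - 2 * sharp a a' b b' w l) * c"
      for i j l and u v w :: "complex ^ ('a + 'a)"
  have "(\<Sum>g\<in>UNIV. kappaC a a' b b' c \<alpha> \<beta> (h * inverse g) (kappaL a a' b b' g u v) (w + doubled_perm_rep g w)) =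
      invform \<alpha> \<beta> (kappaL a a' b b' h u v) (w + doubled_perm_rep h w) +
      (\<Sum>i\<in>UNIV. \<Sum>j\<in>UNIV. \<Sum>l\<in>UNIV. three h i j l * F i j l u v w)" for u v w
  proof -
    have "h * inverse g = 1 \<longleftrightarrow> g = h" for g
      by (metis mult.assoc mult_1_left mult_1_right perm.left_inverse perm.right_inverse)
    then have "(\<Sum>g\<in>UNIV. of_bool (h * inverse g = 1) *
        invform \<alpha> \<beta> (kappaL a a' b b' g u v) (w + doubled_perm_rep g w)) =
        (\<Sum>g\<in>UNIV. if g = h then invform \<alpha> \<beta> (kappaL a a' b b' g u v) (w + doubled_perm_rep g w) else 0)"
      by (intro sum.cong refl) simp
    also have "\<dots> = invform \<alpha> \<beta> (kappaL a a' b b' h u v) (w + doubled_perm_rep h w)"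
      by (subst sum.delta) simp_all
    finally show ?thesis
      unfolding kappaC_formula three_form_kappaL sum.distrib F_def
      by (simp only: swap_product[of "\<lambda>_ _. c"] sum.neutral_const add_0_right)
  qed
  then have "cochain_pair.constant_defect (kappaL a a' b b') (kappaC a a' b b' c \<alpha> \<beta>) h u v w =
      cyc (\<lambda>u v w. invform \<alpha> \<beta> (kappaL a a' b b' h u v) (w + doubled_perm_rep h w)) u v w +
      (\<Sum>i\<in>UNIV. \<Sum>j\<in>UNIV. \<Sum>l\<in>UNIV. three h i j l * cyc (F i j l) u v w)"
    unfolding cochain_pair.constant_defect_def[OF cochain_pair_kappa] cyc_def
    by (simp only: distrib_left sum.distrib ac_simps)
  moreover have "(\<Sum>i\<in>UNIV. \<Sum>j\<in>UNIV. \<Sum>l\<in>UNIV. three h i j l * cyc (F i j l) u v w) = 0"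
  proof (rule three_sum_zero)
    fix i j k
    have F: "cyc (F i j l) u v w = mean a a' b b' i j l u v w * c" for i j l
      by (simp only: F_def mean_def cyc_def distrib_right)
    show "cyc (F i j k) u v w + cyc (F j k i) u v w + cyc (F k i j) u v w = 0"
      unfolding F distrib_right[symmetric] mean_rotate_sum by simp
  qed
  ultimately show ?thesis by simp
qed

text \<open>
  The coefficients are those of the parameter equations, up to taking differences.
\<close>

lemma invform_kappa_vec:
  fixes z :: "complex ^ ('n::finite + 'n)"
  shows "invform \<alpha> \<beta> (kappa_vec a a' b b' i j) z =
    (\<alpha> - \<beta>) * ((a - a') * (z $ Inr i + z $ Inr j) - (b - b') * (z $ Inl i + z $ Inl j)) +
    ((\<alpha> - \<beta>) * a' + \<beta> * (of_nat CARD('n) * a' + 2 * (a - a'))) * (\<Sum>m\<in>UNIV. z $ Inr m) -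
    ((\<alpha> - \<beta>) * b' + \<beta> * (of_nat CARD('n) * b' + 2 * (b - b'))) * (\<Sum>m\<in>UNIV. z $ Inl m)"
proof -
  have 1: "(\<Sum>m\<in>UNIV. (x * (of_bool (m = i) + of_bool (m = j)) + y) * f m) =
      x * (f i + f j) + y * (\<Sum>m\<in>UNIV. f m)" for x y :: complex and f :: "'n \<Rightarrow> complex"
  proof -
    have "(x * (of_bool (m = i) + of_bool (m = j)) + y) * f m =
        (if m = i then x * f i else 0) + (if m = j then x * f j else 0) + y * f m" for m
      by (auto simp: algebra_simps)
    then show ?thesis by (simp add: sum.distrib sum_distrib_left algebra_simps)
  qed
  have 2: "(\<Sum>m\<in>UNIV. x * (of_bool (m = i) + of_bool (m = j)) + y) = 2 * x + of_nat CARD('n) * y"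
    for x y :: complex
    using 1[of x y "\<lambda>_. 1"] by simp
  show ?thesis
    unfolding invform_def kappa_vec_nth sum_subtractf 1 2 by (simp add: algebra_simps)
qed

lemma kappaL_fixed: "doubled_perm_rep g (kappaL a a' b b' g u v) = kappaL a a' b b' g u v"
proof -
  have fixed: "of_bool (g = Perm.swap i j) * om i j u v * doubled_perm_rep g (kappa_vec a a' b b' i j) $ p =
      of_bool (g = Perm.swap i j) * om i j u v * kappa_vec a a' b b' i j $ p" for i j p
  proof (cases "g = Perm.swap i j")
    case True
    have "kappa_vec a a' b b' i j $ Inl i = kappa_vec a a' b b' i j $ Inl j \<and>
        kappa_vec a a' b b' i j $ Inr i = kappa_vec a a' b b' i j $ Inr j"
      by (auto simp: kappa_vec_nth)
    then show ?thesis using True swap_fixed_point by metis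
  qed simp
  have "doubled_perm_rep g (kappaL a a' b b' g u v) $ p = (1/2) * (\<Sum>i\<in>UNIV. \<Sum>j\<in>UNIV.
      of_bool (g = Perm.swap i j) * om i j u v * doubled_perm_rep g (kappa_vec a a' b b' i j) $ p)" for p
    by (simp only: doubled_perm_rep_nth kappaL_nth)
  then show ?thesis unfolding fixed kappaL_nth[symmetric] unfolding vec_eq_iff by blast
qed

lemma swap_eq_one: "Perm.swap i j = 1 \<longleftrightarrow> i = j"
  by (metis apply_one apply_swap_simp(1) id_apply swap_1)

lemma kappaL_one: "kappaL a a' b b' 1 u v = 0"
proof -
  have zero: "of_bool (1 = Perm.swap i j) * om i j u v = 0" for i j
    using swap_eq_one[of i j] by (cases "i = j") (auto simp: om_same)
  show ?thesis unfolding vec_eq_iff kappaL_nth zero by simp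
qed

theorem kappa_pbw:
  assumes eqs: "parameter_eqs CARD('n) a a' b b' \<alpha> \<beta>"
  shows "cochain_pair.pbw_conditions (kappaL a a' b b' :: 'n::finite perm \<Rightarrow> _) (kappaC a a' b b' c \<alpha> \<beta>)"
proof -
  have p: "(\<alpha> - \<beta>) * (a - a') = 0" "(\<alpha> - \<beta>) * (b - b') = 0"
    "(\<alpha> - \<beta>) * a' + \<beta> * (of_nat CARD('n) * a' + 2 * (a - a')) = 0"
    "(\<alpha> - \<beta>) * b' + \<beta> * (of_nat CARD('n) * b' + 2 * (b - b')) = 0"
  proof -
    let ?n = "of_nat CARD('n) :: complex"
    have e: "\<alpha> * a + \<beta> * (a + (?n - 2) * a') = 0" "\<alpha> * a' + \<beta> * (2 * a + (?n - 3) * a') = 0"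
      "\<alpha> * b + \<beta> * (b + (?n - 2) * b') = 0" "\<alpha> * b' + \<beta> * (2 * b + (?n - 3) * b') = 0"
      using eqs by (simp_all add: parameter_eqs_def)
    have "(\<alpha> - \<beta>) * (x - y) = (\<alpha> * x + \<beta> * (x + (?n - 2) * y)) - (\<alpha> * y + \<beta> * (2 * x + (?n - 3) * y))"
      "(\<alpha> - \<beta>) * y + \<beta> * (?n * y + 2 * (x - y)) = \<alpha> * y + \<beta> * (2 * x + (?n - 3) * y)" for x y
      by (simp_all add: algebra_simps)
    from this(1)[of a a'] this(1)[of b b'] this(2)[where x = a and y = a'] this(2)[where x = b and y = b']
    show "(\<alpha> - \<beta>) * (a - a') = 0" "(\<alpha> - \<beta>) * (b - b') = 0"
      "(\<alpha> - \<beta>) * a' + \<beta> * (?n * a' + 2 * (a - a')) = 0"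
      "(\<alpha> - \<beta>) * b' + \<beta> * (?n * b' + 2 * (b - b')) = 0"
      unfolding e by simp_all
  qed
  have "invform \<alpha> \<beta> (kappa_vec a a' b b' i j) z = 0" for i j and z :: "complex ^ ('n + 'n)"
  proof -
    have "(\<alpha> - \<beta>) * ((a - a') * y - (b - b') * x) = ((\<alpha> - \<beta>) * (a - a')) * y - ((\<alpha> - \<beta>) * (b - b')) * x" for x y
      by (simp add: algebra_simps)
    then show ?thesis unfolding invform_kappa_vec p by simp
  qed
  then have "invform \<alpha> \<beta> (kappaL a a' b b' h u v) z = 0" for h :: "'n perm" and u v z
    using linear_kappaL[of "\<lambda>x. invform \<alpha> \<beta> x z" a a' b b' h u v] by (simp add: invform_bilinear)
  then have defect: "cochain_pair.constant_defect (kappaL a a' b b' :: 'n perm \<Rightarrow> _) (kappaC a a' b b' c \<alpha> \<beta>) h u v w = 0"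
    for h u v w
    unfolding kappa_constant_defect by (simp add: cyc_def)
  show ?thesis
    unfolding cochain_pair.pbw_conditions_def[OF cochain_pair_kappa]
    by (intro conjI allI kappa_invariant kappa_cocycle kappa_linear_defect defect)
qed

section \<open>Classification\<close>

text \<open>
  The cocycle condition at \<open>h\<close> for a scalar-valued skew form: \<open>B\<close> has zero wedge product with every
  linear form \<open>w \<mapsto> (h w - w)\<^sub>q\<close>.  In the doubled representation the span of these linear forms has
  even dimension, and a nonzero \<open>B\<close> exists only if the dimension is at most two, that is, if
  \<open>h\<close> is the identity or a transposition.
\<close>

definition codiff ::
    "'n::finite perm \<Rightarrow> (complex ^ ('n + 'n) \<Rightarrow> complex ^ ('n + 'n) \<Rightarrow> complex) \<Rightarrow> bool"
  where "codiff h B \<longleftrightarrow> (\<forall>u v. B u v = - B v u) \<and>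
    (\<forall>u v w q. cyc (\<lambda>u v w. B u v * (doubled_perm_rep h w - w) $ q) u v w = 0)"

lemma displacement_axis:
  "(doubled_perm_rep h (axis p 1) - axis p 1) $ q = (of_bool (q = lact h p) - of_bool (q = p) :: complex)"
  unfolding vector_minus_component doubled_perm_rep_axis by (auto simp: axis_def)

text \<open>
  If \<open>h\<close> moves \<open>m\<close>, the condition evaluated with one argument \<open>x\<^sub>m\<close> or \<open>y\<^sub>m\<close> and read off at the
  coordinates of index \<open>m\<close> expresses all values of \<open>B\<close> by the single value \<open>B x\<^sub>m y\<^sub>m\<close>.
\<close>

lemma codiff_form:
  assumes B: "codiff h B" and m: "Perm.apply h m \<noteq> m"
  shows "B v w = B (axis (Inl m) 1) (axis (Inr m) 1) *
    ((doubled_perm_rep h v - v) $ Inl m * (doubled_perm_rep h w - w) $ Inr m -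
     (doubled_perm_rep h v - v) $ Inr m * (doubled_perm_rep h w - w) $ Inl m)"
proof -
  let ?x = "axis (Inl m) 1" and ?y = "axis (Inr m) 1" and ?d = "\<lambda>w q. (doubled_perm_rep h w - w) $ q"
  have skew: "B u v = - B v u" and eq: "B u v * ?d w q + B v w * ?d u q + B w u * ?d v q = 0" for u v w q
    using B unfolding codiff_def cyc_def by blast+
  have d: "?d ?x (Inl m) = -1" "?d ?x (Inr m) = 0" "?d ?y (Inl m) = 0" "?d ?y (Inr m) = -1"
    unfolding displacement_axis using m by auto
  have y: "B ?y v = B ?x ?y * ?d v (Inl m)" for v
    using eq[of ?x ?y v "Inl m"] unfolding d by (simp add: algebra_simps del: vector_minus_component)
  have x: "B v ?x = B ?x ?y * ?d v (Inr m)" for v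
    using eq[of ?x ?y v "Inr m"] unfolding d by (simp add: algebra_simps del: vector_minus_component)
  have "B v w = B ?x v * ?d w (Inl m) + B w ?x * ?d v (Inl m)"
    using eq[of ?x v w "Inl m"] unfolding d by (simp add: algebra_simps del: vector_minus_component)
  then show ?thesis
    unfolding x skew[of ?x v] by (simp add: algebra_simps del: vector_minus_component)
qed

lemma codiff_swap:
  assumes "codiff (Perm.swap i j) B" "i \<noteq> j"
  shows "B u v = B (axis (Inl i) 1) (axis (Inr i) 1) * om i j u v"
  using codiff_form[OF assms(1), of i u v] assms(2) by (simp add: om_def algebra_simps)

text \<open>
  If \<open>h\<close> is not a transposition, it moves a further index \<open>m'\<close> that does not form a 2-cycle with \<open>m\<close>:
  testing the condition with \<open>x\<^sub>m'\<close> as a third vector makes the value \<open>B x\<^sub>m y\<^sub>m\<close> vanish.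
\<close>

lemma codiff_not_swap:
  assumes B: "codiff h B" and h: "h \<noteq> 1" and nsw: "\<And>i j. i \<noteq> j \<Longrightarrow> h \<noteq> Perm.swap i j"
  shows "B u v = 0"
proof -
  obtain m where m: "Perm.apply h m \<noteq> m"
    using h by (metis perm_eqI apply_one id_apply)
  have "\<exists>m'. m' \<noteq> m \<and> Perm.apply h m' \<noteq> m' \<and> (m' \<noteq> Perm.apply h m \<or> Perm.apply h m' \<noteq> m)"
  proof (rule ccontr)
    assume none: "\<not> ?thesis"
    have *: "Perm.apply h k = k \<or> (k = Perm.apply h m \<and> Perm.apply h k = m)" if "k \<noteq> m" for k
      using none that by blast
    have hm: "Perm.apply h (Perm.apply h m) = m"
      using *[OF m] m apply_inj[of h "Perm.apply h m" m] by blast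
    have "h = Perm.swap m (Perm.apply h m)"
    proof (rule perm_eqI)
      fix k
      show "Perm.apply h k = Perm.apply (Perm.swap m (Perm.apply h m)) k"
        using *[of k] hm by (cases "k = m"; cases "k = Perm.apply h m") (simp_all add: apply_swap)
    qed
    then show False using nsw[of m "Perm.apply h m"] m by simp
  qed
  then obtain m' where m': "m' \<noteq> m" "Perm.apply h m' \<noteq> m'" "m' \<noteq> Perm.apply h m \<or> Perm.apply h m' \<noteq> m"
    by blast
  let ?x = "axis (Inl m) 1" and ?y = "axis (Inr m) 1" and ?x' = "axis (Inl m') 1"
    and ?d = "\<lambda>w q. (doubled_perm_rep h w - w) $ q"
  have eq: "B ?x ?y * ?d ?x' q + B ?y ?x' * ?d ?x q + B ?x' ?x * ?d ?y q = 0" for q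
    using B unfolding codiff_def cyc_def by blast
  have "B ?x ?y = 0"
  proof (cases "m' = Perm.apply h m")
    case False
    then show ?thesis using eq[of "Inl m'"] m m' unfolding displacement_axis by auto
  next
    case True
    then have "B ?y ?x' = 0" using eq[of "Inl m"] m m' unfolding displacement_axis by auto
    then show ?thesis using eq[of "Inl m'"] m m' unfolding displacement_axis by auto
  qed
  then show ?thesis using codiff_form[OF B m, of u v] by simp
qed

lemma codiff_unique:
  assumes B: "codiff h B" "codiff h B'" and h: "h \<noteq> 1"
    and eq: "\<And>i j. i \<noteq> j \<Longrightarrow> h = Perm.swap i j \<Longrightarrow>
      B (axis (Inl i) 1) (axis (Inr i) 1) = B' (axis (Inl i) 1) (axis (Inr i) 1)"
  shows "B u v = B' u v"
proof (cases "\<exists>i j. i \<noteq> j \<and> h = Perm.swap i j")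
  case True
  then obtain i j where "i \<noteq> j" "h = Perm.swap i j" by blast
  then show ?thesis using codiff_swap[of i j B u v] codiff_swap[of i j B' u v] B eq by metis
next
  case False
  then show ?thesis using codiff_not_swap[OF B(1) h] codiff_not_swap[OF B(2) h] by metis
qed

text \<open>
  For values in \<open>V\<close> the cocycle condition takes place in \<open>S\<^sup>2(V)\<close> and mixes two coordinates.  If the
  values are fixed by \<open>h\<close>, they are constant on \<open>h\<close>-orbits of coordinates, whereas displacements
  \<open>h w - w\<close> sum to zero over an orbit: summing one of the coordinates over its orbit kills the
  mixed term and leaves the condition for each coordinate separately.
\<close>

lemma fixed_cocycle_codiff:
  fixes \<kappa> :: "complex ^ ('n::finite + 'n) \<Rightarrow> complex ^ ('n + 'n) \<Rightarrow> complex ^ ('n + 'n)"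
  assumes skew: "\<And>u v. \<kappa> u v = - \<kappa> v u" and fixed: "\<And>u v. doubled_perm_rep h (\<kappa> u v) = \<kappa> u v"
    and coc: "\<And>u v w p q. cyc (\<lambda>u v w. \<kappa> u v $ p * (doubled_perm_rep h w - w) $ q +
      \<kappa> u v $ q * (doubled_perm_rep h w - w) $ p) u v w = 0"
  shows "codiff h (\<lambda>u v. \<kappa> u v $ p)"
proof -
  define Orb where "Orb = {lact (h ^ k) p | k. True}"
  let ?d = "\<lambda>w q. (doubled_perm_rep h w - w) $ q"
  have sub: "lact h ` Orb \<subseteq> Orb"
    unfolding Orb_def by (auto simp: lact_mult[symmetric, unfolded fun_eq_iff comp_def] power_Suc[symmetric] simp del: power_Suc)
  then have img: "lact h ` Orb = Orb"
    by (intro card_subset_eq) (auto simp: card_image inj_on_subset[OF lact_inj])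
  have p: "p \<in> Orb" unfolding Orb_def using power_0[of h] by (auto intro!: exI[of _ 0])
  have d: "(\<Sum>r\<in>Orb. ?d w r) = 0" for w
  proof -
    have "(\<Sum>r\<in>Orb. w $ lact (inverse h) r) = (\<Sum>r\<in>lact h ` Orb. w $ lact (inverse h) r)" by (simp only: img)
    also have "\<dots> = (\<Sum>r\<in>Orb. w $ r)"
      by (subst sum.reindex) (auto simp: inj_on_subset[OF lact_inj])
    finally show ?thesis by (simp add: sum_subtractf)
  qed
  have step: "\<kappa> u v $ lact h r = \<kappa> u v $ r" for u v r
    using arg_cong[OF fixed[of u v], of "\<lambda>x. x $ lact h r"] by simp
  have const: "\<kappa> u v $ r = \<kappa> u v $ p" if "r \<in> Orb" for u v r
  proof -
    obtain k where "r = lact (h ^ k) p" using \<open>r \<in> Orb\<close> unfolding Orb_def by blast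
    moreover have "\<kappa> u v $ lact (h ^ k) p = \<kappa> u v $ p"
      by (induction k) (simp_all add: lact_mult step)
    ultimately show ?thesis by simp
  qed
  have "cyc (\<lambda>u v w. \<kappa> u v $ p * ?d w q) u v w = 0" for u v w q
  proof -
    have "0 = (\<Sum>r\<in>Orb. cyc (\<lambda>u v w. \<kappa> u v $ r * ?d w q + \<kappa> u v $ q * ?d w r) u v w)"
      by (simp only: coc sum.neutral_const)
    also have "\<dots> = cyc (\<lambda>u v w. (\<Sum>r\<in>Orb. \<kappa> u v $ r) * ?d w q + \<kappa> u v $ q * (\<Sum>r\<in>Orb. ?d w r)) u v w"
      by (simp only: cyc_def sum.distrib sum_distrib_left sum_distrib_right)
    also have "\<dots> = cyc (\<lambda>u v w. (of_nat (card Orb) * \<kappa> u v $ p) * ?d w q) u v w"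
      unfolding d by (simp add: const cyc_def)
    also have "\<dots> = of_nat (card Orb) * cyc (\<lambda>u v w. \<kappa> u v $ p * ?d w q) u v w"
      by (simp only: cyc_def distrib_left mult.assoc)
    finally have "of_nat (card Orb) * cyc (\<lambda>u v w. \<kappa> u v $ p * ?d w q) u v w = 0" ..
    moreover have "card Orb \<noteq> 0" using p by auto
    ultimately show ?thesis by simp
  qed
  moreover have "\<kappa> u v $ p = - \<kappa> v u $ p" for u v
    using arg_cong[OF skew[of u v], of "\<lambda>x. x $ p"] by simp
  ultimately show ?thesis unfolding codiff_def by blast
qed

lemma swap_left_inj: "Perm.swap i j = Perm.swap i k \<longleftrightarrow> j = k"
  by (metis apply_swap_simp(1))

lemma kappaL_swap_axis:
  "i \<noteq> j \<Longrightarrow> kappaL a a' b b' (Perm.swap i j) (axis (Inl i) 1) (axis (Inr i) 1) = kappa_vec a a' b b' i j"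
proof -
  assume "i \<noteq> j"
  have "kappaL a a' b b' (Perm.swap i j) (axis (Inl i) 1) (axis (Inr i) 1) =
      (\<Sum>k\<in>- {i}. of_bool (Perm.swap i j = Perm.swap i k) *s kappa_vec a a' b b' i k)"
    by (simp only: kappaL_axis kappaL_basis.simps kappaL_xy_def simp_thms if_True)
  also have "\<dots> = (\<Sum>k\<in>- {i}. if k = j then kappa_vec a a' b b' i j else 0)"
    by (intro sum.cong refl) (auto simp: swap_left_inj)
  finally show ?thesis using \<open>i \<noteq> j\<close> by simp
qed

lemma kappaL_codiff: "codiff h (\<lambda>u v. kappaL a a' b b' h u v $ p)"
proof (rule fixed_cocycle_codiff)
  show "kappaL a a' b b' h u v = - kappaL a a' b b' h v u" for u v
    using cochain_pair.\<kappa>L_skew[OF cochain_pair_kappa] .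
  show "doubled_perm_rep h (kappaL a a' b b' h u v) = kappaL a a' b b' h u v" for u v
    by (rule kappaL_fixed)
  show "cyc (\<lambda>u v w. kappaL a a' b b' h u v $ p * (doubled_perm_rep h w - w) $ q +
      kappaL a a' b b' h u v $ q * (doubled_perm_rep h w - w) $ p) u v w = 0" for u v w p q
    using kappa_cocycle[of a a' b b' h u v w p q]
    unfolding cochain_pair.cocycle_coeff_def[OF cochain_pair_kappa] .
qed

lemma kappaL_swap: "i \<noteq> j \<Longrightarrow> kappaL a a' b b' (Perm.swap i j) u v = om i j u v *s kappa_vec a a' b b' i j"
proof -
  assume ij: "i \<noteq> j"
  have "kappaL a a' b b' (Perm.swap i j) u v $ p =
      kappaL a a' b b' (Perm.swap i j) (axis (Inl i) 1) (axis (Inr i) 1) $ p * om i j u v" for p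
    by (rule codiff_swap[OF kappaL_codiff ij])
  then show ?thesis by (simp add: vec_eq_iff kappaL_swap_axis[OF ij] mult.commute)
qed

text \<open>
  The transposition part of \<open>\<kappa>\<^sup>C\<close>.
\<close>

definition swap_form :: "complex \<Rightarrow> 'n::finite perm \<Rightarrow> complex ^ ('n + 'n) \<Rightarrow> complex ^ ('n + 'n) \<Rightarrow> complex"
  where "swap_form c h u v = (1/2) * (\<Sum>i\<in>UNIV. \<Sum>j\<in>UNIV. of_bool (h = Perm.swap i j) * om i j u v * c)"

lemma swap_form_codiff: "codiff h (swap_form c h)"
proof -
  have skew: "swap_form c h u v = - swap_form c h v u" for u v
    by (simp add: swap_form_def om_skew[of _ _ u v] sum_negf)
  have "cyc (\<lambda>u v w. swap_form c h u v * (doubled_perm_rep h w - w) $ q) u v w = 0" for u v w q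
    unfolding swap_form_def by (rule swap_sum_cocycle)
  then show ?thesis unfolding codiff_def using skew by blast
qed

lemma swap_form_axis:
  "i \<noteq> j \<Longrightarrow> swap_form c (Perm.swap i j) (axis (Inl i) 1) (axis (Inr i) 1) = c"
proof -
  assume "i \<noteq> j"
  have "swap_form c (Perm.swap i j) (axis (Inl i) 1) (axis (Inr i) 1) =
      (\<Sum>l\<in>- {i}. of_bool (Perm.swap i j = Perm.swap i l) * c)"
    unfolding swap_form_def om_axis using delta_pairs_swap[of "\<lambda>_ _. c" "Perm.swap i j" i i] by simp
  also have "\<dots> = (\<Sum>l\<in>- {i}. if l = j then c else 0)"
    by (intro sum.cong refl) (auto simp: swap_left_inj)
  finally show ?thesis using \<open>i \<noteq> j\<close> by simp
qed

lemma swap_form_one: "swap_form c 1 u v = 0"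
proof -
  have zero: "of_bool (1 = Perm.swap i j) * om i j u v * c = 0" for i j
    using swap_eq_one[of i j] by (cases "i = j") (auto simp: om_same)
  show ?thesis unfolding swap_form_def zero by simp
qed

lemma perm_pair:
  assumes "i \<noteq> j" "i' \<noteq> j'"
  obtains \<sigma> :: "'a perm" where "Perm.apply \<sigma> i = i'" "Perm.apply \<sigma> j = j'"
proof -
  define \<tau> where "\<tau> = Perm.swap i i'"
  have "Perm.apply \<tau> j \<noteq> i'" using assms(1) by (auto simp: \<tau>_def apply_swap)
  then have "Perm.apply (Perm.swap (Perm.apply \<tau> j) j' * \<tau>) i = i'"
    "Perm.apply (Perm.swap (Perm.apply \<tau> j) j' * \<tau>) j = j'"
    using assms by (auto simp: apply_times \<tau>_def apply_swap)
  then show thesis using that by blast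
qed

lemma perm_triple:
  assumes "i \<noteq> j" "j \<noteq> k" "k \<noteq> i" "i' \<noteq> j'" "j' \<noteq> k'" "k' \<noteq> i'"
  obtains \<sigma> :: "'a perm" where "Perm.apply \<sigma> i = i'" "Perm.apply \<sigma> j = j'" "Perm.apply \<sigma> k = k'"
proof -
  obtain \<tau> where \<tau>: "Perm.apply \<tau> i = i'" "Perm.apply \<tau> j = j'" using perm_pair assms(1,4) by metis
  have "Perm.apply \<tau> k \<noteq> i'" "Perm.apply \<tau> k \<noteq> j'" using assms(2,3) \<tau> apply_inj by metis+
  then have "Perm.apply (Perm.swap (Perm.apply \<tau> k) k' * \<tau>) i = i'"
    "Perm.apply (Perm.swap (Perm.apply \<tau> k) k' * \<tau>) j = j'"
    "Perm.apply (Perm.swap (Perm.apply \<tau> k) k' * \<tau>) k = k'"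
    using \<tau> assms by (auto simp: apply_times apply_swap)
  then show thesis using that by blast
qed

text \<open>
  The linear part is determined first: its components satisfy \<open>codiff\<close> in each coordinate, so they
  live on transpositions and are given by vectors \<open>\<Lambda> i j\<close>; transitivity of \<open>S\<^sub>n\<close> on pairs and triples
  of indices leaves four free coordinates.  The linear defect is affine in \<open>\<kappa>\<^sup>C\<close>, so the difference \<open>\<delta>\<close>
  of \<open>\<kappa>\<^sup>C\<close> and the explicit 3-cycle part satisfies the homogeneous condition, which
  leaves one number on transpositions and an invariant form at the identity.  Finally the constant
  defect at a transposition says that \<open>\<Lambda> i j\<close> is orthogonal, under that form, to the vectors fixed
  by the transposition, and this amounts to the parameter equations.
\<close>

theorem classification:
  fixes \<kappa>L :: "'n::finite perm \<Rightarrow> complex ^ ('n + 'n) \<Rightarrow> complex ^ ('n + 'n) \<Rightarrow> complex ^ ('n + 'n)"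
  assumes card: "CARD('n) \<ge> 3" and pair: "cochain_pair \<kappa>L \<kappa>C" and cond: "cochain_pair.pbw_conditions \<kappa>L \<kappa>C"
    and fixed: "\<And>g u v. doubled_perm_rep g (\<kappa>L g u v) = \<kappa>L g u v" and one: "\<And>u v. \<kappa>L 1 u v = 0"
  shows "\<exists>a a' b b' c \<alpha> \<beta>. parameter_eqs CARD('n) a a' b b' \<alpha> \<beta> \<and>
    \<kappa>L = kappaL a a' b b' \<and> \<kappa>C = kappaC a a' b b' c \<alpha> \<beta>"
proof -
  interpret cochain_pair \<kappa>L \<kappa>C by (rule pair)
  let ?x = "\<lambda>i :: 'n. axis (Inl i) (1 :: complex)" and ?y = "\<lambda>i :: 'n. axis (Inr i) (1 :: complex)"
  have inv: invariant and coc: "\<And>g u v w p q. cocycle_coeff g u v w p q = 0"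
    and ld: "\<And>h u v w. linear_defect h u v w = 0" and cd: "\<And>h u v w. constant_defect h u v w = 0"
    using cond unfolding pbw_conditions_def by blast+
  have invL: "\<kappa>L (g * h * inverse g) (doubled_perm_rep g u) (doubled_perm_rep g v) = doubled_perm_rep g (\<kappa>L h u v)"
    and invC: "\<kappa>C (g * h * inverse g) (doubled_perm_rep g u) (doubled_perm_rep g v) = \<kappa>C h u v" for g h u v
    using inv unfolding invariant_def by blast+
  have codL: "codiff h (\<lambda>u v. \<kappa>L h u v $ p)" for h p
    using fixed_cocycle_codiff[OF \<kappa>L_skew fixed coc[unfolded cocycle_coeff_def]] .
  obtain i0 j0 k0 :: 'n where d0: "i0 \<noteq> j0" "j0 \<noteq> k0" "k0 \<noteq> i0"
  proof -
    obtain S :: "'n set" where "S \<subseteq> UNIV" "card S = 3"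
      using card obtain_subset_with_card_n by metis
    then obtain i j k where "S = {i, j, k}" "i \<noteq> j" "i \<noteq> k" "j \<noteq> k" using card_3_iff by metis
    then show thesis using that[of i j k] by blast
  qed

  define \<Lambda> where "\<Lambda> i j = \<kappa>L (Perm.swap i j) (?x i) (?y i)" for i j
  have \<Lambda>_perm: "\<Lambda> (Perm.apply g i) (Perm.apply g j) = doubled_perm_rep g (\<Lambda> i j)" for g i j
    using invL[of g "Perm.swap i j" "?x i" "?y i"] by (simp only: \<Lambda>_def conj_swap doubled_perm_rep_axis lact_simps)
  have \<Lambda>_nth: "\<Lambda> (Perm.apply g i) (Perm.apply g j) $ Inl (Perm.apply g m) = \<Lambda> i j $ Inl m"
    "\<Lambda> (Perm.apply g i) (Perm.apply g j) $ Inr (Perm.apply g m) = \<Lambda> i j $ Inr m" for g i j m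
    unfolding \<Lambda>_perm by simp_all
  have \<Lambda>_fix: "\<Lambda> i j $ Inl i = \<Lambda> i j $ Inl j" "\<Lambda> i j $ Inr i = \<Lambda> i j $ Inr j" for i j
    using fixed[of "Perm.swap i j" "?x i" "?y i"] unfolding \<Lambda>_def[symmetric] swap_fixed_point by blast+
  define a where "a = \<Lambda> i0 j0 $ Inl i0"
  define a' where "a' = \<Lambda> i0 j0 $ Inl k0"
  define b where "b = \<Lambda> i0 j0 $ Inr i0"
  define b' where "b' = \<Lambda> i0 j0 $ Inr k0"
  have \<Lambda>_eq: "\<Lambda> i j = kappa_vec a a' b b' i j" if ij: "i \<noteq> j" for i j
  proof -
    obtain g where g: "Perm.apply g i0 = i" "Perm.apply g j0 = j" using perm_pair d0(1) ij by metis
    have i: "\<Lambda> i j $ Inl i = a" "\<Lambda> i j $ Inr i = b"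
      using \<Lambda>_nth[of g i0 j0 i0] g unfolding a_def b_def by simp_all
    have k: "\<Lambda> i j $ Inl m = a' \<and> \<Lambda> i j $ Inr m = b'" if m: "m \<noteq> i" "m \<noteq> j" for m
    proof -
      obtain g where g: "Perm.apply g i0 = i" "Perm.apply g j0 = j" "Perm.apply g k0 = m"
        using perm_triple[of i0 j0 k0 i j m] d0 ij m by metis
      then show ?thesis using \<Lambda>_nth[of g i0 j0 k0] unfolding a'_def b'_def by simp
    qed
    have "\<Lambda> i j $ p = kappa_vec a a' b b' i j $ p" for p
    proof (cases p)
      case (Inl m)
      then show ?thesis using i k[of m] \<Lambda>_fix[of i j] ij by (cases "m = i"; cases "m = j") (auto simp: kappa_vec_nth)
    next
      case (Inr m)
      then show ?thesis using i k[of m] \<Lambda>_fix[of i j] ij by (cases "m = i"; cases "m = j") (auto simp: kappa_vec_nth)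
    qed
    then show ?thesis by (simp add: vec_eq_iff)
  qed
  have L: "\<kappa>L = kappaL a a' b b'"
  proof (intro ext)
    fix h u v
    show "\<kappa>L h u v = kappaL a a' b b' h u v"
    proof (cases "h = 1")
      case True
      then show ?thesis by (simp add: one kappaL_one)
    next
      case False
      have "\<kappa>L h u v $ p = kappaL a a' b b' h u v $ p" for p
      proof (rule codiff_unique[OF codL kappaL_codiff False])
        fix i j assume "i \<noteq> j" "h = Perm.swap i j"
        then show "\<kappa>L h (?x i) (?y i) $ p = kappaL a a' b b' h (?x i) (?y i) $ p"
          using \<Lambda>_eq[of i j] by (simp add: kappaL_swap_axis \<Lambda>_def)
      qed
      then show ?thesis by (simp add: vec_eq_iff)
    qed
  qed

  define \<delta> where "\<delta> h u v = \<kappa>C h u v - kappaC a a' b b' 0 0 0 h u v" for h u v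
  interpret K: cochain_pair "kappaL a a' b b'" "kappaC a a' b b' 0 0 0" by (rule cochain_pair_kappa)
  have \<delta>_skew: "\<delta> h u v = - \<delta> h v u" for h u v
    using \<kappa>C_skew[of h u v] K.\<kappa>C_skew[of h u v] by (simp add: \<delta>_def)
  have \<delta>_codiff: "codiff h (\<delta> h)" for h
  proof -
    have "cyc (\<lambda>u v w. \<delta> h u v * (doubled_perm_rep h w - w) $ q) u v w = 0" for u v w q
    proof -
      have "2 * cyc (\<lambda>u v w. \<delta> h u v * (doubled_perm_rep h w - w) $ q) u v w =
          (linear_defect h u v w - K.linear_defect h u v w) $ q"
        unfolding linear_defect_def K.linear_defect_def cyc_def \<delta>_def
        unfolding L by (simp add: algebra_simps)
      then show ?thesis unfolding ld kappa_linear_defect by simp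
    qed
    then show ?thesis using \<delta>_skew unfolding codiff_def by blast
  qed
  have \<delta>_inv: "\<delta> (g * h * inverse g) (doubled_perm_rep g u) (doubled_perm_rep g v) = \<delta> h u v" for g h u v
    using invC kappa_invariant[of a a' b b' 0 0 0] unfolding K.invariant_def \<delta>_def by (metis (no_types, lifting))
  have \<delta>_axis: "\<delta> (g * h * inverse g) (axis (lact g p) 1) (axis (lact g q) 1) = \<delta> h (axis p 1) (axis q 1)" for g h p q
    using \<delta>_inv[of g h "axis p 1" "axis q 1"] by (simp only: doubled_perm_rep_axis)
  define c where "c = \<delta> (Perm.swap i0 j0) (?x i0) (?y i0)"
  define \<alpha> where "\<alpha> = \<delta> 1 (?x i0) (?y i0)"
  define \<beta> where "\<beta> = \<delta> 1 (?x i0) (?y j0)"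
  have \<delta>_c: "\<delta> (Perm.swap i j) (?x i) (?y i) = c" if "i \<noteq> j" for i j
  proof -
    obtain g where "Perm.apply g i0 = i" "Perm.apply g j0 = j" using perm_pair d0(1) \<open>i \<noteq> j\<close> by metis
    then show ?thesis
      using \<delta>_axis[of g "Perm.swap i0 j0" "Inl i0" "Inr i0"] by (simp add: conj_swap c_def)
  qed
  have \<delta>_one_axis: "\<delta> 1 (axis (lact g p) 1) (axis (lact g q) 1) = \<delta> 1 (axis p 1) (axis q 1)" for g p q
    using \<delta>_axis[of g 1 p q] by simp
  have \<delta>_one: "\<delta> 1 u v = invform \<alpha> \<beta> u v" for u v
  proof -
    have xx: "\<delta> 1 (?x i) (?x j) = 0" "\<delta> 1 (?y i) (?y j) = 0" for i j
      using \<delta>_one_axis[of "Perm.swap i j" "Inl i" "Inl j"] \<delta>_skew[of 1 "?x i" "?x j"]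
        \<delta>_one_axis[of "Perm.swap i j" "Inr i" "Inr j"] \<delta>_skew[of 1 "?y i" "?y j"]
      by (simp_all add: eq_neg_iff_add_eq_0)
    have xy: "\<delta> 1 (?x i) (?y j) = (if i = j then \<alpha> else \<beta>)" for i j
    proof (cases "i = j")
      case True
      then show ?thesis using \<delta>_one_axis[of "Perm.swap i0 i" "Inl i0" "Inr i0"] by (simp add: \<alpha>_def)
    next
      case False
      obtain g where "Perm.apply g i0 = i" "Perm.apply g j0 = j" using perm_pair d0(1) False by metis
      then show ?thesis using \<delta>_one_axis[of g "Inl i0" "Inr j0"] False by (simp add: \<beta>_def)
    qed
    have basis: "\<delta> 1 (axis p 1) (axis q 1) = invform \<alpha> \<beta> (axis p 1) (axis q 1)" for p q
      by (cases p; cases q) (simp_all add: xx xy invform_axis \<delta>_skew[of 1 "axis (Inr _) 1" "axis (Inl _) 1"])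
    have "\<delta> 1 u v = (\<Sum>p\<in>UNIV. \<Sum>q\<in>UNIV. (u $ p * v $ q) * \<delta> 1 (axis p 1) (axis q 1))"
      by (rule bilinear_expansion) (simp_all add: \<delta>_def \<kappa>C_bilinear K.\<kappa>C_bilinear algebra_simps)
    also have "\<dots> = invform \<alpha> \<beta> u v"
      unfolding basis by (rule bilinear_expansion[symmetric]) (simp_all add: invform_bilinear)
    finally show ?thesis .
  qed
  have C: "\<kappa>C = kappaC a a' b b' c \<alpha> \<beta>"
  proof (intro ext)
    fix h :: "'n perm" and u v :: "complex ^ ('n + 'n)"
    have "kappaC a a' b b' c \<alpha> \<beta> h u v - kappaC a a' b b' 0 0 0 h u v =
        of_bool (h = 1) * invform \<alpha> \<beta> u v + swap_form c h u v"
      by (simp add: kappaC_formula swap_form_def invform_def)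
    moreover have "\<delta> h u v = of_bool (h = 1) * invform \<alpha> \<beta> u v + swap_form c h u v"
    proof (cases "h = 1")
      case True
      then show ?thesis by (simp add: \<delta>_one swap_form_one)
    next
      case False
      have "\<delta> h u v = swap_form c h u v"
        by (rule codiff_unique[OF \<delta>_codiff swap_form_codiff False]) (simp add: \<delta>_c swap_form_axis)
      then show ?thesis using False by simp
    qed
    ultimately have "\<kappa>C h u v - kappaC a a' b b' 0 0 0 h u v =
        kappaC a a' b b' c \<alpha> \<beta> h u v - kappaC a a' b b' 0 0 0 h u v"
      by (simp only: \<delta>_def)
    then show "\<kappa>C h u v = kappaC a a' b b' c \<alpha> \<beta> h u v" by simp
  qed

  let ?n = "of_nat CARD('n) :: complex"
  \<comment> \<open>for \<open>w\<close> fixed by the transposition only one term of the cyclic sum is nonzero\<close>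
  have radical: "invform \<alpha> \<beta> (kappa_vec a a' b b' i0 j0) w = 0"
    if w: "w $ Inl i0 = w $ Inl j0" "w $ Inr i0 = w $ Inr j0" for w
  proof -
    let ?h = "Perm.swap i0 j0"
    have hw: "doubled_perm_rep ?h w = w" using w swap_fixed_point by blast
    have z: "om i0 j0 v w = 0" "om i0 j0 w v = 0" for v by (simp_all add: om_def w)
    have form0: "invform \<alpha> \<beta> 0 v = 0" for v :: "complex ^ ('n + 'n)" by (simp add: invform_def)
    have o: "om i0 j0 (?x i0) (?y i0) = 1" using d0(1) by (simp add: om_axis)
    have "0 = cyc (\<lambda>u v w. invform \<alpha> \<beta> (kappaL a a' b b' ?h u v) (w + doubled_perm_rep ?h w)) (?x i0) (?y i0) w"
      using cd[of ?h "?x i0" "?y i0" w] unfolding L C kappa_constant_defect by simp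
    also have "\<dots> = invform \<alpha> \<beta> (kappa_vec a a' b b' i0 j0) (w + w)"
      using d0(1) by (simp add: form0 cyc_def kappaL_swap z o hw)
    finally have "invform \<alpha> \<beta> (kappa_vec a a' b b' i0 j0) w + invform \<alpha> \<beta> (kappa_vec a a' b b' i0 j0) w = 0"
      by (simp only: invform_bilinear)
    then show ?thesis by simp
  qed
  have r: "(\<alpha> - \<beta>) * (b - b') = 0" "(\<alpha> - \<beta>) * (a - a') = 0"
    "(\<alpha> - \<beta>) * a' + \<beta> * (?n * a' + 2 * (a - a')) = 0"
    "(\<alpha> - \<beta>) * b' + \<beta> * (?n * b' + 2 * (b - b')) = 0"
  proof -
    have s: "(\<Sum>m\<in>UNIV. ?x k $ Inl m) = 1" "(\<Sum>m\<in>UNIV. ?y k $ Inr m) = 1" for k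
      by (simp_all add: axis_def)
    have ko: "k0 \<noteq> j0" "i0 \<noteq> k0" using d0 by auto
    \<comment> \<open>a basis vector of index \<open>k0\<close> isolates the coefficient of the coordinate sum; this uses \<open>n \<ge> 3\<close>\<close>
    show 4: "(\<alpha> - \<beta>) * b' + \<beta> * (?n * b' + 2 * (b - b')) = 0"
      using radical[of "?x k0"] d0 ko unfolding invform_kappa_vec s by (simp add: axis_def neg_eq_iff_add_eq_0)
    show 3: "(\<alpha> - \<beta>) * a' + \<beta> * (?n * a' + 2 * (a - a')) = 0"
      using radical[of "?y k0"] d0 ko unfolding invform_kappa_vec s by (simp add: axis_def neg_eq_iff_add_eq_0)
    show "(\<alpha> - \<beta>) * (b - b') = 0"
      using radical[of "?x i0 + ?x j0"] d0 unfolding invform_kappa_vec 3 4 by (auto simp: axis_def)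
    show "(\<alpha> - \<beta>) * (a - a') = 0"
      using radical[of "?y i0 + ?y j0"] d0 unfolding invform_kappa_vec 3 4 by (auto simp: axis_def)
  qed
  have "\<alpha> * x + \<beta> * (x + (?n - 2) * y) = (\<alpha> - \<beta>) * (x - y) + ((\<alpha> - \<beta>) * y + \<beta> * (?n * y + 2 * (x - y)))"
    "\<alpha> * y + \<beta> * (2 * x + (?n - 3) * y) = (\<alpha> - \<beta>) * y + \<beta> * (?n * y + 2 * (x - y))" for x y
    by (simp_all add: algebra_simps)
  then have "parameter_eqs CARD('n) a a' b b' \<alpha> \<beta>"
    unfolding parameter_eqs_def by (simp only: r add_0_left simp_thms)
  then show ?thesis using L C by blast
qed

theorem theorem7p2:
  assumes "CARD('n::finite) \<ge> 3"
  shows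
    "(\<forall>a a' b b' c \<alpha> \<beta>. parameter_eqs CARD('n) a a' b b' \<alpha> \<beta> \<longrightarrow>
        drinfeld_orbifold_algebra_t (doubled_perm_rep :: 'n perm \<Rightarrow> _)
          (kappaL a a' b b') (kappaC a a' b b' c \<alpha> \<beta>)
          (Ht_alg doubled_perm_rep
             (kappaL a a' b b') (kappaC a a' b b' c \<alpha> \<beta>) xy_basis)) \<and>
     {(kappaL a a' b b', kappaC a a' b b' c \<alpha> \<beta>,
       Ht_specialization (doubled_perm_rep :: 'n perm \<Rightarrow> _)
         (kappaL a a' b b') (kappaC a a' b b' c \<alpha> \<beta>) xy_basis 1) |
        a a' b b' c \<alpha> \<beta>. parameter_eqs CARD('n) a a' b b' \<alpha> \<beta>}
     = {(\<kappa>L, \<kappa>C, H_alg doubled_perm_rep \<kappa>L \<kappa>C) | \<kappa>L \<kappa>C.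
          drinfeld_orbifold_algebra (doubled_perm_rep :: 'n perm \<Rightarrow> _) \<kappa>L \<kappa>C \<and>
          (\<forall>g u v. \<kappa>L g u v \<in> fixed_space doubled_perm_rep g) \<and>
          (\<forall>u v. \<kappa>L 1 u v = 0)}"
proof -
  have drin: "drinfeld_orbifold_algebra (doubled_perm_rep :: 'n perm \<Rightarrow> _) (kappaL a a' b b') (kappaC a a' b b' c \<alpha> \<beta>)"
    if "parameter_eqs CARD('n) a a' b b' \<alpha> \<beta>" for a a' b b' c \<alpha> \<beta>
    using kappa_pbw[OF that] cochain_pair.drinfeld_iff_conditions[OF cochain_pair_kappa] by blast
  have Ht: "Ht_alg (doubled_perm_rep :: 'n perm \<Rightarrow> _) (kappaL a a' b b') (kappaC a a' b b' c \<alpha> \<beta>) xy_basis =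
      Ht_alg doubled_perm_rep (kappaL a a' b b') (kappaC a a' b b' c \<alpha> \<beta>) UNIV"
    and spec: "Ht_specialization (doubled_perm_rep :: 'n perm \<Rightarrow> _)
      (kappaL a a' b b') (kappaC a a' b b' c \<alpha> \<beta>) xy_basis 1 =
      H_alg doubled_perm_rep (kappaL a a' b b') (kappaC a a' b b' c \<alpha> \<beta>)" for a a' b b' c \<alpha> \<beta>
    by (rule cochain_pair.Ht_alg_basis[OF cochain_pair_kappa]
        cochain_pair.specialization_at_one[OF cochain_pair_kappa])+
  have classify: "\<exists>a a' b b' c \<alpha> \<beta>. parameter_eqs CARD('n) a a' b b' \<alpha> \<beta> \<and>
      \<kappa>L = kappaL a a' b b' \<and> \<kappa>C = kappaC a a' b b' c \<alpha> \<beta>"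
    if d: "drinfeld_orbifold_algebra (doubled_perm_rep :: 'n perm \<Rightarrow> _) \<kappa>L \<kappa>C"
      and f: "\<forall>g u v. \<kappa>L g u v \<in> fixed_space doubled_perm_rep g" and o: "\<forall>u v. \<kappa>L 1 u v = 0" for \<kappa>L \<kappa>C
  proof -
    have pair: "cochain_pair \<kappa>L \<kappa>C"
      using d unfolding drinfeld_orbifold_algebra_def by (intro cochain_pair.intro) blast+
    have "cochain_pair.pbw_conditions \<kappa>L \<kappa>C"
      using d cochain_pair.drinfeld_iff_conditions[OF pair] by blast
    then show ?thesis
      using f o by (intro classification[OF assms pair]) (simp_all add: fixed_space_def)
  qed
  have fixd: "kappaL a a' b b' g u v \<in> fixed_space doubled_perm_rep g" for a a' b b' and g :: "'n perm" and u v
    by (simp add: fixed_space_def kappaL_fixed)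
  show ?thesis
  proof (intro conjI allI impI)
    fix a a' b b' c \<alpha> \<beta> assume "parameter_eqs CARD('n) a a' b b' \<alpha> \<beta>"
    then show "drinfeld_orbifold_algebra_t (doubled_perm_rep :: 'n perm \<Rightarrow> _)
          (kappaL a a' b b') (kappaC a a' b b' c \<alpha> \<beta>)
          (Ht_alg doubled_perm_rep (kappaL a a' b b') (kappaC a a' b b' c \<alpha> \<beta>) xy_basis)"
      unfolding drinfeld_orbifold_algebra_t_def using drin Ht by blast
  next
    show "{(kappaL a a' b b', kappaC a a' b b' c \<alpha> \<beta>,
       Ht_specialization (doubled_perm_rep :: 'n perm \<Rightarrow> _)
         (kappaL a a' b b') (kappaC a a' b b' c \<alpha> \<beta>) xy_basis 1) |
        a a' b b' c \<alpha> \<beta>. parameter_eqs CARD('n) a a' b b' \<alpha> \<beta>}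
     = {(\<kappa>L, \<kappa>C, H_alg doubled_perm_rep \<kappa>L \<kappa>C) | \<kappa>L \<kappa>C.
          drinfeld_orbifold_algebra (doubled_perm_rep :: 'n perm \<Rightarrow> _) \<kappa>L \<kappa>C \<and>
          (\<forall>g u v. \<kappa>L g u v \<in> fixed_space doubled_perm_rep g) \<and>
          (\<forall>u v. \<kappa>L 1 u v = 0)}"
      unfolding spec
    proof (intro subset_antisym subsetI)
      fix z
      assume "z \<in> {(kappaL a a' b b' :: 'n perm \<Rightarrow> _, kappaC a a' b b' c \<alpha> \<beta> :: 'n perm \<Rightarrow> _,
         H_alg (doubled_perm_rep :: 'n perm \<Rightarrow> _) (kappaL a a' b b') (kappaC a a' b b' c \<alpha> \<beta>)) |
          a a' b b' c \<alpha> \<beta>. parameter_eqs CARD('n) a a' b b' \<alpha> \<beta>}"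
      then obtain a a' b b' c \<alpha> \<beta> where z: "z = (kappaL a a' b b' :: 'n perm \<Rightarrow> _, kappaC a a' b b' c \<alpha> \<beta> :: 'n perm \<Rightarrow> _,
          H_alg (doubled_perm_rep :: 'n perm \<Rightarrow> _) (kappaL a a' b b') (kappaC a a' b b' c \<alpha> \<beta>))"
        and eqs: "parameter_eqs CARD('n) a a' b b' \<alpha> \<beta>"
        unfolding mem_Collect_eq by (elim exE conjE)
      show "z \<in> {(\<kappa>L, \<kappa>C, H_alg doubled_perm_rep \<kappa>L \<kappa>C) | \<kappa>L \<kappa>C.
          drinfeld_orbifold_algebra (doubled_perm_rep :: 'n perm \<Rightarrow> _) \<kappa>L \<kappa>C \<and>
          (\<forall>g u v. \<kappa>L g u v \<in> fixed_space doubled_perm_rep g) \<and>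
          (\<forall>u v. \<kappa>L 1 u v = 0)}"
        unfolding mem_Collect_eq
        by (intro exI conjI allI, rule z, rule drin[OF eqs], rule fixd, rule kappaL_one)
    next
      fix z
      assume "z \<in> {(\<kappa>L, \<kappa>C, H_alg doubled_perm_rep \<kappa>L \<kappa>C) | \<kappa>L \<kappa>C.
          drinfeld_orbifold_algebra (doubled_perm_rep :: 'n perm \<Rightarrow> _) \<kappa>L \<kappa>C \<and>
          (\<forall>g u v. \<kappa>L g u v \<in> fixed_space doubled_perm_rep g) \<and>
          (\<forall>u v. \<kappa>L 1 u v = 0)}"
      then obtain \<kappa>L \<kappa>C where z: "z = (\<kappa>L, \<kappa>C, H_alg doubled_perm_rep \<kappa>L \<kappa>C)"
        and K: "drinfeld_orbifold_algebra (doubled_perm_rep :: 'n perm \<Rightarrow> _) \<kappa>L \<kappa>C"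
          "\<forall>g u v. \<kappa>L g u v \<in> fixed_space doubled_perm_rep g" "\<forall>u v. \<kappa>L 1 u v = 0"
        unfolding mem_Collect_eq by (elim exE conjE)
      obtain a a' b b' c \<alpha> \<beta> where eqs: "parameter_eqs CARD('n) a a' b b' \<alpha> \<beta>"
        and L: "\<kappa>L = kappaL a a' b b'" and C: "\<kappa>C = kappaC a a' b b' c \<alpha> \<beta>"
        using classify[OF K] by (elim exE conjE)
      show "z \<in> {(kappaL a a' b b' :: 'n perm \<Rightarrow> _, kappaC a a' b b' c \<alpha> \<beta> :: 'n perm \<Rightarrow> _,
         H_alg (doubled_perm_rep :: 'n perm \<Rightarrow> _) (kappaL a a' b b') (kappaC a a' b b' c \<alpha> \<beta>)) |
          a a' b b' c \<alpha> \<beta>. parameter_eqs CARD('n) a a' b b' \<alpha> \<beta>}"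
        unfolding mem_Collect_eq z L C by (intro exI conjI, rule refl, rule eqs)
    qed
  qed
qed

end
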